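(* Suppose that $\mathbb{T}\times G^{(0)}\overset{\iota}{\to}E\overset{\pi}{\to}G$ is a topological twist over a Lie groupoid $G$, that $\{(U_\alpha,\varphi_\alpha)\}_{\alpha\in\mathfrak{A}}$ is a smooth atlas of $G$, and that $\{\sigma_\alpha:U_\alpha\to\pi^{-1}(U_\alpha)\}_{\alpha\in\mathfrak{A}}$ is a family of continuous sections of $\pi$. Suppose that for all $\alpha,\alpha'\in\mathfrak{A}$ the map $$U_\alpha\cap U_{\alpha'}\to\mathbb{T}\times G^{(0)},\qquad\gamma\mapsto\iota^{-1}\big(\sigma_\alpha(\gamma)\sigma_{\alpha'}(\gamma)^{-1}\big)$$ is smooth. Then: (1) there is a unique smooth structure on the topological space $E$ with respect to which $\pi:E\to G$ is a smooth principal $\mathbb{T}$-bundle and all the $\sigma_\alpha$ are smooth; and, with respect to this smooth structure on $E$, (2) $\pi^{-1}(G^{(0)})$ is an embedded submanifold of $E$; and (3) if $p:S\to G$ is another smooth principal $\mathbb{T}$-bundle and $f:E\to S$ is a continuous bundle map (that is, $p\circ f=\pi$) that is $\mathbb{T}$-equivariant, then $f$ is smooth if and only if $f\circ\sigma_\alpha:U_\alpha\to S$ is smooth for each $\alpha\in\mathfrak{A}$.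
   Context: "Manifold" means smooth manifold: Hausdorff, second-countable, locally Euclidean, with a maximal smooth atlas; smooth structures are compatible with the given topology and uniqueness is as maximal atlases. A smooth atlas is a cover by pairwise smoothly compatible charts. All groupoids are locally compact Hausdorff topological groupoids with unit space $G^{(0)}\subseteq G$, continuous surjective range and source maps $r,s:G\to G^{(0)}$, and continuous composition and inversion. A Lie groupoid is a topological groupoid such that $G,G^{(0)}$ are manifolds, $G^{(0)}\hookrightarrow G$ is a smooth embedding, $r,s$ are submersions, and composition and inversion are smooth. A topological twist over $G$ consists of a locally compact Hausdorff groupoid $E$ and groupoid homomorphisms $\iota:\mathbb{T}\times G^{(0)}\to E$ (where $\mathbb{T}\times G^{(0)}$ is the trivial group bundle) and $\pi:E\to G$ such that $\iota$ is a homeomorphism onto $\pi^{-1}(G^{(0)})$ with $\iota(1,\pi(y))=y$ for $y\in E^{(0)}$; $\pi$ is a continuous open surjection; and $\iota(z,\pi(r(e)))e=e\,\iota(z,\pi(s(e)))$ for all $e\in E$, $z\in\mathbb{T}$. Units of $E$ are identified with units of $G$ via $\pi$. $\mathbb{T}$ acts on $E$ by $z\cdot e=\iota(z,r(e))e$. A smooth principal $\mathbb{T}$-bundle $p:S\to M$ consists of manifolds $S,M$, a smooth map $p$, and a smooth action of $\mathbb{T}$ on $S$, free and transitive on each fibre, such that $M$ has an open cover by sets $U$ admitting $\mathbb{T}$-equivariant diffeomorphisms $p^{-1}(U)\to\mathbb{T}\times U$ over $U$. The action on $E$ is the one above. $\mathbb{T}$ carries its usual Lie group structure. *)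

theory Defs
  imports "HOL-Analysis.Analysis"
begin

section \<open>Smooth maps between open subsets of Euclidean spaces\<close>

text \<open>
  The model space of dimension \<open>n\<close> is the library's \<^const>\<open>Euclidean_space\<close> \<open>n\<close>: the points
  \<open>x :: nat \<Rightarrow> real\<close> with \<open>x i = 0\<close> for all \<open>i \<ge> n\<close>. Thus dimensions are numbers, not types.
\<close>

definition partial_deriv :: "nat \<Rightarrow> ((nat \<Rightarrow> real) \<Rightarrow> real) \<Rightarrow> (nat \<Rightarrow> real) \<Rightarrow> real" where
  "partial_deriv i f x = deriv (\<lambda>t. f (x(i := t))) (x i)"

text \<open>\<open>C_diff k n W f\<close>: all partial derivatives of \<open>f\<close> of order at most \<open>k\<close> exist and are
  continuous on \<open>W\<close>. It is only used for \<open>W\<close> open in \<open>Euclidean_space n\<close>.\<close>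

primrec C_diff :: "nat \<Rightarrow> nat \<Rightarrow> (nat \<Rightarrow> real) set \<Rightarrow> ((nat \<Rightarrow> real) \<Rightarrow> real) \<Rightarrow> bool" where
  "C_diff 0 n W f \<longleftrightarrow> continuous_map (subtopology (Euclidean_space n) W) euclideanreal f"
| "C_diff (Suc k) n W f \<longleftrightarrow>
     continuous_map (subtopology (Euclidean_space n) W) euclideanreal f \<and>
     (\<forall>i<n. (\<forall>x\<in>W. (\<lambda>t. f (x(i := t))) differentiable (at (x i))) \<and>
            C_diff k n W (partial_deriv i f))"

definition smooth_eucl ::
    "nat \<Rightarrow> nat \<Rightarrow> (nat \<Rightarrow> real) set \<Rightarrow> ((nat \<Rightarrow> real) \<Rightarrow> nat \<Rightarrow> real) \<Rightarrow> bool" where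
  "smooth_eucl n m W F \<longleftrightarrow>
     openin (Euclidean_space n) W \<and> F \<in> W \<rightarrow> topspace (Euclidean_space m) \<and>
     (\<forall>j<m. \<forall>k. C_diff k n W (\<lambda>x. F x j))"

text \<open>The Jacobian matrix of \<open>F\<close> at \<open>x\<close>, acting on \<open>v\<close>.\<close>

definition differential ::
    "nat \<Rightarrow> nat \<Rightarrow> ((nat \<Rightarrow> real) \<Rightarrow> nat \<Rightarrow> real) \<Rightarrow> (nat \<Rightarrow> real) \<Rightarrow> (nat \<Rightarrow> real) \<Rightarrow> nat \<Rightarrow> real" where
  "differential n m F x v =
     (\<lambda>j. if j < m then \<Sum>i<n. partial_deriv i (\<lambda>y. F y j) x * v i else 0)"


section \<open>Smooth manifolds\<close>

text \<open>
  A chart is a triple of its dimension, its domain and its coordinate map; the values of the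
  coordinate map outside the domain are irrelevant. The dimension belongs to the chart, so
  different components of a manifold may have different dimensions.
\<close>

type_synonym 'a chart = "nat \<times> 'a set \<times> ('a \<Rightarrow> nat \<Rightarrow> real)"

abbreviation chart_dim :: "'a chart \<Rightarrow> nat" where "chart_dim c \<equiv> fst c"
abbreviation chart_dom :: "'a chart \<Rightarrow> 'a set" where "chart_dom c \<equiv> fst (snd c)"
abbreviation chart_map :: "'a chart \<Rightarrow> 'a \<Rightarrow> nat \<Rightarrow> real" where "chart_map c \<equiv> snd (snd c)"

definition chart_of :: "'a topology \<Rightarrow> 'a chart \<Rightarrow> bool" where
  "chart_of X c \<longleftrightarrow>
     openin X (chart_dom c) \<and>
     openin (Euclidean_space (chart_dim c)) (chart_map c ` chart_dom c) \<and>
     homeomorphic_map (subtopology X (chart_dom c))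
       (subtopology (Euclidean_space (chart_dim c)) (chart_map c ` chart_dom c)) (chart_map c)"

definition coord_rep ::
    "'a chart \<Rightarrow> 'b chart \<Rightarrow> ('a \<Rightarrow> 'b) \<Rightarrow> (nat \<Rightarrow> real) \<Rightarrow> nat \<Rightarrow> real" where
  "coord_rep c d f = (\<lambda>x. chart_map d (f (inv_into (chart_dom c) (chart_map c) x)))"

definition smooth_transition :: "'a chart \<Rightarrow> 'a chart \<Rightarrow> bool" where
  "smooth_transition c d \<longleftrightarrow>
     smooth_eucl (chart_dim c) (chart_dim d) (chart_map c ` (chart_dom c \<inter> chart_dom d))
       (coord_rep c d (\<lambda>x. x))"

definition smoothly_compatible :: "'a chart \<Rightarrow> 'a chart \<Rightarrow> bool" where
  "smoothly_compatible c d \<longleftrightarrow> smooth_transition c d \<and> smooth_transition d c"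

definition smooth_atlas :: "'a topology \<Rightarrow> 'a chart set \<Rightarrow> bool" where
  "smooth_atlas X A \<longleftrightarrow>
     (\<forall>c\<in>A. chart_of X c) \<and> (\<Union>c\<in>A. chart_dom c) = topspace X \<and>
     (\<forall>c\<in>A. \<forall>d\<in>A. smoothly_compatible c d)"

text \<open>For a smooth atlas \<open>A\<close> this is the unique maximal smooth atlas containing \<open>A\<close>.\<close>

definition generated_structure :: "'a topology \<Rightarrow> 'a chart set \<Rightarrow> 'a chart set" where
  "generated_structure X A = {c. chart_of X c \<and> (\<forall>d\<in>A. smoothly_compatible c d)}"

definition second_countable_space :: "'a topology \<Rightarrow> bool" where
  "second_countable_space X \<longleftrightarrow>
     (\<exists>B. countable B \<and> (\<forall>V\<in>B. openin X V) \<and>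
          (\<forall>V. openin X V \<longrightarrow> (\<exists>B'\<subseteq>B. \<Union>B' = V)))"

type_synonym 'a mfd = "'a topology \<times> 'a chart set"

definition smooth_manifold :: "'a mfd \<Rightarrow> bool" where
  "smooth_manifold M \<longleftrightarrow>
     Hausdorff_space (fst M) \<and> second_countable_space (fst M) \<and>
     smooth_atlas (fst M) (snd M) \<and>
     (\<forall>A. smooth_atlas (fst M) A \<and> snd M \<subseteq> A \<longrightarrow> A = snd M)"

definition open_submfd :: "'a mfd \<Rightarrow> 'a set \<Rightarrow> 'a mfd" where
  "open_submfd M U = (subtopology (fst M) U, {c \<in> snd M. chart_dom c \<subseteq> U})"

definition prod_chart :: "'a chart \<Rightarrow> 'b chart \<Rightarrow> ('a \<times> 'b) chart" where
  "prod_chart c d =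
     (chart_dim c + chart_dim d, chart_dom c \<times> chart_dom d,
      \<lambda>(x, y) i. if i < chart_dim c then chart_map c x i else chart_map d y (i - chart_dim c))"

definition prod_mfd :: "'a mfd \<Rightarrow> 'b mfd \<Rightarrow> ('a \<times> 'b) mfd" where
  "prod_mfd M N =
     (prod_topology (fst M) (fst N),
      generated_structure (prod_topology (fst M) (fst N))
        {prod_chart c d | c d. c \<in> snd M \<and> d \<in> snd N})"

text \<open>Charts that represent \<open>f\<close> near \<open>p\<close>.\<close>

definition adapted_charts ::
    "'a mfd \<Rightarrow> 'b mfd \<Rightarrow> ('a \<Rightarrow> 'b) \<Rightarrow> 'a \<Rightarrow> 'a chart \<Rightarrow> 'b chart \<Rightarrow> bool" where
  "adapted_charts M N f p c d \<longleftrightarrow>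
     c \<in> snd M \<and> d \<in> snd N \<and> p \<in> chart_dom c \<and> f ` chart_dom c \<subseteq> chart_dom d"

definition smooth_map :: "'a mfd \<Rightarrow> 'b mfd \<Rightarrow> ('a \<Rightarrow> 'b) \<Rightarrow> bool" where
  "smooth_map M N f \<longleftrightarrow>
     f \<in> topspace (fst M) \<rightarrow> topspace (fst N) \<and>
     (\<forall>p\<in>topspace (fst M). \<exists>c d. adapted_charts M N f p c d \<and>
        smooth_eucl (chart_dim c) (chart_dim d) (chart_map c ` chart_dom c) (coord_rep c d f))"

definition diffeomorphism :: "'a mfd \<Rightarrow> 'b mfd \<Rightarrow> ('a \<Rightarrow> 'b) \<Rightarrow> bool" where
  "diffeomorphism M N f \<longleftrightarrow>
     bij_betw f (topspace (fst M)) (topspace (fst N)) \<and>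
     smooth_map M N f \<and> smooth_map N M (inv_into (topspace (fst M)) f)"

text \<open>Injectivity and surjectivity of the differential at a point do not depend on the charts
  in which it is computed, so one pair of charts at each point suffices.\<close>

definition immersion :: "'a mfd \<Rightarrow> 'b mfd \<Rightarrow> ('a \<Rightarrow> 'b) \<Rightarrow> bool" where
  "immersion M N f \<longleftrightarrow> smooth_map M N f \<and>
     (\<forall>p\<in>topspace (fst M). \<exists>c d. adapted_charts M N f p c d \<and>
        inj_on (differential (chart_dim c) (chart_dim d) (coord_rep c d f) (chart_map c p))
          (topspace (Euclidean_space (chart_dim c))))"

definition submersion :: "'a mfd \<Rightarrow> 'b mfd \<Rightarrow> ('a \<Rightarrow> 'b) \<Rightarrow> bool" where
  "submersion M N f \<longleftrightarrow> smooth_map M N f \<and>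
     (\<forall>p\<in>topspace (fst M). \<exists>c d. adapted_charts M N f p c d \<and>
        differential (chart_dim c) (chart_dim d) (coord_rep c d f) (chart_map c p) `
          topspace (Euclidean_space (chart_dim c)) = topspace (Euclidean_space (chart_dim d)))"

definition smooth_embedding :: "'a mfd \<Rightarrow> 'b mfd \<Rightarrow> ('a \<Rightarrow> 'b) \<Rightarrow> bool" where
  "smooth_embedding M N f \<longleftrightarrow> immersion M N f \<and> embedding_map (fst M) (fst N) f"

text \<open>\<open>A\<close> is a smooth structure on the subspace \<open>W\<close> of \<open>M\<close> for which the inclusion of \<open>W\<close> is a
  smooth embedding. There is at most one such \<open>A\<close>.\<close>

definition embedded_structure :: "'a mfd \<Rightarrow> 'a set \<Rightarrow> 'a chart set \<Rightarrow> bool" where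
  "embedded_structure M W A \<longleftrightarrow>
     W \<subseteq> topspace (fst M) \<and> smooth_manifold (subtopology (fst M) W, A) \<and>
     smooth_embedding (subtopology (fst M) W, A) M (\<lambda>x. x)"

definition embedded_submanifold :: "'a mfd \<Rightarrow> 'a set \<Rightarrow> bool" where
  "embedded_submanifold M W \<longleftrightarrow> (\<exists>A. embedded_structure M W A)"


section \<open>The circle\<close>

abbreviation circle :: "complex set" where "circle \<equiv> sphere 0 1"

text \<open>The charts are the local inverses of \<open>\<theta> \<mapsto> exp (i \<theta>)\<close>.\<close>

definition circle_atlas :: "complex chart set" where
  "circle_atlas =
     {(1, cis ` {a<..<b}, \<lambda>z i. if i = 0 then the_inv_into {a<..<b} cis z else 0) | a b.
        a < b \<and> b - a \<le> 2 * pi}"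

definition circle_mfd :: "complex mfd" where
  "circle_mfd = (top_of_set circle, generated_structure (top_of_set circle) circle_atlas)"


section \<open>Topological groupoids and Lie groupoids\<close>

text \<open>The underlying set is the underlying set of the topology. All operations are total
  functions, of which only the values on that set, and on composable pairs, matter.\<close>

record 'g groupoid =
  gtop :: "'g topology"
  units :: "'g set"
  rng :: "'g \<Rightarrow> 'g"
  src :: "'g \<Rightarrow> 'g"
  mul :: "'g \<Rightarrow> 'g \<Rightarrow> 'g"
  ginv :: "'g \<Rightarrow> 'g"

abbreviation arrows :: "'g groupoid \<Rightarrow> 'g set" where "arrows G \<equiv> topspace (gtop G)"

abbreviation unit_top :: "'g groupoid \<Rightarrow> 'g topology" where
  "unit_top G \<equiv> subtopology (gtop G) (units G)"

definition composable :: "'g groupoid \<Rightarrow> ('g \<times> 'g) set" where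
  "composable G = {(x, y). x \<in> arrows G \<and> y \<in> arrows G \<and> src G x = rng G y}"

definition algebraic_groupoid :: "'g groupoid \<Rightarrow> bool" where
  "algebraic_groupoid G \<longleftrightarrow>
     units G \<subseteq> arrows G \<and>
     rng G \<in> arrows G \<rightarrow> units G \<and> src G \<in> arrows G \<rightarrow> units G \<and>
     (\<forall>u\<in>units G. rng G u = u \<and> src G u = u) \<and>
     (\<forall>(x, y)\<in>composable G. mul G x y \<in> arrows G \<and>
        rng G (mul G x y) = rng G x \<and> src G (mul G x y) = src G y) \<and>
     (\<forall>x y z. (x, y) \<in> composable G \<and> (y, z) \<in> composable G \<longrightarrow>
        mul G (mul G x y) z = mul G x (mul G y z)) \<and>
     (\<forall>x\<in>arrows G. mul G (rng G x) x = x \<and> mul G x (src G x) = x) \<and>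
     (\<forall>x\<in>arrows G. ginv G x \<in> arrows G \<and>
        rng G (ginv G x) = src G x \<and> src G (ginv G x) = rng G x \<and>
        mul G x (ginv G x) = rng G x \<and> mul G (ginv G x) x = src G x)"

definition topological_groupoid :: "'g groupoid \<Rightarrow> bool" where
  "topological_groupoid G \<longleftrightarrow>
     algebraic_groupoid G \<and>
     locally_compact_space (gtop G) \<and> Hausdorff_space (gtop G) \<and>
     continuous_map (gtop G) (unit_top G) (rng G) \<and>
     continuous_map (gtop G) (unit_top G) (src G) \<and>
     continuous_map (subtopology (prod_topology (gtop G) (gtop G)) (composable G)) (gtop G)
       (\<lambda>(x, y). mul G x y) \<and>
     continuous_map (gtop G) (gtop G) (ginv G)"

definition groupoid_hom :: "'g groupoid \<Rightarrow> 'h groupoid \<Rightarrow> ('g \<Rightarrow> 'h) \<Rightarrow> bool" where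
  "groupoid_hom G H f \<longleftrightarrow>
     f \<in> arrows G \<rightarrow> arrows H \<and>
     (\<forall>(x, y)\<in>composable G. (f x, f y) \<in> composable H \<and> f (mul G x y) = mul H (f x) (f y))"

text \<open>\<open>lie_groupoid G A A0\<close>: the topological groupoid \<open>G\<close> is a Lie groupoid for the smooth
  structures \<open>A\<close> on \<open>G\<close> and \<open>A0\<close> on its unit space. As range and source are submersions, the
  composable pairs form an embedded submanifold of \<open>G \<times> G\<close>, and composition is required to be
  smooth for the (unique) corresponding smooth structure.\<close>

definition lie_groupoid :: "'g groupoid \<Rightarrow> 'g chart set \<Rightarrow> 'g chart set \<Rightarrow> bool" where
  "lie_groupoid G A A0 \<longleftrightarrow>
     topological_groupoid G \<and>
     smooth_manifold (gtop G, A) \<and> smooth_manifold (unit_top G, A0) \<and>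
     smooth_embedding (unit_top G, A0) (gtop G, A) (\<lambda>u. u) \<and>
     submersion (gtop G, A) (unit_top G, A0) (rng G) \<and>
     submersion (gtop G, A) (unit_top G, A0) (src G) \<and>
     (\<exists>A2. embedded_structure (prod_mfd (gtop G, A) (gtop G, A)) (composable G) A2 \<and>
        smooth_map (subtopology (prod_topology (gtop G) (gtop G)) (composable G), A2) (gtop G, A)
          (\<lambda>(x, y). mul G x y)) \<and>
     smooth_map (gtop G, A) (gtop G, A) (ginv G)"


section \<open>Topological twists\<close>

definition trivial_circle_bundle :: "'g groupoid \<Rightarrow> (complex \<times> 'g) groupoid" where
  "trivial_circle_bundle G =
     \<lparr>gtop = prod_topology (top_of_set circle) (unit_top G),
      units = {1} \<times> units G,
      rng = (\<lambda>(z, u). (1, u)),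
      src = (\<lambda>(z, u). (1, u)),
      mul = (\<lambda>(z, u) (w, v). (z * w, u)),
      ginv = (\<lambda>(z, u). (inverse z, u))\<rparr>"

definition preim :: "'e groupoid \<Rightarrow> ('e \<Rightarrow> 'g) \<Rightarrow> 'g set \<Rightarrow> 'e set" where
  "preim E \<pi> V = {e \<in> arrows E. \<pi> e \<in> V}"

definition topological_twist ::
    "'g groupoid \<Rightarrow> 'e groupoid \<Rightarrow> (complex \<times> 'g \<Rightarrow> 'e) \<Rightarrow> ('e \<Rightarrow> 'g) \<Rightarrow> bool" where
  "topological_twist G E \<iota> \<pi> \<longleftrightarrow>
     topological_groupoid G \<and> topological_groupoid E \<and>
     groupoid_hom (trivial_circle_bundle G) E \<iota> \<and>
     groupoid_hom E G \<pi> \<and>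
     homeomorphic_map (gtop (trivial_circle_bundle G))
       (subtopology (gtop E) (preim E \<pi> (units G))) \<iota> \<and>
     (\<forall>y\<in>units E. \<iota> (1, \<pi> y) = y) \<and>
     continuous_map (gtop E) (gtop G) \<pi> \<and> open_map (gtop E) (gtop G) \<pi> \<and>
     \<pi> ` arrows E = arrows G \<and>
     (\<forall>e\<in>arrows E. \<forall>z\<in>circle.
        mul E (\<iota> (z, \<pi> (rng E e))) e = mul E e (\<iota> (z, \<pi> (src E e))))"

text \<open>The action \<open>z \<cdot> e = \<iota>(z, r(e)) e\<close>, with the unit \<open>r(e)\<close> of \<open>E\<close> regarded as the unit
  \<open>\<pi>(r(e))\<close> of \<open>G\<close>.\<close>

definition twist_action ::
    "'e groupoid \<Rightarrow> (complex \<times> 'g \<Rightarrow> 'e) \<Rightarrow> ('e \<Rightarrow> 'g) \<Rightarrow> complex \<Rightarrow> 'e \<Rightarrow> 'e" where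
  "twist_action E \<iota> \<pi> z e = mul E (\<iota> (z, \<pi> (rng E e))) e"


section \<open>Smooth principal circle bundles\<close>

text \<open>\<open>\<Phi>\<close> is an equivariant diffeomorphism from \<open>p\<^sup>-\<^sup>1(U)\<close> onto \<open>\<T> \<times> U\<close> over \<open>U\<close>, where
  \<open>\<T>\<close> acts on \<open>\<T> \<times> U\<close> by multiplication on the first factor.\<close>

definition local_trivialization ::
    "'s mfd \<Rightarrow> 'm mfd \<Rightarrow> ('s \<Rightarrow> 'm) \<Rightarrow> (complex \<Rightarrow> 's \<Rightarrow> 's) \<Rightarrow> 'm set \<Rightarrow>
     ('s \<Rightarrow> complex \<times> 'm) \<Rightarrow> bool" where
  "local_trivialization S M p act U \<Phi> \<longleftrightarrow>
     (let P = {x \<in> topspace (fst S). p x \<in> U} in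
        diffeomorphism (open_submfd S P) (prod_mfd circle_mfd (open_submfd M U)) \<Phi> \<and>
        (\<forall>x\<in>P. snd (\<Phi> x) = p x) \<and>
        (\<forall>z\<in>circle. \<forall>x\<in>P. \<Phi> (act z x) = (z * fst (\<Phi> x), snd (\<Phi> x))))"

definition smooth_principal_circle_bundle ::
    "'s mfd \<Rightarrow> 'm mfd \<Rightarrow> ('s \<Rightarrow> 'm) \<Rightarrow> (complex \<Rightarrow> 's \<Rightarrow> 's) \<Rightarrow> bool" where
  "smooth_principal_circle_bundle S M p act \<longleftrightarrow>
     smooth_manifold S \<and> smooth_manifold M \<and> smooth_map S M p \<and>
     smooth_map (prod_mfd circle_mfd S) S (\<lambda>(z, x). act z x) \<and>
     (\<forall>x\<in>topspace (fst S). act 1 x = x) \<and>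
     (\<forall>z\<in>circle. \<forall>w\<in>circle. \<forall>x\<in>topspace (fst S). act (z * w) x = act z (act w x)) \<and>
     (\<forall>z\<in>circle. \<forall>x\<in>topspace (fst S). p (act z x) = p x) \<and>
     (\<forall>x\<in>topspace (fst S). \<forall>y\<in>topspace (fst S). p x = p y \<longrightarrow> (\<exists>!z. z \<in> circle \<and> act z x = y)) \<and>
     (\<forall>m\<in>topspace (fst M). \<exists>U. openin (fst M) U \<and> m \<in> U \<and>
        (\<exists>\<Phi>. local_trivialization S M p act U \<Phi>))"

text \<open>The smooth structures on the space \<open>E\<close> of a twist over \<open>G\<close>, where \<open>G\<close> carries the smooth
  structure \<open>A\<close>, that make \<open>\<pi>\<close> a smooth principal bundle and each \<open>\<sigma> a : U a \<rightarrow> E\<close> smooth.\<close>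

definition twist_structure ::
    "'g groupoid \<Rightarrow> 'g chart set \<Rightarrow> 'e groupoid \<Rightarrow> (complex \<times> 'g \<Rightarrow> 'e) \<Rightarrow> ('e \<Rightarrow> 'g) \<Rightarrow>
     'i set \<Rightarrow> ('i \<Rightarrow> 'g set) \<Rightarrow> ('i \<Rightarrow> 'g \<Rightarrow> 'e) \<Rightarrow> 'e chart set \<Rightarrow> bool" where
  "twist_structure G A E \<iota> \<pi> I U \<sigma> B \<longleftrightarrow>
     smooth_manifold (gtop E, B) \<and>
     smooth_principal_circle_bundle (gtop E, B) (gtop G, A) \<pi> (twist_action E \<iota> \<pi>) \<and>
     (\<forall>a\<in>I. smooth_map (open_submfd (gtop G, A) (U a)) (gtop E, B) (\<sigma> a))"

end

theory Submission
  imports Defs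
begin

text \<open>
  Above the domain of a section, \<open>E\<close> is a product: \<open>\<psi>\<^sub>a(z, \<gamma>) = z \<cdot> \<sigma>\<^sub>a(\<gamma>)\<close> is an equivariant homeomorphism
  of \<open>\<T> \<times> U\<^sub>a\<close> onto \<open>\<pi>\<^sup>-\<^sup>1(U\<^sub>a)\<close>, and its inverse comes from division in the groupoid \<open>E\<close>
  (\<open>param_homeomorphic_map\<close>). If \<open>c\<^sub>a\<^sub>b\<close> denotes the circle component of \<open>\<iota>\<^sup>-\<^sup>1(\<sigma>\<^sub>a \<sigma>\<^sub>b\<^sup>-\<^sup>1)\<close>, then
  \<open>\<sigma>\<^sub>a = c\<^sub>a\<^sub>b \<cdot> \<sigma>\<^sub>b\<close>, so the change of parametrisation from \<open>a\<close> to \<open>b\<close> is \<open>(z, \<gamma>) \<mapsto> (z c\<^sub>a\<^sub>b(\<gamma>), \<gamma>)\<close>.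
  It is smooth by hypothesis, and therefore the charts of the manifolds \<open>\<T> \<times> U\<^sub>a\<close>, transported
  along the \<open>\<psi>\<^sub>a\<close>, form a smooth atlas of \<open>E\<close> (\<open>glue_smooth_manifolds\<close>, \<open>glue_over\<close>).

  All claims follow from one equivalence, \<open>twist_structure_iff\<close>: a smooth structure on \<open>E\<close> makes \<open>\<pi>\<close> a
  principal bundle and the sections smooth if and only if it makes every \<open>\<psi>\<^sub>a\<close> a diffeomorphism onto an open
  submanifold. In one direction, everything is read off in the parametrisations. In the other, \<open>\<psi>\<^sub>a\<close> is
  composed of the action and \<open>\<sigma>\<^sub>a\<close>, and its inverse is a quotient of two values of a local trivialisation.
  A map out of \<open>E\<close> is then smooth if and only if its compositions with all \<open>\<psi>\<^sub>a\<close> are. Applied to the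
  identity, this shows that two such structures coincide; applied to an equivariant map \<open>f\<close>, it gives the
  third claim, since \<open>f(\<psi>\<^sub>a(z, \<gamma>)) = z \<cdot> f(\<sigma>\<^sub>a(\<gamma>))\<close>.

  For the second claim, the gluing is repeated over the unit space (\<open>preim_embedded_submanifold\<close>). In the
  resulting charts, the inclusion of \<open>\<pi>\<^sup>-\<^sup>1(G\<^sup>0)\<close> is the product of an identity with the inclusion of the
  unit space in \<open>G\<close>, so it is an immersion (\<open>inj_on_differential_join\<close>).

  These arguments rest on elementary facts about manifolds given by charts: the chain rule for functions
  with continuous partial derivatives (\<open>curve_chain_rule\<close>, \<open>C_diff_compose\<close>), the independence of smoothness
  from the charts in which it is tested (\<open>smooth_map_smooth_wrt\<close>), open submanifolds, products, and the circle
  with its smooth multiplication (\<open>smooth_map_circle_mult\<close>).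
\<close>

section \<open>Differential calculus in Euclidean coordinates\<close>

lemma Euclidean_space_eq_top_of_set:
  "Euclidean_space n = top_of_set (topspace (Euclidean_space n))"
  by (simp add: Euclidean_space_def euclidean_product_topology)

lemma mem_Euclidean_space: "x \<in> topspace (Euclidean_space n) \<longleftrightarrow> (\<forall>i\<ge>n. x i = 0)"
  by (simp add: topspace_Euclidean_space)

lemma continuous_map_Euclidean_subspace_iff:
  assumes "W \<subseteq> topspace (Euclidean_space n)"
  shows "continuous_map (subtopology (Euclidean_space n) W) euclideanreal f \<longleftrightarrow> continuous_on W f"
proof -
  have "subtopology (Euclidean_space n) W = top_of_set W"
    using assms Euclidean_space_eq_top_of_set[of n]
    by (metis inf.absorb_iff2 subtopology_subtopology)
  then show ?thesis by simp
qed

text \<open>Boxes suffice as neighbourhoods because a basic open set of the product topology restricts only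
  finitely many coordinates, and the coordinates from \<open>n\<close> on are zero anyway.\<close>

lemma openin_Euclidean_space_box:
  assumes V: "openin (Euclidean_space n) V" and p: "p \<in> V"
  obtains e where "e > 0"
    "\<And>y. y \<in> topspace (Euclidean_space n) \<Longrightarrow> (\<And>i. i < n \<Longrightarrow> \<bar>y i - p i\<bar> < e) \<Longrightarrow> y \<in> V"
proof -
  obtain T where T: "openin (powertop_real UNIV) T" "V = T \<inter> {x. \<forall>i\<ge>n. x i = 0}"
    using V by (auto simp: Euclidean_space_def openin_subtopology)
  obtain U where U: "finite {i. U i \<noteq> (UNIV::real set)}" "\<And>i. open (U i)"
      "p \<in> Pi\<^sub>E UNIV U" "Pi\<^sub>E UNIV U \<subseteq> T"
    using T p by (auto simp: openin_product_topology_alt)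
  have "\<exists>e>0. \<forall>y. \<bar>y - p i\<bar> < e \<longrightarrow> y \<in> U i" for i
    using U(2)[of i] U(3) by (force simp: open_dist dist_real_def PiE_iff)
  then obtain e where e: "\<And>i. e i > 0" "\<And>i y. \<bar>y - p i\<bar> < e i \<Longrightarrow> y \<in> U i" by metis
  define d where "d = Min (insert 1 (e ` {..<n}))"
  have d: "d > 0" "\<And>i. i < n \<Longrightarrow> d \<le> e i"
    using e by (auto simp: d_def)
  show thesis
  proof (rule that[OF d(1)])
    fix y assume y: "y \<in> topspace (Euclidean_space n)" "\<And>i. i < n \<Longrightarrow> \<bar>y i - p i\<bar> < d"
    have "y i \<in> U i" for i
    proof (cases "i < n")
      case True
      then show ?thesis using y(2) d(2) e(2) by (meson less_le_trans)
    next
      case False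
      then have "y i = p i" using y(1) p T(2) by (auto simp: mem_Euclidean_space)
      then show ?thesis using U(3) by (auto simp: PiE_iff)
    qed
    then show "y \<in> V" using y(1) U(4) T(2) by (auto simp: PiE_iff mem_Euclidean_space)
  qed
qed

lemma update_mem_Euclidean_space:
  "x \<in> topspace (Euclidean_space n) \<Longrightarrow> i < n \<Longrightarrow> x(i := t) \<in> topspace (Euclidean_space n)"
  by (simp add: mem_Euclidean_space)

lemma eventually_update_mem:
  assumes "openin (Euclidean_space n) W" "x \<in> W" "i < n"
  shows "eventually (\<lambda>t. x(i := t) \<in> W) (nhds (x i))"
proof -
  obtain e where e: "e > 0"
    "\<And>y. y \<in> topspace (Euclidean_space n) \<Longrightarrow> (\<And>i. i < n \<Longrightarrow> \<bar>y i - x i\<bar> < e) \<Longrightarrow> y \<in> W"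
    using openin_Euclidean_space_box[OF assms(1,2)] by blast
  have x: "x \<in> topspace (Euclidean_space n)" using assms openin_subset by blast
  have "x(i := t) \<in> W" if "dist t (x i) < e" for t
    using that update_mem_Euclidean_space[OF x assms(3)] e by (auto simp: dist_real_def)
  then show ?thesis using e(1) by (auto simp: eventually_nhds_metric)
qed

lemma continuous_on_box:
  assumes W: "openin (Euclidean_space n) W" and f: "continuous_on W f" and p: "p \<in> W" and e: "e > 0"
  obtains d where "d > 0"
    "\<And>y. y \<in> topspace (Euclidean_space n) \<Longrightarrow> (\<And>i. i < n \<Longrightarrow> \<bar>y i - p i\<bar> < d) \<Longrightarrow>
       y \<in> W \<and> \<bar>f y - f p :: real\<bar> < e"
proof -
  have "continuous_map (subtopology (Euclidean_space n) W) euclideanreal f"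
    using f openin_subset[OF W] by (simp add: continuous_map_Euclidean_subspace_iff)
  then have "openin (subtopology (Euclidean_space n) W)
     {y \<in> topspace (subtopology (Euclidean_space n) W). f y \<in> ball (f p) e}"
    by (rule openin_continuous_map_preimage) auto
  moreover have "{y \<in> topspace (subtopology (Euclidean_space n) W). f y \<in> ball (f p) e}
       = {y \<in> W. \<bar>f y - f p\<bar> < e}"
    using openin_subset[OF W] by (auto simp: dist_real_def)
  ultimately have "openin (Euclidean_space n) {y \<in> W. \<bar>f y - f p\<bar> < e}"
    using W openin_trans_full by fastforce
  from openin_Euclidean_space_box[OF this, of p] p e that show thesis by auto
qed

lemma mean_value_either_order:
  fixes f :: "real \<Rightarrow> real"
  assumes "a \<noteq> b" "\<And>x. min a b \<le> x \<Longrightarrow> x \<le> max a b \<Longrightarrow> DERIV f x :> f' x"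
  obtains z where "min a b \<le> z" "z \<le> max a b" "f b - f a = (b - a) * f' z"
proof (cases "a < b")
  case True
  then obtain z where "a < z" "z < b" "f b - f a = (b - a) * f' z"
    using MVT2[of a b f f'] assms(2) by (auto simp: min_def max_def)
  then show thesis using that[of z] True by simp
next
  case False
  then have "b < a" using assms by simp
  then obtain z where z: "b < z" "z < a" "f a - f b = (a - b) * f' z"
    using MVT2[of b a f f'] assms(2) by (auto simp: min_def max_def)
  then have "f b - f a = (b - a) * f' z" by (simp add: algebra_simps)
  then show thesis using that[of z] z(1,2) \<open>b < a\<close> by simp
qed

lemma C_diff_Suc_has_derivative:
  assumes "C_diff (Suc k) n W f" "x \<in> W" "i < n"
  shows "((\<lambda>t. f (x(i := t))) has_real_derivative partial_deriv i f x) (at (x i))"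
proof -
  have "(\<lambda>t. f (x(i := t))) differentiable (at (x i))" using assms by auto
  then show ?thesis
    unfolding partial_deriv_def
    using DERIV_deriv_iff_real_differentiable by blast
qed

text \<open>
  The chain rule along a curve needs the continuity of the partial derivatives: moving from
  \<open>p\<close> to \<open>\<gamma> t\<close> one coordinate at a time, the mean value theorem expresses each of the \<open>m\<close>
  increments by a partial derivative at a point that tends to \<open>p\<close>.
\<close>

lemma curve_chain_rule:
  assumes V: "openin (Euclidean_space m) V" and g: "C_diff (Suc 0) m V g"
    and p: "\<gamma> t0 \<in> V" and ev: "eventually (\<lambda>t. \<gamma> t \<in> topspace (Euclidean_space m)) (at t0)"
    and D: "\<And>j. j < m \<Longrightarrow> ((\<lambda>t. \<gamma> t j) has_real_derivative D j) (at t0)"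
  shows "((\<lambda>t. g (\<gamma> t)) has_real_derivative (\<Sum>j<m. partial_deriv j g (\<gamma> t0) * D j)) (at t0)"
proof -
  define p where "p = \<gamma> t0"
  define q where "q = (\<lambda>t j i. if i < j then \<gamma> t i else p i)"
  \<comment> \<open>\<open>q t j\<close> has already moved its first \<open>j\<close> coordinates from \<open>p\<close> to \<open>\<gamma> t\<close>; \<open>A t j\<close> is the slope of
    the next move, with its limit as value where the coordinate does not move.\<close>
  define A where "A = (\<lambda>t j. if \<gamma> t j = p j then partial_deriv j g p
      else (g (q t (Suc j)) - g (q t j)) / (\<gamma> t j - p j))"
  have VS: "V \<subseteq> topspace (Euclidean_space m)" using V openin_subset by blast
  have pV: "p \<in> V" using p p_def by simp
  have lim: "((\<lambda>t. \<gamma> t j) \<longlongrightarrow> p j) (at t0)" if "j < m" for j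
    using DERIV_isCont[OF D[OF that]] by (simp add: isCont_def p_def)
  have near: "eventually (\<lambda>t. \<forall>i<m. \<bar>\<gamma> t i - p i\<bar> < d) (at t0)" if "d > 0" for d
  proof -
    have "eventually (\<lambda>t. \<forall>i\<in>{..<m}. \<bar>\<gamma> t i - p i\<bar> < d) (at t0)"
      using tendstoD[OF lim that]
      by (intro eventually_ball_finite finite_lessThan) (simp add: dist_real_def)
    then show ?thesis by (rule eventually_mono) auto
  qed
  have A: "((\<lambda>t. A t j) \<longlongrightarrow> partial_deriv j g p) (at t0)" if j: "j < m" for j
  proof (rule tendstoI)
    fix e :: real assume e: "e > 0"
    have "continuous_on V (partial_deriv j g)"
      using g j continuous_map_Euclidean_subspace_iff[OF VS] by auto
    then obtain d where d: "d > 0"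
      "\<And>y. y \<in> topspace (Euclidean_space m) \<Longrightarrow> (\<And>i. i < m \<Longrightarrow> \<bar>y i - p i\<bar> < d) \<Longrightarrow>
         y \<in> V \<and> \<bar>partial_deriv j g y - partial_deriv j g p\<bar> < e"
      using continuous_on_box[OF V _ pV e] by blast
    from near[OF d(1)] show "eventually (\<lambda>t. dist (A t j) (partial_deriv j g p) < e) (at t0)"
    proof (rule eventually_mono)
      fix t assume t: "\<forall>i<m. \<bar>\<gamma> t i - p i\<bar> < d"
      show "dist (A t j) (partial_deriv j g p) < e"
      proof (cases "\<gamma> t j = p j")
        case True
        then show ?thesis using e by (simp add: A_def)
      next
        case False
        have box: "(q t j)(j := s) \<in> V \<and>
            \<bar>partial_deriv j g ((q t j)(j := s)) - partial_deriv j g p\<bar> < e"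
          if s: "min (p j) (\<gamma> t j) \<le> s" "s \<le> max (p j) (\<gamma> t j)" for s
        proof (rule d(2))
          show "(q t j)(j := s) \<in> topspace (Euclidean_space m)"
            using j pV VS by (auto simp: mem_Euclidean_space q_def)
          have "\<bar>s - p j\<bar> < d" using s t j by (auto simp: abs_if split: if_splits)
          then show "\<bar>((q t j)(j := s)) i - p i\<bar> < d" if "i < m" for i
            using t that d(1) by (auto simp: q_def)
        qed
        have "DERIV (\<lambda>s. g ((q t j)(j := s))) s :> partial_deriv j g ((q t j)(j := s))"
          if "min (p j) (\<gamma> t j) \<le> s" "s \<le> max (p j) (\<gamma> t j)" for s
          using C_diff_Suc_has_derivative[OF g _ j, of "(q t j)(j := s)"] box[OF that] by simp
        then obtain z where z: "min (p j) (\<gamma> t j) \<le> z" "z \<le> max (p j) (\<gamma> t j)"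
          "g ((q t j)(j := \<gamma> t j)) - g ((q t j)(j := p j))
             = (\<gamma> t j - p j) * partial_deriv j g ((q t j)(j := z))"
          using mean_value_either_order[of "p j" "\<gamma> t j" "\<lambda>s. g ((q t j)(j := s))"
              "\<lambda>s. partial_deriv j g ((q t j)(j := s))"] False by metis
        have q1: "(q t j)(j := \<gamma> t j) = q t (Suc j)" and q2: "(q t j)(j := p j) = q t j"
          by (auto simp: q_def fun_eq_iff less_Suc_eq)
        have "A t j = partial_deriv j g ((q t j)(j := z))"
          using z(3) False by (simp add: A_def q1 q2)
        then show ?thesis using box[OF z(1,2)] by (simp add: dist_real_def)
      qed
    qed
  qed
  have quot: "eventually (\<lambda>t. (\<Sum>j<m. A t j * ((\<gamma> t j - p j) / (t - t0)))
      = (g (\<gamma> t) - g (\<gamma> t0)) / (t - t0)) (at t0)"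
    using ev
  proof (rule eventually_mono)
    fix t assume t: "\<gamma> t \<in> topspace (Euclidean_space m)"
    have "A t j * (\<gamma> t j - p j) = g (q t (Suc j)) - g (q t j)" for j
    proof (cases "\<gamma> t j = p j")
      case True
      then have "q t (Suc j) = q t j" by (auto simp: q_def fun_eq_iff less_Suc_eq)
      then show ?thesis using True by simp
    qed (simp add: A_def)
    then have "(\<Sum>j<m. A t j * (\<gamma> t j - p j)) = g (q t m) - g (q t 0)"
      using sum_lessThan_telescope[of "\<lambda>j. g (q t j)" m] by simp
    moreover have "q t m = \<gamma> t"
      using t pV VS by (auto simp: q_def fun_eq_iff mem_Euclidean_space subset_iff)
    moreover have "q t 0 = \<gamma> t0" by (simp add: q_def p_def)
    ultimately show "(\<Sum>j<m. A t j * ((\<gamma> t j - p j) / (t - t0))) = (g (\<gamma> t) - g (\<gamma> t0)) / (t - t0)"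
      by (simp flip: sum_divide_distrib)
  qed
  have "((\<lambda>t. \<Sum>j<m. A t j * ((\<gamma> t j - p j) / (t - t0))) \<longlongrightarrow> (\<Sum>j<m. partial_deriv j g p * D j)) (at t0)"
    using A D by (intro tendsto_sum tendsto_mult) (auto simp: has_field_derivative_iff p_def)
  then show ?thesis
    unfolding has_field_derivative_iff p_def[symmetric]
    using Lim_transform_eventually quot p_def by fastforce
qed


subsection \<open>Algebra of continuously differentiable functions\<close>

lemma C_diff_imp_continuous_on:
  "openin (Euclidean_space n) W \<Longrightarrow> C_diff k n W f \<Longrightarrow> continuous_on W f"
  by (cases k) (auto simp flip: continuous_map_Euclidean_subspace_iff dest: openin_subset)

lemma partial_deriv_cong:
  assumes W: "openin (Euclidean_space n) W" and fg: "\<And>x. x \<in> W \<Longrightarrow> f x = g x"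
    and x: "x \<in> W" and i: "i < n"
  shows "partial_deriv i f x = partial_deriv i g x"
    "(\<lambda>t. f (x(i := t))) differentiable (at (x i)) \<longleftrightarrow> (\<lambda>t. g (x(i := t))) differentiable (at (x i))"
proof -
  have ev: "eventually (\<lambda>t. f (x(i := t)) = g (x(i := t))) (nhds (x i))"
    using eventually_update_mem[OF W x i] by eventually_elim (use fg in auto)
  then show "partial_deriv i f x = partial_deriv i g x"
    unfolding partial_deriv_def by (intro deriv_cong_ev) auto
  show "(\<lambda>t. f (x(i := t))) differentiable (at (x i)) \<longleftrightarrow> (\<lambda>t. g (x(i := t))) differentiable (at (x i))"
    unfolding real_differentiable_def using DERIV_cong_ev[OF refl ev refl] by auto
qed

lemma C_diff_cong:
  assumes W: "openin (Euclidean_space n) W" and fg: "\<And>x. x \<in> W \<Longrightarrow> f x = g x"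
  shows "C_diff k n W f \<Longrightarrow> C_diff k n W g"
  using fg
proof (induction k arbitrary: f g)
  case 0
  have "continuous_on W f" using C_diff_imp_continuous_on[OF W 0(1)] .
  then have "continuous_on W g" using 0(2) continuous_on_cong by fastforce
  then show ?case using W openin_subset[OF W] by (simp add: continuous_map_Euclidean_subspace_iff)
next
  case (Suc k)
  have "continuous_on W f" using C_diff_imp_continuous_on[OF W Suc.prems(1)] .
  then have c: "continuous_on W g" using Suc.prems(2) continuous_on_cong by fastforce
  have "C_diff k n W (partial_deriv i g)" if "i < n" for i
    using Suc.IH[of "partial_deriv i f" "partial_deriv i g"] Suc.prems that
      partial_deriv_cong(1)[OF W, of f g] by auto
  then show ?case
    using Suc.prems c partial_deriv_cong(2)[OF W, of f g] openin_subset[OF W]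
    by (auto simp: continuous_map_Euclidean_subspace_iff)
qed

lemma C_diff_SucI:
  assumes W: "openin (Euclidean_space n) W"
    and c: "continuous_on W f"
    and d: "\<And>i x. i < n \<Longrightarrow> x \<in> W \<Longrightarrow> ((\<lambda>t. f (x(i := t))) has_real_derivative f' i x) (at (x i))"
    and C: "\<And>i. i < n \<Longrightarrow> C_diff k n W (f' i)"
  shows "C_diff (Suc k) n W f"
proof -
  have "C_diff k n W (partial_deriv i f)" if "i < n" for i
    by (rule C_diff_cong[OF W _ C[OF that]])
      (use DERIV_imp_deriv[OF d[OF that]] in \<open>simp add: partial_deriv_def\<close>)
  then show ?thesis
    using c d W openin_subset[OF W]
    by (auto simp: continuous_map_Euclidean_subspace_iff real_differentiable_def)
qed

lemma C_diff_SucD: "C_diff (Suc k) n W f \<Longrightarrow> C_diff k n W f"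
  by (induction k arbitrary: f) auto

lemma C_diff_subset: "C_diff k n W f \<Longrightarrow> V \<subseteq> W \<Longrightarrow> C_diff k n V f"
  by (induction k arbitrary: f)
    (auto intro: continuous_map_from_subtopology_mono)

lemma continuous_map_local:
  assumes "\<And>x. x \<in> topspace X \<Longrightarrow> \<exists>V. openin X V \<and> x \<in> V \<and> continuous_map (subtopology X V) Y f"
  shows "continuous_map X Y f"
proof (rule pasting_lemma[where I="{V. openin X V \<and> continuous_map (subtopology X V) Y f}"
      and T="\<lambda>V. V" and f="\<lambda>V. f"])
qed (use assms in auto)

lemma C_diff_local:
  assumes "W \<subseteq> topspace (Euclidean_space n)"
    and "\<And>x. x \<in> W \<Longrightarrow> \<exists>V. openin (Euclidean_space n) V \<and> x \<in> V \<and> V \<subseteq> W \<and> C_diff k n V f"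
  shows "C_diff k n W f"
proof -
  have c: "continuous_on W f"
    if *: "\<And>x. x \<in> W \<Longrightarrow> \<exists>V. openin (Euclidean_space n) V \<and> x \<in> V \<and> V \<subseteq> W \<and> C_diff k n V f" for k f
  proof -
    have "continuous_map (subtopology (Euclidean_space n) W) euclideanreal f"
    proof (rule continuous_map_local)
      fix x assume "x \<in> topspace (subtopology (Euclidean_space n) W)"
      then have "x \<in> W" by simp
      from *[OF this] obtain V
        where V: "openin (Euclidean_space n) V" "x \<in> V" "V \<subseteq> W" "C_diff k n V f" by blast
      then have "continuous_map (subtopology (Euclidean_space n) V) euclideanreal f"
        by (simp add: C_diff_imp_continuous_on continuous_map_Euclidean_subspace_iff openin_subset)
      then show "\<exists>V. openin (subtopology (Euclidean_space n) W) V \<and> x \<in> V \<and>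
          continuous_map (subtopology (subtopology (Euclidean_space n) W) V) euclideanreal f"
        using V by (intro exI[of _ V]) (auto simp: subtopology_subtopology inf_absorb2 intro!: openin_subset_topspace_eq[THEN iffD2] simp: openin_subtopology_alt)
    qed
    then show ?thesis using continuous_map_Euclidean_subspace_iff[OF assms(1)] by simp
  qed
  show ?thesis
    using assms(2)
  proof (induction k arbitrary: f)
    case 0
    then show ?case using c[OF 0] assms(1) by (simp add: continuous_map_Euclidean_subspace_iff)
  next
    case (Suc k)
    have "C_diff k n W (partial_deriv i f)" if "i < n" for i
    proof (rule Suc.IH)
      fix x assume "x \<in> W"
      then show "\<exists>V. openin (Euclidean_space n) V \<and> x \<in> V \<and> V \<subseteq> W \<and> C_diff k n V (partial_deriv i f)"
        using Suc.prems[of x] that by auto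
    qed
    moreover have "(\<lambda>t. f (x(i := t))) differentiable (at (x i))" if "i < n" "x \<in> W" for i x
      using Suc.prems[OF that(2)] that by auto
    ultimately show ?case
      using c[OF Suc.prems] assms(1) by (simp add: continuous_map_Euclidean_subspace_iff)
  qed
qed

lemma C_diff_const: "openin (Euclidean_space n) W \<Longrightarrow> C_diff k n W (\<lambda>x. c)"
proof (induction k arbitrary: c)
  case (Suc k)
  then show ?case by (intro C_diff_SucI[where f'="\<lambda>i x. 0"]) auto
qed simp

lemma continuous_on_coordinate: "continuous_on W (\<lambda>x::nat \<Rightarrow> real. x j)"
  by (rule continuous_on_subset[OF continuous_on_product_coordinates]) simp

lemma C_diff_coordinate:
  assumes W: "openin (Euclidean_space n) W"
  shows "C_diff k n W (\<lambda>x. x j)"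
proof (cases k)
  case 0
  then show ?thesis
    using openin_subset[OF W] continuous_on_coordinate by (simp add: continuous_map_Euclidean_subspace_iff)
next
  case (Suc l)
  show ?thesis unfolding Suc
  proof (rule C_diff_SucI[where f'="\<lambda>i x. if i = j then 1 else 0"])
    show "continuous_on W (\<lambda>x. x j)" by (rule continuous_on_coordinate)
    show "C_diff l n W (\<lambda>x. if i = j then 1 else 0)" for i
      using C_diff_const[OF W] by simp
  qed (use W in \<open>auto simp: fun_upd_def\<close>)
qed

lemma C_diff_add:
  assumes W: "openin (Euclidean_space n) W"
  shows "C_diff k n W f \<Longrightarrow> C_diff k n W g \<Longrightarrow> C_diff k n W (\<lambda>x. f x + g x)"
proof (induction k arbitrary: f g)
  case 0
  then show ?case
    using openin_subset[OF W] by (auto simp: continuous_map_Euclidean_subspace_iff intro!: continuous_intros)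
next
  case (Suc k)
  show ?case
  proof (rule C_diff_SucI[where f'="\<lambda>i x. partial_deriv i f x + partial_deriv i g x", OF W])
    show "continuous_on W (\<lambda>x. f x + g x)"
      using Suc.prems C_diff_imp_continuous_on[OF W] by (intro continuous_intros) blast+
    show "((\<lambda>t. f (x(i := t)) + g (x(i := t))) has_real_derivative
            partial_deriv i f x + partial_deriv i g x) (at (x i))" if "i < n" "x \<in> W" for i x
      using that Suc.prems by (intro DERIV_add C_diff_Suc_has_derivative)
    show "C_diff k n W (\<lambda>x. partial_deriv i f x + partial_deriv i g x)" if "i < n" for i
      using that Suc.prems by (intro Suc.IH) auto
  qed
qed

lemma C_diff_mult:
  assumes W: "openin (Euclidean_space n) W"
  shows "C_diff k n W f \<Longrightarrow> C_diff k n W g \<Longrightarrow> C_diff k n W (\<lambda>x. f x * g x)"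
proof (induction k arbitrary: f g)
  case 0
  then show ?case
    using openin_subset[OF W] by (auto simp: continuous_map_Euclidean_subspace_iff intro!: continuous_intros)
next
  case (Suc k)
  show ?case
  proof (rule C_diff_SucI[where f'="\<lambda>i x. partial_deriv i f x * g x + partial_deriv i g x * f x", OF W])
    show "continuous_on W (\<lambda>x. f x * g x)"
      using Suc.prems C_diff_imp_continuous_on[OF W] by (intro continuous_intros) blast+
    show "((\<lambda>t. f (x(i := t)) * g (x(i := t))) has_real_derivative
            partial_deriv i f x * g x + partial_deriv i g x * f x) (at (x i))" if "i < n" "x \<in> W" for i x
      using DERIV_mult[OF C_diff_Suc_has_derivative[OF Suc.prems(1) that(2,1)]
          C_diff_Suc_has_derivative[OF Suc.prems(2) that(2,1)]] by (simp only: fun_upd_triv)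
    show "C_diff k n W (\<lambda>x. partial_deriv i f x * g x + partial_deriv i g x * f x)" if "i < n" for i
    proof -
      have "C_diff k n W (partial_deriv i f)" "C_diff k n W (partial_deriv i g)"
        using that Suc.prems by auto
      moreover have "C_diff k n W f" "C_diff k n W g"
        using Suc.prems C_diff_SucD by blast+
      ultimately show ?thesis by (intro C_diff_add[OF W] Suc.IH)
    qed
  qed
qed

lemma C_diff_sum:
  assumes "openin (Euclidean_space n) W" "\<And>j. j \<in> J \<Longrightarrow> C_diff k n W (f j)"
  shows "C_diff k n W (\<lambda>x. \<Sum>j\<in>J. f j x)"
  using assms(2)
  by (induction J rule: infinite_finite_induct)
    (auto intro: C_diff_add[OF assms(1)] C_diff_const[OF assms(1)])


subsection \<open>Smooth maps between open sets\<close>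

text \<open>The coordinates \<open>j \<ge> m\<close> of a map into the \<open>m\<close>-dimensional space vanish, so the bound on \<open>j\<close> can be
  dropped; this spares the composition lemmas a case distinction.\<close>

lemma smooth_eucl_iff:
  "smooth_eucl n m W F \<longleftrightarrow> openin (Euclidean_space n) W \<and> F \<in> W \<rightarrow> topspace (Euclidean_space m) \<and>
     (\<forall>j k. C_diff k n W (\<lambda>x. F x j))"
proof -
  have "C_diff k n W (\<lambda>x. F x j)"
    if "openin (Euclidean_space n) W" "F \<in> W \<rightarrow> topspace (Euclidean_space m)" "\<not> j < m" for j k
    using C_diff_cong[OF that(1), of "\<lambda>x. 0" "\<lambda>x. F x j"] C_diff_const[OF that(1)] that
    by (auto simp: Pi_iff mem_Euclidean_space)
  then show ?thesis unfolding smooth_eucl_def by blast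
qed

text \<open>By the chain rule, a partial derivative of \<open>g \<circ> F\<close> is a sum of products of functions
  \<open>(\<partial>\<^sub>j g) \<circ> F\<close> and partial derivatives of \<open>F\<close>. The first factors are again compositions with \<open>F\<close>,
  of lower order, so the induction on the order has to run over all \<open>g\<close> at once.\<close>

lemma C_diff_compose:
  assumes F: "smooth_eucl n m W F" and FV: "F ` W \<subseteq> V" and V: "openin (Euclidean_space m) V"
    and g: "\<And>k. C_diff k m V g"
  shows "C_diff k n W (\<lambda>x. g (F x))"
proof -
  have W: "openin (Euclidean_space n) W" and FS: "F \<in> W \<rightarrow> topspace (Euclidean_space m)"
    and FC: "\<And>j k. C_diff k n W (\<lambda>x. F x j)" using F by (auto simp: smooth_eucl_iff)
  have Fc: "continuous_on W F"
    using FC[of 0] C_diff_imp_continuous_on[OF W] by (intro continuous_on_coordinatewise_then_product) blast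
  have c: "continuous_on W (\<lambda>x. g (F x))" if "C_diff k m V g" for k g
    using continuous_on_compose2[OF C_diff_imp_continuous_on[OF V that] Fc FV] .
  show ?thesis using g
  proof (induction k arbitrary: g)
    case 0
    then show ?case
      using openin_subset[OF W] c[OF 0] by (simp add: continuous_map_Euclidean_subspace_iff)
  next
    case (Suc k)
    show ?case
    proof (rule C_diff_SucI[OF W])
      show "continuous_on W (\<lambda>x. g (F x))" using c Suc.prems by blast
      show "((\<lambda>t. g (F (x(i := t)))) has_real_derivative
          (\<Sum>j<m. partial_deriv j g (F x) * partial_deriv i (\<lambda>y. F y j) x)) (at (x i))"
        if i: "i < n" "x \<in> W" for i x
      proof -
        have "eventually (\<lambda>t. F (x(i := t)) \<in> topspace (Euclidean_space m)) (nhds (x i))"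
          using eventually_update_mem[OF W i(2,1)] by eventually_elim (use FS in auto)
        then have "eventually (\<lambda>t. F (x(i := t)) \<in> topspace (Euclidean_space m)) (at (x i))"
          by (simp add: eventually_at_filter eventually_mono)
        moreover have "((\<lambda>t. F (x(i := t)) j) has_real_derivative partial_deriv i (\<lambda>y. F y j) x) (at (x i))" for j
          using C_diff_Suc_has_derivative[OF FC i(2,1)] .
        ultimately show ?thesis
          using curve_chain_rule[OF V, of g "\<lambda>t. F (x(i := t))" "x i"] Suc.prems FV i by auto
      qed
      show "C_diff k n W (\<lambda>x. \<Sum>j<m. partial_deriv j g (F x) * partial_deriv i (\<lambda>y. F y j) x)"
        if i: "i < n" for i
      proof (intro C_diff_sum C_diff_mult W)
        fix j assume "j \<in> {..<m}"
        then have "C_diff l m V (partial_deriv j g)" for l using Suc.prems[of "Suc l"] by auto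
        then show "C_diff k n W (\<lambda>x. partial_deriv j g (F x))" by (rule Suc.IH)
        show "C_diff k n W (partial_deriv i (\<lambda>y. F y j))" using FC[of "Suc k" j] i by auto
      qed
    qed
  qed
qed

lemma smooth_eucl_compose:
  assumes "smooth_eucl n m W F" "smooth_eucl m l V H" "F ` W \<subseteq> V"
  shows "smooth_eucl n l W (\<lambda>x. H (F x))"
  using assms C_diff_compose[OF assms(1,3), of "\<lambda>y. H y j" for j]
  unfolding smooth_eucl_iff by (auto simp: Pi_iff)

lemma smooth_eucl_cong:
  assumes "smooth_eucl n m W F" "\<And>x. x \<in> W \<Longrightarrow> F x = H x"
  shows "smooth_eucl n m W H"
  using assms C_diff_cong[of n W "\<lambda>x. F x j" "\<lambda>x. H x j" for j]
  unfolding smooth_eucl_iff by (auto simp: Pi_iff)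

lemma smooth_eucl_cong_iff:
  assumes "\<And>x. x \<in> W \<Longrightarrow> F x = H x"
  shows "smooth_eucl n m W F \<longleftrightarrow> smooth_eucl n m W H"
  using smooth_eucl_cong[of n m W F H] smooth_eucl_cong[of n m W H F] assms by metis

lemma smooth_eucl_subset:
  assumes "smooth_eucl n m W F" "openin (Euclidean_space n) V" "V \<subseteq> W"
  shows "smooth_eucl n m V F"
  using assms C_diff_subset[OF _ assms(3)] unfolding smooth_eucl_iff by (auto simp: Pi_iff)

lemma smooth_eucl_local:
  assumes "\<And>x. x \<in> W \<Longrightarrow> \<exists>V. x \<in> V \<and> V \<subseteq> W \<and> smooth_eucl n m V F"
  shows "smooth_eucl n m W F"
proof -
  have loc: "\<exists>V. openin (Euclidean_space n) V \<and> x \<in> V \<and> V \<subseteq> W \<and>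
      F \<in> V \<rightarrow> topspace (Euclidean_space m) \<and> (\<forall>j k. C_diff k n V (\<lambda>x. F x j))" if "x \<in> W" for x
    using assms[OF that] unfolding smooth_eucl_iff by auto
  have W: "openin (Euclidean_space n) W"
  proof (subst openin_subopen, intro ballI)
    fix x assume "x \<in> W"
    from loc[OF this] show "\<exists>V. openin (Euclidean_space n) V \<and> x \<in> V \<and> V \<subseteq> W" by blast
  qed
  show ?thesis
    unfolding smooth_eucl_iff
  proof (intro conjI allI W)
    show "F \<in> W \<rightarrow> topspace (Euclidean_space m)"
    proof
      fix x assume "x \<in> W"
      from loc[OF this] show "F x \<in> topspace (Euclidean_space m)" by blast
    qed
    show "C_diff k n W (\<lambda>x. F x j)" for j k
    proof (rule C_diff_local[OF openin_subset[OF W]])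
      fix x assume "x \<in> W"
      from loc[OF this] show "\<exists>V. openin (Euclidean_space n) V \<and> x \<in> V \<and> V \<subseteq> W \<and> C_diff k n V (\<lambda>x. F x j)"
        by blast
    qed
  qed
qed

lemma smooth_eucl_id: "openin (Euclidean_space n) W \<Longrightarrow> smooth_eucl n n W (\<lambda>x. x)"
  using openin_subset by (auto simp: smooth_eucl_iff C_diff_coordinate)

lemma smooth_eucl_continuous_map:
  assumes "smooth_eucl n m W F"
  shows "continuous_map (subtopology (Euclidean_space n) W) (Euclidean_space m) F"
proof -
  have W: "openin (Euclidean_space n) W" using assms by (simp add: smooth_eucl_iff)
  have "continuous_on W F"
    using assms[unfolded smooth_eucl_iff] C_diff_imp_continuous_on[OF W]
    by (intro continuous_on_coordinatewise_then_product) blast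
  then show ?thesis
    using assms openin_subset[OF W]
    by (auto simp: cm_Euclidean_space_iff_continuous_on smooth_eucl_iff inf_absorb2)
qed

section \<open>Charts\<close>

lemma second_countable_space_iff: "second_countable_space X \<longleftrightarrow> second_countable X"
proof
  assume "second_countable_space X"
  then obtain B where B: "countable B" "\<forall>V\<in>B. openin X V"
    "\<forall>V. openin X V \<longrightarrow> (\<exists>B'\<subseteq>B. \<Union>B' = V)"
    unfolding second_countable_space_def by auto
  have "\<exists>V\<in>B. x \<in> V \<and> V \<subseteq> U" if U: "openin X U" "x \<in> U" for U x
  proof -
    obtain B' where "B' \<subseteq> B" "\<Union>B' = U" using B(3) U(1) by blast
    then show ?thesis using U(2) by blast
  qed
  then show "second_countable X" using B(1,2) unfolding second_countable_def by blast
next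
  assume "second_countable X"
  then obtain B where B: "countable B" "\<forall>V\<in>B. openin X V"
    "\<And>U x. openin X U \<Longrightarrow> x \<in> U \<Longrightarrow> \<exists>V\<in>B. x \<in> V \<and> V \<subseteq> U"
    unfolding second_countable_def by metis
  have "\<exists>B'\<subseteq>B. \<Union>B' = U" if U: "openin X U" for U
  proof (intro exI conjI)
    show "\<Union>{V\<in>B. V \<subseteq> U} = U" using B(3)[OF U] by blast
  qed auto
  then show "second_countable_space X" using B(1,2) unfolding second_countable_space_def by blast
qed

lemma chart_of_openin: "chart_of X c \<Longrightarrow> openin X (chart_dom c)"
  by (simp add: chart_of_def)

lemma chart_of_subset: "chart_of X c \<Longrightarrow> chart_dom c \<subseteq> topspace X"
  using chart_of_openin openin_subset by blast

lemma chart_of_inj: "chart_of X c \<Longrightarrow> inj_on (chart_map c) (chart_dom c)"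
  using homeomorphic_imp_injective_map chart_of_subset[of X c]
  by (fastforce simp: chart_of_def inf_absorb2)

lemma chart_of_continuous_map:
  "chart_of X c \<Longrightarrow> continuous_map (subtopology X (chart_dom c)) (Euclidean_space (chart_dim c)) (chart_map c)"
  unfolding chart_of_def by (metis continuous_map_in_subtopology homeomorphic_imp_continuous_map)

lemma chart_of_open_image:
  assumes c: "chart_of X c" and W: "openin X W" "W \<subseteq> chart_dom c"
  shows "openin (Euclidean_space (chart_dim c)) (chart_map c ` W)"
proof -
  have "open_map (subtopology X (chart_dom c))
      (subtopology (Euclidean_space (chart_dim c)) (chart_map c ` chart_dom c)) (chart_map c)"
    using c homeomorphic_imp_open_map unfolding chart_of_def by blast
  moreover have "openin (subtopology X (chart_dom c)) W"
    using W c by (simp add: chart_of_openin openin_open_subtopology)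
  ultimately have "openin (subtopology (Euclidean_space (chart_dim c)) (chart_map c ` chart_dom c)) (chart_map c ` W)"
    by (simp add: open_map_def)
  then show ?thesis using c by (simp add: chart_of_def openin_open_subtopology)
qed

lemma chart_of_open_preimage:
  assumes c: "chart_of X c" and Q: "openin (Euclidean_space (chart_dim c)) Q"
  shows "openin X {x \<in> chart_dom c. chart_map c x \<in> Q}"
proof -
  have "openin (subtopology X (chart_dom c)) {x \<in> topspace (subtopology X (chart_dom c)). chart_map c x \<in> Q}"
    using chart_of_continuous_map[OF c] Q by (rule openin_continuous_map_preimage)
  then show ?thesis
    using chart_of_subset[OF c] chart_of_openin[OF c] openin_open_subtopology[of X "chart_dom c"]
    by (simp add: Int_absorb1)
qed

lemma chart_of_restrict:
  assumes c: "chart_of X c" and V: "openin X V"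
  shows "chart_of X (chart_dim c, chart_dom c \<inter> V, chart_map c)"
proof -
  have o: "openin X (chart_dom c \<inter> V)" using c V chart_of_openin by blast
  have h: "homeomorphic_map (subtopology X (chart_dom c))
      (subtopology (Euclidean_space (chart_dim c)) (chart_map c ` chart_dom c)) (chart_map c)"
    using c by (simp add: chart_of_def)
  have "homeomorphic_map (subtopology (subtopology X (chart_dom c)) (chart_dom c \<inter> V))
      (subtopology (subtopology (Euclidean_space (chart_dim c)) (chart_map c ` chart_dom c))
        (chart_map c ` (chart_dom c \<inter> V))) (chart_map c)"
  proof (rule homeomorphic_map_subtopologies[OF h])
    have "chart_map c ` chart_dom c \<subseteq> topspace (Euclidean_space (chart_dim c))"
      using c unfolding chart_of_def by (meson openin_subset)
    then show "chart_map c ` (topspace (subtopology X (chart_dom c)) \<inter> (chart_dom c \<inter> V)) =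
        topspace (subtopology (Euclidean_space (chart_dim c)) (chart_map c ` chart_dom c)) \<inter>
          (chart_map c ` (chart_dom c \<inter> V))"
      using chart_of_subset[OF c] by auto
  qed
  moreover have "chart_map c ` chart_dom c \<inter> chart_map c ` (chart_dom c \<inter> V) = chart_map c ` (chart_dom c \<inter> V)"
    by blast
  ultimately show ?thesis
    using o chart_of_open_image[OF c o] by (simp add: chart_of_def subtopology_subtopology flip: Int_assoc)
qed

lemma chart_of_subtopology:
  assumes "openin X U"
  shows "chart_of (subtopology X U) c \<longleftrightarrow> chart_of X c \<and> chart_dom c \<subseteq> U"
proof (cases "chart_dom c \<subseteq> U")
  case True
  then have "U \<inter> chart_dom c = chart_dom c" by blast
  then show ?thesis
    using True assms by (auto simp: chart_of_def subtopology_subtopology openin_open_subtopology)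
next
  case False
  then show ?thesis using assms by (auto simp: chart_of_def openin_open_subtopology)
qed

text \<open>Smoothness of \<open>f\<close> on a part \<open>W\<close> of the domain of \<open>c\<close>, as seen through the charts \<open>c\<close>
  and \<open>d\<close>. Letting \<open>W\<close> vary makes shrinking a chart unnecessary in most arguments.\<close>

definition smooth_wrt :: "'a chart \<Rightarrow> 'b chart \<Rightarrow> 'a set \<Rightarrow> ('a \<Rightarrow> 'b) \<Rightarrow> bool" where
  "smooth_wrt c d W f \<longleftrightarrow>
     smooth_eucl (chart_dim c) (chart_dim d) (chart_map c ` W) (coord_rep c d f)"

lemma smooth_transition_iff: "smooth_transition c d \<longleftrightarrow> smooth_wrt c d (chart_dom c \<inter> chart_dom d) (\<lambda>x. x)"
  by (simp add: smooth_transition_def smooth_wrt_def)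

lemma coord_rep_eq:
  "chart_of X c \<Longrightarrow> x \<in> chart_dom c \<Longrightarrow> coord_rep c d f (chart_map c x) = chart_map d (f x)"
  by (simp add: coord_rep_def chart_of_inj)

lemma smooth_wrt_subset:
  assumes "smooth_wrt c d W f" "chart_of X c" "openin X V" "V \<subseteq> W" "W \<subseteq> chart_dom c"
  shows "smooth_wrt c d V f"
  unfolding smooth_wrt_def
proof (rule smooth_eucl_subset[OF assms(1)[unfolded smooth_wrt_def]])
  show "openin (Euclidean_space (chart_dim c)) (chart_map c ` V)"
    using assms by (intro chart_of_open_image[OF assms(2,3)]) simp
qed (use assms in blast)

lemma smooth_wrt_cong:
  assumes "smooth_wrt c d W f" "chart_of X c" "W \<subseteq> chart_dom c" "\<And>x. x \<in> W \<Longrightarrow> f x = g x"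
  shows "smooth_wrt c d W g"
  unfolding smooth_wrt_def
proof (rule smooth_eucl_cong[OF assms(1)[unfolded smooth_wrt_def]])
  fix y assume "y \<in> chart_map c ` W"
  then obtain x where x: "x \<in> W" "y = chart_map c x" by blast
  then have "x \<in> chart_dom c" using assms(3) by blast
  then show "coord_rep c d f y = coord_rep c d g y"
    using coord_rep_eq[OF assms(2)] x assms(4) by metis
qed

lemma smooth_wrt_compose:
  assumes f: "smooth_wrt c d W f" and g: "smooth_wrt d e W' g"
    and c: "chart_of X c" and d: "chart_of Y d"
    and W: "W \<subseteq> chart_dom c" and W': "W' \<subseteq> chart_dom d" and fW: "f ` W \<subseteq> W'"
  shows "smooth_wrt c e W (\<lambda>x. g (f x))"
  unfolding smooth_wrt_def
proof (rule smooth_eucl_cong)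
  show "smooth_eucl (chart_dim c) (chart_dim e) (chart_map c ` W) (\<lambda>x. coord_rep d e g (coord_rep c d f x))"
  proof (rule smooth_eucl_compose[OF f[unfolded smooth_wrt_def] g[unfolded smooth_wrt_def]])
    show "coord_rep c d f ` chart_map c ` W \<subseteq> chart_map d ` W'"
    proof clarify
      fix x assume x: "x \<in> W"
      then have "coord_rep c d f (chart_map c x) = chart_map d (f x)" using coord_rep_eq[OF c] W by blast
      then show "coord_rep c d f (chart_map c x) \<in> chart_map d ` W'" using fW x by auto
    qed
  qed
  fix y assume "y \<in> chart_map c ` W"
  then obtain x where x: "x \<in> W" "y = chart_map c x" by blast
  then have "x \<in> chart_dom c" "f x \<in> chart_dom d" using W W' fW by auto
  then show "coord_rep d e g (coord_rep c d f y) = coord_rep c e (\<lambda>x. g (f x)) y"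
    using x by (simp add: coord_rep_eq[OF c] coord_rep_eq[OF d])
qed

lemma smooth_wrt_local:
  assumes "\<And>x. x \<in> W \<Longrightarrow> \<exists>V. x \<in> V \<and> V \<subseteq> W \<and> smooth_wrt c d V f"
  shows "smooth_wrt c d W f"
  unfolding smooth_wrt_def
proof (rule smooth_eucl_local)
  fix y assume "y \<in> chart_map c ` W"
  then obtain x where x: "x \<in> W" "y = chart_map c x" by blast
  from assms[OF x(1)] obtain V where "x \<in> V" "V \<subseteq> W" "smooth_wrt c d V f" by blast
  then show "\<exists>V. y \<in> V \<and> V \<subseteq> chart_map c ` W \<and> smooth_eucl (chart_dim c) (chart_dim d) V (coord_rep c d f)"
    unfolding smooth_wrt_def using x(2) by (intro exI[of _ "chart_map c ` V"]) auto
qed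

lemma smooth_wrt_id:
  assumes "chart_of X c" "openin X W" "W \<subseteq> chart_dom c"
  shows "smooth_wrt c c W (\<lambda>x. x)"
  unfolding smooth_wrt_def
proof (rule smooth_eucl_cong[OF smooth_eucl_id[OF chart_of_open_image[OF assms]]])
  fix y assume "y \<in> chart_map c ` W"
  then obtain x where x: "x \<in> W" "y = chart_map c x" by blast
  then have "x \<in> chart_dom c" using assms(3) by blast
  then show "y = coord_rep c c (\<lambda>x. x) y" by (simp add: coord_rep_eq[OF assms(1)] x(2))
qed

lemma smooth_wrt_restrict_source:
  assumes "chart_of X c" "openin X V" "W \<subseteq> chart_dom c \<inter> V"
  shows "smooth_wrt (chart_dim c, chart_dom c \<inter> V, chart_map c) d W f \<longleftrightarrow> smooth_wrt c d W f"
proof -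
  have eq: "coord_rep (chart_dim c, chart_dom c \<inter> V, chart_map c) d f y = coord_rep c d f y"
    if "y \<in> chart_map c ` W" for y
  proof -
    from that obtain x where x: "x \<in> W" "y = chart_map c x" by (elim imageE)
    then have "x \<in> chart_dom c \<inter> V" using assms(3) by blast
    then show ?thesis
      using coord_rep_eq[OF chart_of_restrict[OF assms(1,2)], of x d f] coord_rep_eq[OF assms(1), of x d f] x
      by simp
  qed
  show ?thesis
    unfolding smooth_wrt_def fst_conv snd_conv by (rule smooth_eucl_cong_iff[OF eq])
qed

lemma smooth_wrt_restrict_target:
  "smooth_wrt c (chart_dim d, V, chart_map d) W f \<longleftrightarrow> smooth_wrt c d W f"
  by (simp add: smooth_wrt_def coord_rep_def)

lemma smooth_wrt_continuous_map:
  assumes f: "smooth_wrt c d W f" and c: "chart_of X c" and d: "chart_of Y d"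
    and W: "W \<subseteq> chart_dom c" and fW: "f ` W \<subseteq> chart_dom d"
  shows "continuous_map (subtopology X W) Y f"
proof -
  let ?E = "subtopology (Euclidean_space (chart_dim d)) (chart_map d ` chart_dom d)"
  obtain k where k: "homeomorphic_maps (subtopology Y (chart_dom d)) ?E (chart_map d) k"
    using d unfolding chart_of_def homeomorphic_map_maps by blast
  have 1: "continuous_map (subtopology X W)
      (subtopology (Euclidean_space (chart_dim c)) (chart_map c ` W)) (chart_map c)"
    using continuous_map_from_subtopology_mono[OF chart_of_continuous_map[OF c] W]
    by (simp add: continuous_map_in_subtopology image_subset_iff_funcset[symmetric] image_mono)
  have 2: "continuous_map (subtopology (Euclidean_space (chart_dim c)) (chart_map c ` W)) ?E (coord_rep c d f)"
  proof -
    have "coord_rep c d f (chart_map c x) \<in> chart_map d ` chart_dom d" if "x \<in> W" for x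
    proof -
      have "x \<in> chart_dom c" "f x \<in> chart_dom d" using that W fW by auto
      then show ?thesis by (simp add: coord_rep_eq[OF c])
    qed
    then show ?thesis
      using smooth_eucl_continuous_map[OF f[unfolded smooth_wrt_def]]
      by (auto simp: continuous_map_in_subtopology)
  qed
  have 3: "continuous_map ?E Y k"
    using k continuous_map_into_fulltopology unfolding homeomorphic_maps_def by blast
  have "continuous_map (subtopology X W) Y (k \<circ> (coord_rep c d f \<circ> chart_map c))"
    by (intro continuous_map_compose[OF _ 3] continuous_map_compose[OF 1 2])
  then show ?thesis
  proof (rule continuous_map_eq)
    fix x assume "x \<in> topspace (subtopology X W)"
    then have "x \<in> chart_dom c" "f x \<in> chart_dom d" using W fW by auto
    then show "(k \<circ> (coord_rep c d f \<circ> chart_map c)) x = f x"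
      using k coord_rep_eq[OF c, of x d f] chart_of_subset[OF d]
      by (auto simp: homeomorphic_maps_def)
  qed
qed


section \<open>Smooth manifolds and smooth maps\<close>

text \<open>Compatibility is transitive through an atlas because smoothness is local: near a common point of
  \<open>c\<close> and \<open>e\<close>, the transition factors through a chart of the atlas at that point.\<close>

lemma smooth_transition_trans:
  assumes c: "chart_of X c" and e: "chart_of X e" and A: "\<And>a. a \<in> A \<Longrightarrow> chart_of X a"
    and cov: "chart_dom c \<inter> chart_dom e \<subseteq> (\<Union>a\<in>A. chart_dom a)"
    and ca: "\<And>a. a \<in> A \<Longrightarrow> smooth_transition c a" and ae: "\<And>a. a \<in> A \<Longrightarrow> smooth_transition a e"
  shows "smooth_transition c e"
  unfolding smooth_transition_iff
proof (rule smooth_wrt_local)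
  fix x assume x: "x \<in> chart_dom c \<inter> chart_dom e"
  then obtain a where a: "a \<in> A" "x \<in> chart_dom a" using cov by blast
  let ?W = "chart_dom c \<inter> chart_dom e \<inter> chart_dom a"
  have W: "openin X ?W" using c e A[OF a(1)] by (intro openin_Int chart_of_openin)
  have "smooth_wrt c a ?W (\<lambda>x. x)"
    by (rule smooth_wrt_subset[OF ca[OF a(1), unfolded smooth_transition_iff] c W]) auto
  moreover have "smooth_wrt a e ?W (\<lambda>x. x)"
    by (rule smooth_wrt_subset[OF ae[OF a(1), unfolded smooth_transition_iff] A[OF a(1)] W]) auto
  ultimately have "smooth_wrt c e ?W (\<lambda>x. x)"
    using smooth_wrt_compose[OF _ _ c A[OF a(1)], of ?W "\<lambda>x. x" e ?W "\<lambda>x. x"] by auto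
  then show "\<exists>V. x \<in> V \<and> V \<subseteq> chart_dom c \<inter> chart_dom e \<and> smooth_wrt c e V (\<lambda>x. x)"
    using x a by (intro exI[of _ ?W]) auto
qed

lemma smooth_manifold_chart_of: "smooth_manifold M \<Longrightarrow> c \<in> snd M \<Longrightarrow> chart_of (fst M) c"
  by (simp add: smooth_manifold_def smooth_atlas_def)

lemma smooth_manifold_transition: "smooth_manifold M \<Longrightarrow> c \<in> snd M \<Longrightarrow> d \<in> snd M \<Longrightarrow> smooth_transition c d"
  by (simp add: smooth_manifold_def smooth_atlas_def smoothly_compatible_def)

lemma smooth_manifold_chart_at:
  assumes "smooth_manifold M" "p \<in> topspace (fst M)"
  obtains c where "c \<in> snd M" "p \<in> chart_dom c"
  using assms unfolding smooth_manifold_def smooth_atlas_def by blast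

lemma smooth_atlas_insert:
  assumes A: "smooth_atlas X A" and c: "chart_of X c" "\<And>a. a \<in> A \<Longrightarrow> smoothly_compatible c a"
  shows "smooth_atlas X (insert c A)"
proof -
  have "smoothly_compatible c c"
    using smooth_wrt_id[OF c(1) chart_of_openin[OF c(1)]]
    by (simp add: smoothly_compatible_def smooth_transition_iff)
  moreover have "smoothly_compatible a c" if "a \<in> A" for a
    using c(2)[OF that] by (simp add: smoothly_compatible_def)
  ultimately show ?thesis
    using A c chart_of_subset[OF c(1)] unfolding smooth_atlas_def by auto
qed

text \<open>Maximality in use: compatibility with enough charts to cover the domain suffices.\<close>

lemma smooth_manifold_chart_memI:
  assumes M: "smooth_manifold M" and c: "chart_of (fst M) c"
    and cov: "\<And>p. p \<in> chart_dom c \<Longrightarrow> \<exists>a\<in>snd M. p \<in> chart_dom a \<and> smoothly_compatible c a"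
  shows "c \<in> snd M"
proof -
  let ?A = "{a \<in> snd M. smoothly_compatible c a}"
  have A: "chart_of (fst M) a" if "a \<in> ?A" for a using that smooth_manifold_chart_of[OF M] by blast
  have cov': "chart_dom c \<subseteq> (\<Union>a\<in>?A. chart_dom a)" using cov by blast
  have "smoothly_compatible c e" if e: "e \<in> snd M" for e
  proof -
    have "smooth_transition c e"
    proof (rule smooth_transition_trans[OF c smooth_manifold_chart_of[OF M e] A])
      show "chart_dom c \<inter> chart_dom e \<subseteq> (\<Union>a\<in>?A. chart_dom a)" using cov' by blast
      show "smooth_transition c a" if "a \<in> ?A" for a using that by (simp add: smoothly_compatible_def)
      show "smooth_transition a e" if "a \<in> ?A" for a using smooth_manifold_transition[OF M _ e] that by simp
    qed
    moreover have "smooth_transition e c"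
    proof (rule smooth_transition_trans[OF smooth_manifold_chart_of[OF M e] c A])
      show "chart_dom e \<inter> chart_dom c \<subseteq> (\<Union>a\<in>?A. chart_dom a)" using cov' by blast
      show "smooth_transition a c" if "a \<in> ?A" for a using that by (simp add: smoothly_compatible_def)
      show "smooth_transition e a" if "a \<in> ?A" for a using smooth_manifold_transition[OF M e] that by simp
    qed
    ultimately show ?thesis by (simp add: smoothly_compatible_def)
  qed
  then have "smooth_atlas (fst M) (insert c (snd M))"
    using M smooth_atlas_insert[OF _ c] unfolding smooth_manifold_def by blast
  then have "insert c (snd M) = snd M" using M unfolding smooth_manifold_def by blast
  then show ?thesis by blast
qed

text \<open>Charts that are compatible with a given atlas are compatible with each other, so all of them
  together form an atlas, and an atlas that extends this one consists of such charts.\<close>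

lemma smooth_manifold_generated:
  assumes "Hausdorff_space X" "second_countable_space X" and A: "smooth_atlas X A"
  shows "smooth_manifold (X, generated_structure X A)" "A \<subseteq> generated_structure X A"
proof -
  show sub: "A \<subseteq> generated_structure X A"
    using A by (auto simp: smooth_atlas_def generated_structure_def)
  have Ac: "chart_of X a" if "a \<in> A" for a using A that by (simp add: smooth_atlas_def)
  have cov: "(\<Union>a\<in>A. chart_dom a) = topspace X" using A by (simp add: smooth_atlas_def)
  have tr: "smooth_transition c e" if "c \<in> generated_structure X A" "e \<in> generated_structure X A" for c e
  proof (rule smooth_transition_trans[of X c e A])
    show "chart_of X c" "chart_of X e" using that by (auto simp: generated_structure_def)
    then show "chart_dom c \<inter> chart_dom e \<subseteq> (\<Union>a\<in>A. chart_dom a)" using cov chart_of_subset by blast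
    show "chart_of X a" if "a \<in> A" for a using Ac that .
    show "smooth_transition c a" if "a \<in> A" for a
      using \<open>c \<in> generated_structure X A\<close> that by (simp add: generated_structure_def smoothly_compatible_def)
    show "smooth_transition a e" if "a \<in> A" for a
      using \<open>e \<in> generated_structure X A\<close> that by (simp add: generated_structure_def smoothly_compatible_def)
  qed
  have at: "smooth_atlas X (generated_structure X A)"
    unfolding smooth_atlas_def
  proof (intro conjI ballI)
    show ch: "chart_of X c" if "c \<in> generated_structure X A" for c
      using that by (simp add: generated_structure_def)
    have "(\<Union>c\<in>generated_structure X A. chart_dom c) \<subseteq> topspace X"
      by (intro UN_least chart_of_subset ch)
    moreover have "topspace X \<subseteq> (\<Union>c\<in>generated_structure X A. chart_dom c)"
      unfolding cov[symmetric] using sub by (rule UN_mono) simp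
    ultimately show "(\<Union>c\<in>generated_structure X A. chart_dom c) = topspace X" by (rule subset_antisym)
    show "smoothly_compatible c d" if "c \<in> generated_structure X A" "d \<in> generated_structure X A" for c d
      using tr that by (simp add: smoothly_compatible_def)
  qed
  have "A' = generated_structure X A" if "smooth_atlas X A'" "generated_structure X A \<subseteq> A'" for A'
  proof -
    have "A \<subseteq> A'" using sub that(2) by (rule subset_trans)
    have "c \<in> generated_structure X A" if c: "c \<in> A'" for c
    proof -
      have "chart_of X c" "\<forall>d\<in>A'. smoothly_compatible c d"
        using \<open>smooth_atlas X A'\<close> c unfolding smooth_atlas_def by simp_all
      moreover have "\<forall>d\<in>A. smoothly_compatible c d"
        using calculation(2) \<open>A \<subseteq> A'\<close> by (meson subsetD)
      ultimately show ?thesis by (simp add: generated_structure_def)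
    qed
    then have "A' \<subseteq> generated_structure X A" by (rule subsetI)
    then show ?thesis using that(2) by blast
  qed
  then show "smooth_manifold (X, generated_structure X A)"
    using assms at by (simp add: smooth_manifold_def)
qed

lemma smooth_manifold_restrict_chart:
  assumes M: "smooth_manifold M" and c: "c \<in> snd M" and V: "openin (fst M) V"
  shows "(chart_dim c, chart_dom c \<inter> V, chart_map c) \<in> snd M"
proof (rule smooth_manifold_chart_memI[OF M])
  let ?r = "(chart_dim c, chart_dom c \<inter> V, chart_map c)"
  have cc: "chart_of (fst M) c" using smooth_manifold_chart_of[OF M c] .
  show r: "chart_of (fst M) ?r" using chart_of_restrict[OF cc V] .
  have "smooth_wrt c c (chart_dom c \<inter> V) (\<lambda>x. x)"
    using smooth_wrt_id[OF cc chart_of_openin[OF r]] by simp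
  then have "smoothly_compatible ?r c"
    using smooth_wrt_restrict_source[OF cc V, of "chart_dom c \<inter> V" c]
    by (simp add: smoothly_compatible_def smooth_transition_iff smooth_wrt_restrict_target
        Int_absorb1 Int_absorb2 Int_commute Int_left_absorb Int_left_commute)
  then show "\<exists>a\<in>snd M. p \<in> chart_dom a \<and> smoothly_compatible ?r a" if "p \<in> chart_dom ?r" for p
    using c that by auto
qed


subsection \<open>Smooth maps\<close>

lemma smooth_map_funcset: "smooth_map M N f \<Longrightarrow> p \<in> topspace (fst M) \<Longrightarrow> f p \<in> topspace (fst N)"
  by (auto simp: smooth_map_def)

lemma smooth_map_charts_at:
  assumes "smooth_map M N f" "p \<in> topspace (fst M)"
  obtains c d where "c \<in> snd M" "d \<in> snd N" "p \<in> chart_dom c" "f ` chart_dom c \<subseteq> chart_dom d"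
    "smooth_wrt c d (chart_dom c) f"
  using assms unfolding smooth_map_def adapted_charts_def smooth_wrt_def by blast

definition smooth_at :: "'a mfd \<Rightarrow> 'b mfd \<Rightarrow> ('a \<Rightarrow> 'b) \<Rightarrow> 'a \<Rightarrow> bool" where
  "smooth_at M N f p \<longleftrightarrow> (\<exists>c\<in>snd M. \<exists>d\<in>snd N. \<exists>W. openin (fst M) W \<and> p \<in> W \<and>
     W \<subseteq> chart_dom c \<and> f ` W \<subseteq> chart_dom d \<and> smooth_wrt c d W f)"

text \<open>The adapted charts in the definition of smoothness can be had by shrinking: a maximal atlas
  contains the restrictions of its charts to open sets.\<close>

lemma smooth_mapI:
  assumes M: "smooth_manifold M" and f: "\<And>p. p \<in> topspace (fst M) \<Longrightarrow> f p \<in> topspace (fst N)"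
    and loc: "\<And>p. p \<in> topspace (fst M) \<Longrightarrow> smooth_at M N f p"
  shows "smooth_map M N f"
  unfolding smooth_map_def
proof (intro conjI ballI)
  fix p assume "p \<in> topspace (fst M)"
  from loc[OF this] obtain c d W where *: "c \<in> snd M" "d \<in> snd N" "openin (fst M) W" "p \<in> W"
      "W \<subseteq> chart_dom c" "f ` W \<subseteq> chart_dom d" "smooth_wrt c d W f"
    unfolding smooth_at_def by blast
  let ?r = "(chart_dim c, chart_dom c \<inter> W, chart_map c)"
  have "?r \<in> snd M" using smooth_manifold_restrict_chart[OF M] * by blast
  then have "adapted_charts M N f p ?r d" using * by (auto simp: adapted_charts_def)
  moreover have "smooth_wrt ?r d W f"
    using smooth_wrt_restrict_source[OF smooth_manifold_chart_of[OF M *(1)] *(3), of W d f] * by simp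
  then have "smooth_eucl (chart_dim ?r) (chart_dim d) (chart_map ?r ` chart_dom ?r) (coord_rep ?r d f)"
    using *(5) by (simp add: smooth_wrt_def Int_absorb1)
  ultimately show "\<exists>c d. adapted_charts M N f p c d \<and>
      smooth_eucl (chart_dim c) (chart_dim d) (chart_map c ` chart_dom c) (coord_rep c d f)" by blast
qed (use f in blast)

lemma smooth_map_continuous_map:
  assumes M: "smooth_manifold M" and N: "smooth_manifold N" and f: "smooth_map M N f"
  shows "continuous_map (fst M) (fst N) f"
proof (rule continuous_map_local)
  fix p assume "p \<in> topspace (fst M)"
  from smooth_map_charts_at[OF f this] obtain c d where
    *: "c \<in> snd M" "d \<in> snd N" "p \<in> chart_dom c" "f ` chart_dom c \<subseteq> chart_dom d"
    "smooth_wrt c d (chart_dom c) f" .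
  have c: "chart_of (fst M) c" and d: "chart_of (fst N) d"
    using smooth_manifold_chart_of[OF M *(1)] smooth_manifold_chart_of[OF N *(2)] .
  show "\<exists>V. openin (fst M) V \<and> p \<in> V \<and> continuous_map (subtopology (fst M) V) (fst N) f"
    using smooth_wrt_continuous_map[OF *(5) c d] *(3,4) chart_of_openin[OF c] by auto
qed

lemma openin_smooth_preimage:
  assumes M: "smooth_manifold M" and N: "smooth_manifold N" and f: "smooth_map M N f"
    and U: "openin (fst M) U" and V: "openin (fst N) V"
  shows "openin (fst M) {x \<in> U. f x \<in> V}"
proof -
  have "openin (fst M) (U \<inter> {x \<in> topspace (fst M). f x \<in> V})"
    using openin_continuous_map_preimage[OF smooth_map_continuous_map[OF M N f] V] U by blast
  moreover have "U \<inter> {x \<in> topspace (fst M). f x \<in> V} = {x \<in> U. f x \<in> V}"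
    using openin_subset[OF U] by blast
  ultimately show ?thesis by simp
qed

text \<open>Smoothness is independent of the charts in which it is tested: near each point, pass through
  the charts that witness smoothness there.\<close>

lemma smooth_map_smooth_wrt:
  assumes M: "smooth_manifold M" and N: "smooth_manifold N" and f: "smooth_map M N f"
    and c: "c \<in> snd M" and d: "d \<in> snd N"
    and W: "openin (fst M) W" "W \<subseteq> chart_dom c" "f ` W \<subseteq> chart_dom d"
  shows "smooth_wrt c d W f"
proof (rule smooth_wrt_local)
  fix p assume p: "p \<in> W"
  then have "p \<in> topspace (fst M)" using W(1) openin_subset by blast
  from smooth_map_charts_at[OF f this] obtain c' d' where
    *: "c' \<in> snd M" "d' \<in> snd N" "p \<in> chart_dom c'" "f ` chart_dom c' \<subseteq> chart_dom d'"
    "smooth_wrt c' d' (chart_dom c') f" .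
  have cc: "chart_of (fst M) c" "chart_of (fst M) c'" and dd: "chart_of (fst N) d" "chart_of (fst N) d'"
    using smooth_manifold_chart_of[OF M c] smooth_manifold_chart_of[OF M *(1)]
      smooth_manifold_chart_of[OF N d] smooth_manifold_chart_of[OF N *(2)] .
  let ?V = "W \<inter> chart_dom c'"
  have V: "openin (fst M) ?V" using W(1) chart_of_openin[OF cc(2)] by blast
  have 1: "smooth_wrt c c' ?V (\<lambda>x. x)"
    using smooth_wrt_subset[OF smooth_manifold_transition[OF M c *(1), unfolded smooth_transition_iff] cc(1) V] W(2)
    by auto
  have 2: "smooth_wrt c' d' ?V f" using smooth_wrt_subset[OF *(5) cc(2) V] by auto
  have "smooth_wrt c d' ?V (\<lambda>x. f x)"
    using smooth_wrt_compose[OF 1 2 cc] W(2) by auto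
  moreover have "smooth_wrt d' d (chart_dom d' \<inter> chart_dom d) (\<lambda>x. x)"
    using smooth_manifold_transition[OF N *(2) d] by (simp add: smooth_transition_iff)
  ultimately have "smooth_wrt c d ?V f"
    using smooth_wrt_compose[OF _ _ cc(1) dd(2), of ?V f d "chart_dom d' \<inter> chart_dom d" "\<lambda>x. x"] W(2,3) *(4)
    by (auto simp: image_subset_iff)
  then show "\<exists>V. p \<in> V \<and> V \<subseteq> W \<and> smooth_wrt c d V f" using p *(3) by blast
qed

lemma smooth_map_compose:
  assumes M: "smooth_manifold M" and N: "smooth_manifold N"
    and f: "smooth_map M N f" and g: "smooth_map N P g"
  shows "smooth_map M P (\<lambda>x. g (f x))"
proof (rule smooth_mapI[OF M])
  show "g (f p) \<in> topspace (fst P)" if "p \<in> topspace (fst M)" for p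
    using smooth_map_funcset f g that by metis
  fix p assume p: "p \<in> topspace (fst M)"
  from smooth_map_charts_at[OF g smooth_map_funcset[OF f p]] obtain d e where
    *: "d \<in> snd N" "e \<in> snd P" "f p \<in> chart_dom d" "g ` chart_dom d \<subseteq> chart_dom e"
    "smooth_wrt d e (chart_dom d) g" .
  obtain c where c: "c \<in> snd M" "p \<in> chart_dom c" using smooth_manifold_chart_at[OF M p] .
  have cc: "chart_of (fst M) c" and dd: "chart_of (fst N) d"
    using smooth_manifold_chart_of[OF M c(1)] smooth_manifold_chart_of[OF N *(1)] .
  let ?W = "{x \<in> chart_dom c. f x \<in> chart_dom d}"
  have W: "openin (fst M) ?W"
    by (rule openin_smooth_preimage[OF M N f chart_of_openin[OF cc] chart_of_openin[OF dd]])
  have "smooth_wrt c d ?W f" by (rule smooth_map_smooth_wrt[OF M N f c(1) *(1) W]) auto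
  then have "smooth_wrt c e ?W (\<lambda>x. g (f x))"
    using smooth_wrt_compose[OF _ *(5) cc dd] by auto
  then show "smooth_at M P (\<lambda>x. g (f x)) p"
    using W * c unfolding smooth_at_def by (intro bexI[OF _ c(1)] bexI[OF _ *(2)] exI[of _ ?W] conjI) auto
qed

lemma smooth_map_cong:
  assumes M: "smooth_manifold M" and f: "smooth_map M N f" and fg: "\<And>x. x \<in> topspace (fst M) \<Longrightarrow> f x = g x"
  shows "smooth_map M N g"
proof (rule smooth_mapI[OF M])
  show "g p \<in> topspace (fst N)" if "p \<in> topspace (fst M)" for p
    using smooth_map_funcset[OF f that] fg[OF that] by simp
  fix p assume "p \<in> topspace (fst M)"
  from smooth_map_charts_at[OF f this] obtain c d where
    *: "c \<in> snd M" "d \<in> snd N" "p \<in> chart_dom c" "f ` chart_dom c \<subseteq> chart_dom d"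
    "smooth_wrt c d (chart_dom c) f" .
  have c: "chart_of (fst M) c" using smooth_manifold_chart_of[OF M *(1)] .
  have fg': "f x = g x" if "x \<in> chart_dom c" for x using fg chart_of_subset[OF c] that by blast
  have "smooth_wrt c d (chart_dom c) g" by (rule smooth_wrt_cong[OF *(5) c]) (use fg' in auto)
  moreover have "g ` chart_dom c \<subseteq> chart_dom d" using *(4) fg' by force
  ultimately show "smooth_at M N g p"
    using * chart_of_openin[OF c]
    unfolding smooth_at_def by (intro bexI[OF _ *(1)] bexI[OF _ *(2)] exI[of _ "chart_dom c"] conjI) simp_all
qed

lemma smooth_map_id:
  assumes M: "smooth_manifold M" shows "smooth_map M M (\<lambda>x. x)"
proof (rule smooth_mapI[OF M])
  fix p assume "p \<in> topspace (fst M)"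
  then obtain c where c: "c \<in> snd M" "p \<in> chart_dom c" using smooth_manifold_chart_at[OF M] by blast
  then show "smooth_at M M (\<lambda>x. x) p"
    using chart_of_openin[OF smooth_manifold_chart_of[OF M c(1)]]
      smooth_wrt_id[OF smooth_manifold_chart_of[OF M c(1)]]
    unfolding smooth_at_def by (intro bexI[OF _ c(1)] exI[of _ "chart_dom c"] conjI) simp_all
qed auto

lemma smooth_map_const:
  assumes M: "smooth_manifold M" and N: "smooth_manifold N" and q: "q \<in> topspace (fst N)"
  shows "smooth_map M N (\<lambda>x. q)"
proof (rule smooth_mapI[OF M])
  fix p assume "p \<in> topspace (fst M)"
  then obtain c where c: "c \<in> snd M" "p \<in> chart_dom c" using smooth_manifold_chart_at[OF M] by blast
  obtain d where d: "d \<in> snd N" "q \<in> chart_dom d" using smooth_manifold_chart_at[OF N q] by blast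
  have cc: "chart_of (fst M) c" and dd: "chart_of (fst N) d"
    using smooth_manifold_chart_of[OF M c(1)] smooth_manifold_chart_of[OF N d(1)] .
  have o: "openin (Euclidean_space (chart_dim c)) (chart_map c ` chart_dom c)"
    using cc by (simp add: chart_of_def)
  have "chart_map d q \<in> topspace (Euclidean_space (chart_dim d))"
    using chart_of_open_image[OF dd chart_of_openin[OF dd]] d(2) openin_subset by blast
  then have "smooth_wrt c d (chart_dom c) (\<lambda>x. q)"
    using o by (auto simp: smooth_wrt_def coord_rep_def smooth_eucl_iff C_diff_const)
  then show "smooth_at M N (\<lambda>x. q) p"
    using c d chart_of_openin[OF cc]
    unfolding smooth_at_def by (intro bexI[OF _ c(1)] bexI[OF _ d(1)] exI[of _ "chart_dom c"] conjI) auto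
qed (use q in auto)

text \<open>The identity is smooth in both directions exactly if the charts of the two structures are
  compatible with each other; maximality then makes the structures equal.\<close>

lemma smooth_structure_eqI:
  assumes B: "smooth_manifold (X, B)" and B': "smooth_manifold (X, B')"
    and 1: "smooth_map (X, B) (X, B') (\<lambda>x. x)" and 2: "smooth_map (X, B') (X, B) (\<lambda>x. x)"
  shows "B = B'"
proof -
  have tr: "smooth_transition c d"
    if M: "smooth_manifold (X, B1)" "smooth_manifold (X, B2)" "smooth_map (X, B1) (X, B2) (\<lambda>x. x)"
      and cd: "c \<in> B1" "d \<in> B2" for B1 B2 c d
  proof -
    have c: "chart_of X c" and d: "chart_of X d"
      using smooth_manifold_chart_of[OF M(1), of c] smooth_manifold_chart_of[OF M(2), of d] cd by simp_all
    show ?thesis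
      unfolding smooth_transition_iff
      by (rule smooth_map_smooth_wrt[OF M])
        (use cd openin_Int[OF chart_of_openin[OF c] chart_of_openin[OF d]] in simp_all)
  qed
  have "B1 \<subseteq> B2" if M: "smooth_manifold (X, B1)" "smooth_manifold (X, B2)"
    and i: "smooth_map (X, B1) (X, B2) (\<lambda>x. x)" "smooth_map (X, B2) (X, B1) (\<lambda>x. x)" for B1 B2
  proof
    fix c assume c: "c \<in> B1"
    then have cc: "chart_of X c" using smooth_manifold_chart_of[OF M(1)] by simp
    have "c \<in> snd (X, B2)"
    proof (rule smooth_manifold_chart_memI[OF M(2)])
      fix p assume "p \<in> chart_dom c"
      then have "p \<in> topspace (fst (X, B2))" using chart_of_subset[OF cc] by auto
      from smooth_manifold_chart_at[OF M(2) this] obtain a where a: "a \<in> snd (X, B2)" "p \<in> chart_dom a" .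
      then have "smoothly_compatible c a"
        using tr[OF M i(1) c, of a] tr[OF M(2,1) i(2) _ c, of a] by (simp add: smoothly_compatible_def)
      then show "\<exists>a\<in>snd (X, B2). p \<in> chart_dom a \<and> smoothly_compatible c a" using a by blast
    qed (use cc in simp)
    then show "c \<in> B2" by simp
  qed
  then show ?thesis using assms by blast
qed


subsection \<open>Open submanifolds\<close>

lemma fst_open_submfd [simp]: "fst (open_submfd M U) = subtopology (fst M) U"
  by (simp add: open_submfd_def)

lemma snd_open_submfd [simp]: "c \<in> snd (open_submfd M U) \<longleftrightarrow> c \<in> snd M \<and> chart_dom c \<subseteq> U"
  by (simp add: open_submfd_def)

lemma open_submfd_open_submfd: "open_submfd (open_submfd M U) V = open_submfd M (U \<inter> V)"
  by (auto simp: open_submfd_def subtopology_subtopology)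

lemma open_submfd_Int_topspace:
  assumes M: "smooth_manifold M"
  shows "open_submfd M U = open_submfd M (topspace (fst M) \<inter> U)"
proof -
  have "chart_dom c \<subseteq> topspace (fst M)" if "c \<in> snd M" for c
    by (rule chart_of_subset[OF smooth_manifold_chart_of[OF M that]])
  moreover have "subtopology (fst M) U = subtopology (fst M) (topspace (fst M) \<inter> U)"
    by (metis subtopology_restrict)
  ultimately show ?thesis by (auto simp: open_submfd_def)
qed

text \<open>Maximality of the restricted atlas comes from that of \<open>M\<close>: a chart inside \<open>U\<close> that is compatible with
  the charts of \<open>M\<close> inside \<open>U\<close> is compatible with enough charts of \<open>M\<close> to cover its domain.\<close>

lemma smooth_manifold_open_submfd:
  assumes M: "smooth_manifold M" and U: "openin (fst M) U"
  shows "smooth_manifold (open_submfd M U)"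
proof -
  have ch: "chart_of (subtopology (fst M) U) c \<longleftrightarrow> chart_of (fst M) c \<and> chart_dom c \<subseteq> U" for c
    using chart_of_subtopology[OF U] .
  have small: "\<exists>c\<in>snd (open_submfd M U). p \<in> chart_dom c" if p: "p \<in> U" for p
  proof -
    have "p \<in> topspace (fst M)" using p openin_subset[OF U] by blast
    then obtain c where c: "c \<in> snd M" "p \<in> chart_dom c" using smooth_manifold_chart_at[OF M] by blast
    then show ?thesis using smooth_manifold_restrict_chart[OF M c(1) U] p
      by (intro bexI[of _ "(chart_dim c, chart_dom c \<inter> U, chart_map c)"]) auto
  qed
  have "smooth_atlas (subtopology (fst M) U) (snd (open_submfd M U))"
    unfolding smooth_atlas_def
  proof (intro conjI ballI)
    show "chart_of (subtopology (fst M) U) c" if "c \<in> snd (open_submfd M U)" for c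
      using that ch[of c] smooth_manifold_chart_of[OF M, of c] by simp
    show "(\<Union>c\<in>snd (open_submfd M U). chart_dom c) = topspace (subtopology (fst M) U)"
    proof (rule subset_antisym)
      show "(\<Union>c\<in>snd (open_submfd M U). chart_dom c) \<subseteq> topspace (subtopology (fst M) U)"
        using openin_subset[OF U] by (intro UN_least) (simp add: Int_absorb1)
      show "topspace (subtopology (fst M) U) \<subseteq> (\<Union>c\<in>snd (open_submfd M U). chart_dom c)"
        using small by fastforce
    qed
    show "smoothly_compatible c d" if "c \<in> snd (open_submfd M U)" "d \<in> snd (open_submfd M U)" for c d
      using that smooth_manifold_transition[OF M] by (simp add: smoothly_compatible_def)
  qed
  moreover have "A = snd (open_submfd M U)"
    if A: "smooth_atlas (subtopology (fst M) U) A" "snd (open_submfd M U) \<subseteq> A" for A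
  proof -
    have "c \<in> snd (open_submfd M U)" if c: "c \<in> A" for c
    proof -
      have cc: "chart_of (fst M) c" "chart_dom c \<subseteq> U" using A(1) c ch[of c] by (simp_all add: smooth_atlas_def)
      have "c \<in> snd M"
      proof (rule smooth_manifold_chart_memI[OF M cc(1)])
        fix p assume "p \<in> chart_dom c"
        then have "p \<in> U" using cc(2) by blast
        from small[OF this] obtain a where "a \<in> snd (open_submfd M U)" "p \<in> chart_dom a" by (elim bexE)
        moreover have "smoothly_compatible c a"
          using A c calculation(1) unfolding smooth_atlas_def by (meson subsetD)
        ultimately show "\<exists>a\<in>snd M. p \<in> chart_dom a \<and> smoothly_compatible c a"
          using snd_open_submfd by blast
      qed
      then show ?thesis using cc(2) by simp
    qed
    then show ?thesis using A(2) by blast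
  qed
  moreover have "second_countable_space (subtopology (fst M) U)"
    using M second_countable_subtopology by (auto simp: smooth_manifold_def second_countable_space_iff)
  ultimately show ?thesis
    using M Hausdorff_space_subtopology unfolding smooth_manifold_def fst_open_submfd by blast
qed

lemma smooth_map_restrict:
  assumes M: "smooth_manifold M" and U: "openin (fst M) U" and f: "smooth_map M N f"
  shows "smooth_map (open_submfd M U) N f"
proof (rule smooth_mapI[OF smooth_manifold_open_submfd[OF M U]])
  show "f p \<in> topspace (fst N)" if "p \<in> topspace (fst (open_submfd M U))" for p
    using that smooth_map_funcset[OF f] by simp
  fix p assume p: "p \<in> topspace (fst (open_submfd M U))"
  then have "p \<in> topspace (fst M)" by simp
  from smooth_map_charts_at[OF f this] obtain c d where
    *: "c \<in> snd M" "d \<in> snd N" "p \<in> chart_dom c" "f ` chart_dom c \<subseteq> chart_dom d"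
    "smooth_wrt c d (chart_dom c) f" .
  have c: "chart_of (fst M) c" using smooth_manifold_chart_of[OF M *(1)] .
  let ?r = "(chart_dim c, chart_dom c \<inter> U, chart_map c)"
  have o: "openin (fst M) (chart_dom c \<inter> U)" using U chart_of_openin[OF c] by blast
  have "smooth_wrt c d (chart_dom c \<inter> U) f" by (rule smooth_wrt_subset[OF *(5) c o]) auto
  then have "smooth_wrt ?r d (chart_dom c \<inter> U) f"
    using smooth_wrt_restrict_source[OF c U] by blast
  moreover have "?r \<in> snd (open_submfd M U)" using smooth_manifold_restrict_chart[OF M *(1) U] by simp
  ultimately show "smooth_at (open_submfd M U) N f p"
    using *(2,3,4) p o U
    unfolding smooth_at_def by (intro bexI[of _ ?r] bexI[of _ d] exI[of _ "chart_dom c \<inter> U"] conjI) (auto simp: openin_open_subtopology)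
qed

lemma smooth_map_local:
  assumes "\<And>p. p \<in> topspace (fst M) \<Longrightarrow> \<exists>U. openin (fst M) U \<and> p \<in> U \<and> smooth_map (open_submfd M U) N f"
  shows "smooth_map M N f"
  unfolding smooth_map_def
proof (intro conjI ballI)
  show "f \<in> topspace (fst M) \<rightarrow> topspace (fst N)"
  proof
    fix p assume p: "p \<in> topspace (fst M)"
    from assms[OF this] obtain U where "p \<in> U" "smooth_map (open_submfd M U) N f" by blast
    then show "f p \<in> topspace (fst N)" using p smooth_map_funcset[of "open_submfd M U" N f p] by simp
  qed
  fix p assume p: "p \<in> topspace (fst M)"
  from assms[OF this] obtain U where U: "p \<in> U" "smooth_map (open_submfd M U) N f" by blast
  then have "p \<in> topspace (fst (open_submfd M U))" using p by simp
  from smooth_map_charts_at[OF U(2) this] show "\<exists>c d. adapted_charts M N f p c d \<and>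
      smooth_eucl (chart_dim c) (chart_dim d) (chart_map c ` chart_dom c) (coord_rep c d f)"
    unfolding adapted_charts_def smooth_wrt_def snd_open_submfd by metis
qed

lemma smooth_map_into_open:
  assumes M: "smooth_manifold M" and N: "smooth_manifold N" and V: "openin (fst N) V"
    and f: "smooth_map M N f" and fV: "\<And>p. p \<in> topspace (fst M) \<Longrightarrow> f p \<in> V"
  shows "smooth_map M (open_submfd N V) f"
proof (rule smooth_mapI[OF M])
  show "f p \<in> topspace (fst (open_submfd N V))" if "p \<in> topspace (fst M)" for p
    using that fV smooth_map_funcset[OF f] by simp
  fix p assume p: "p \<in> topspace (fst M)"
  from smooth_map_charts_at[OF f this] obtain c d where
    *: "c \<in> snd M" "d \<in> snd N" "p \<in> chart_dom c" "f ` chart_dom c \<subseteq> chart_dom d"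
    "smooth_wrt c d (chart_dom c) f" .
  have c: "chart_of (fst M) c" using smooth_manifold_chart_of[OF M *(1)] .
  let ?r = "(chart_dim d, chart_dom d \<inter> V, chart_map d)"
  have "?r \<in> snd (open_submfd N V)" using smooth_manifold_restrict_chart[OF N *(2) V] by simp
  moreover have "f ` chart_dom c \<subseteq> V" using fV chart_of_subset[OF c] by blast
  ultimately show "smooth_at M (open_submfd N V) f p"
    using * chart_of_openin[OF c] smooth_wrt_restrict_target[of c d "chart_dom d \<inter> V"]
    unfolding smooth_at_def by (intro bexI[OF _ *(1)] bexI[of _ ?r] exI[of _ "chart_dom c"] conjI) auto
qed

lemma smooth_map_from_open:
  assumes f: "smooth_map M (open_submfd N V) f"
  shows "smooth_map M N f"
proof -
  have "f \<in> topspace (fst M) \<rightarrow> topspace (fst N)" using smooth_map_funcset[OF f] by auto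
  then show ?thesis
    using f unfolding smooth_map_def adapted_charts_def by (metis snd_open_submfd)
qed

lemma diffeomorphism_inverse:
  assumes M: "smooth_manifold M" and f: "diffeomorphism M N f"
  shows "diffeomorphism N M (inv_into (topspace (fst M)) f)"
proof -
  let ?g = "inv_into (topspace (fst M)) f"
  have b: "bij_betw f (topspace (fst M)) (topspace (fst N))" using f by (simp add: diffeomorphism_def)
  have "smooth_map M N (inv_into (topspace (fst N)) ?g)"
    by (rule smooth_map_cong[OF M, of _ f])
      (use f inv_into_inv_into_eq[OF b] in \<open>auto simp: diffeomorphism_def\<close>)
  then show ?thesis using f bij_betw_inv_into[OF b] by (simp add: diffeomorphism_def)
qed

subsection \<open>Transport of charts along homeomorphisms\<close>

lemma homeomorphic_map_inv_into:
  assumes "homeomorphic_map X Y h"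
  shows "homeomorphic_maps X Y h (inv_into (topspace X) h)"
proof -
  obtain k where k: "homeomorphic_maps X Y h k" using assms homeomorphic_map_maps by blast
  have inj: "inj_on h (topspace X)" and im: "h ` topspace X = topspace Y"
    using homeomorphic_imp_injective_map[OF assms] homeomorphic_imp_surjective_map[OF assms] .
  have kx: "k y = inv_into (topspace X) h y" if "y \<in> topspace Y" for y
  proof -
    from that im obtain x where "x \<in> topspace X" "y = h x" by blast
    then show ?thesis using k inj by (simp add: homeomorphic_maps_def)
  qed
  show ?thesis by (rule homeomorphic_maps_eq[OF k]) (use kx in auto)
qed

definition push_chart :: "'a topology \<Rightarrow> ('a \<Rightarrow> 'b) \<Rightarrow> 'a chart \<Rightarrow> 'b chart" where
  "push_chart X h c = (chart_dim c, h ` chart_dom c, \<lambda>y. chart_map c (inv_into (topspace X) h y))"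

lemma push_chart_simps [simp]:
  "chart_dim (push_chart X h c) = chart_dim c"
  "chart_dom (push_chart X h c) = h ` chart_dom c"
  by (simp_all add: push_chart_def)

lemma chart_map_push:
  "inj_on h (topspace X) \<Longrightarrow> x \<in> topspace X \<Longrightarrow> chart_map (push_chart X h c) (h x) = chart_map c x"
  by (simp add: push_chart_def)

lemma chart_of_push:
  assumes h: "homeomorphic_map X (subtopology Z V) h" and V: "openin Z V" and c: "chart_of X c"
  shows "chart_of Z (push_chart X h c)"
proof -
  let ?k = "inv_into (topspace X) h" and ?p = "push_chart X h c"
  have hk: "homeomorphic_maps X (subtopology Z V) h ?k" by (rule homeomorphic_map_inv_into[OF h])
  have inj: "inj_on h (topspace X)" using h homeomorphic_imp_injective_map by blast
  have cs: "chart_dom c \<subseteq> topspace X" by (rule chart_of_subset[OF c])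
  have "openin (subtopology Z V) (h ` chart_dom c)"
    using homeomorphic_imp_open_map[OF h] chart_of_openin[OF c] by (simp add: open_map_def)
  then have op: "openin Z (h ` chart_dom c)" and sub: "h ` chart_dom c \<subseteq> V"
    using V by (simp_all add: openin_open_subtopology)
  have im: "chart_map ?p ` chart_dom ?p = chart_map c ` chart_dom c"
    unfolding push_chart_simps image_image by (rule image_cong[OF refl]) (use chart_map_push[OF inj] cs in blast)
  have "homeomorphic_maps (subtopology X (chart_dom c)) (subtopology (subtopology Z V) (h ` chart_dom c)) h ?k"
  proof (rule homeomorphic_maps_subtopologies[OF hk])
    have "h ` chart_dom c \<subseteq> topspace (subtopology Z V)" using openin_subset[OF op] sub by simp
    then show "h ` (topspace X \<inter> chart_dom c) = topspace (subtopology Z V) \<inter> h ` chart_dom c"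
      using cs by (simp only: inf_absorb2)
  qed
  moreover have "subtopology (subtopology Z V) (h ` chart_dom c) = subtopology Z (h ` chart_dom c)"
    using sub by (simp add: subtopology_subtopology inf_absorb2)
  ultimately have "homeomorphic_map (subtopology Z (h ` chart_dom c)) (subtopology X (chart_dom c)) ?k"
    by (simp add: homeomorphic_maps_map)
  moreover have "homeomorphic_map (subtopology X (chart_dom c))
      (subtopology (Euclidean_space (chart_dim c)) (chart_map c ` chart_dom c)) (chart_map c)"
    using c by (simp add: chart_of_def)
  ultimately have "homeomorphic_map (subtopology Z (h ` chart_dom c))
      (subtopology (Euclidean_space (chart_dim c)) (chart_map c ` chart_dom c)) (chart_map c \<circ> ?k)"
    by (rule homeomorphic_map_compose)
  moreover have "chart_map ?p = chart_map c \<circ> ?k" by (simp add: push_chart_def o_def)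
  moreover have "openin (Euclidean_space (chart_dim c)) (chart_map c ` chart_dom c)"
    using c by (simp add: chart_of_def)
  ultimately show ?thesis
    using op im by (simp add: chart_of_def)
qed

lemma smooth_wrt_push_source:
  assumes p: "chart_of Z (push_chart X h c)" and c: "chart_of X c" and inj: "inj_on h (topspace X)"
    and W: "W \<subseteq> chart_dom c"
  shows "smooth_wrt (push_chart X h c) d (h ` W) f \<longleftrightarrow> smooth_wrt c d W (\<lambda>x. f (h x))"
proof -
  have cs: "chart_dom c \<subseteq> topspace X" by (rule chart_of_subset[OF c])
  have im: "chart_map (push_chart X h c) ` h ` W = chart_map c ` W"
    unfolding image_image by (rule image_cong[OF refl]) (use chart_map_push[OF inj] cs W in blast)
  have eq: "coord_rep (push_chart X h c) d f y = coord_rep c d (\<lambda>x. f (h x)) y" if "y \<in> chart_map c ` W" for y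
  proof -
    from that obtain x where x: "x \<in> W" "y = chart_map c x" by (elim imageE)
    then have xc: "x \<in> chart_dom c" "x \<in> topspace X" using W cs by auto
    then have "y = chart_map (push_chart X h c) (h x)" using chart_map_push[OF inj] x by simp
    then have "coord_rep (push_chart X h c) d f y = chart_map d (f (h x))"
      using coord_rep_eq[OF p, of "h x" d f] xc by simp
    then show ?thesis using coord_rep_eq[OF c xc(1), of d "\<lambda>x. f (h x)"] x by simp
  qed
  show ?thesis
    unfolding smooth_wrt_def im push_chart_simps by (rule smooth_eucl_cong_iff[OF eq])
qed

lemma smooth_wrt_push_target:
  "smooth_wrt c (push_chart X h d) W f \<longleftrightarrow> smooth_wrt c d W (\<lambda>x. inv_into (topspace X) h (f x))"
  by (simp add: smooth_wrt_def coord_rep_def push_chart_def)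

lemma diffeomorphism_homeomorphic_map:
  assumes M: "smooth_manifold M" and N: "smooth_manifold N" and f: "diffeomorphism M N f"
  shows "homeomorphic_map (fst M) (fst N) f"
proof -
  have "homeomorphic_maps (fst M) (fst N) f (inv_into (topspace (fst M)) f)"
    using f smooth_map_continuous_map[OF M N] smooth_map_continuous_map[OF N M]
    by (auto simp: homeomorphic_maps_def diffeomorphism_def bij_betw_def f_inv_into_f)
  then show ?thesis using homeomorphic_map_maps by blast
qed

text \<open>In the charts \<open>push_chart h c\<close> and \<open>d\<close>, the identity of \<open>M\<close> is \<open>h\<close> in the charts \<open>c\<close> and \<open>d\<close>. Hence
  smoothness of \<open>h\<close> and of its inverse is compatibility of the transported chart.\<close>

lemma push_chart_mem:
  assumes N: "smooth_manifold N" and M: "smooth_manifold M" and V: "openin (fst M) V"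
    and h: "diffeomorphism N (open_submfd M V) h" and c: "c \<in> snd N"
  shows "push_chart (fst N) h c \<in> snd M"
proof (rule smooth_manifold_chart_memI[OF M])
  let ?MV = "open_submfd M V" and ?p = "push_chart (fst N) h c" and ?k = "inv_into (topspace (fst N)) h"
  have MV: "smooth_manifold ?MV" by (rule smooth_manifold_open_submfd[OF M V])
  have hh: "homeomorphic_map (fst N) (subtopology (fst M) V) h"
    using diffeomorphism_homeomorphic_map[OF N MV h] by simp
  have cc: "chart_of (fst N) c" by (rule smooth_manifold_chart_of[OF N c])
  have cs: "chart_dom c \<subseteq> topspace (fst N)" by (rule chart_of_subset[OF cc])
  show p: "chart_of (fst M) ?p" by (rule chart_of_push[OF hh V cc])
  have inj: "inj_on h (topspace (fst N))" and im: "h ` topspace (fst N) = topspace (fst M) \<inter> V"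
    using homeomorphic_imp_injective_map[OF hh] homeomorphic_imp_surjective_map[OF hh] by simp_all
  have sm: "smooth_map N ?MV h" "smooth_map ?MV N ?k" using h by (simp_all add: diffeomorphism_def)
  fix q assume q: "q \<in> chart_dom ?p"
  then have "q \<in> topspace (fst ?MV)" using im cs by auto
  from smooth_manifold_chart_at[OF MV this] obtain a where a: "a \<in> snd ?MV" "q \<in> chart_dom a" .
  have ac: "chart_of (fst ?MV) a" by (rule smooth_manifold_chart_of[OF MV a(1)])
  have am: "a \<in> snd M" "chart_dom a \<subseteq> V" using a(1) by simp_all
  have ac': "chart_of (fst M) a" by (rule smooth_manifold_chart_of[OF M am(1)])
  let ?W = "{x \<in> chart_dom c. h x \<in> chart_dom a}"
  have W: "openin (fst N) ?W"
    by (rule openin_smooth_preimage[OF N MV sm(1) chart_of_openin[OF cc] chart_of_openin[OF ac]])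
  have hW: "h ` ?W = chart_dom ?p \<inter> chart_dom a" by auto
  have "smooth_wrt c a ?W h" by (rule smooth_map_smooth_wrt[OF N MV sm(1) c a(1) W]) auto
  then have 1: "smooth_wrt ?p a (chart_dom ?p \<inter> chart_dom a) (\<lambda>x. x)"
    using smooth_wrt_push_source[OF p cc inj, of ?W a "\<lambda>x. x"] hW by auto
  have o2: "openin (fst ?MV) (chart_dom ?p \<inter> chart_dom a)"
    using openin_Int[OF chart_of_openin[OF p] chart_of_openin[OF ac']] am V
    by (auto simp: openin_open_subtopology)
  have kp: "?k ` (chart_dom ?p \<inter> chart_dom a) \<subseteq> chart_dom c"
    using inj cs by (auto simp: subset_iff)
  have "smooth_wrt a c (chart_dom ?p \<inter> chart_dom a) ?k"
    by (rule smooth_map_smooth_wrt[OF MV N sm(2) a(1) c o2 _ kp]) simp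
  then have 2: "smooth_wrt a ?p (chart_dom a \<inter> chart_dom ?p) (\<lambda>x. x)"
    by (simp add: smooth_wrt_push_target Int_commute)
  show "\<exists>a\<in>snd M. q \<in> chart_dom a \<and> smoothly_compatible ?p a"
    using am a(2) 1 2 by (auto simp: smoothly_compatible_def smooth_transition_iff)
qed

text \<open>
  Manifolds that are homeomorphic to the members of an open cover of \<open>X\<close> glue to a smooth
  structure on \<open>X\<close> as soon as the changes of parametrisation between them are smooth: these are
  exactly the transition maps between the transported charts.
\<close>

theorem glue_smooth_manifolds:
  fixes X :: "'a topology" and N :: "'i \<Rightarrow> 'b mfd"
  assumes X: "Hausdorff_space X" "second_countable_space X"
    and N: "\<And>a. a \<in> I \<Longrightarrow> smooth_manifold (N a)"
    and V: "\<And>a. a \<in> I \<Longrightarrow> openin X (V a)" and cov: "(\<Union>a\<in>I. V a) = topspace X"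
    and h: "\<And>a. a \<in> I \<Longrightarrow> homeomorphic_map (fst (N a)) (subtopology X (V a)) (h a)"
    and tr: "\<And>a b. a \<in> I \<Longrightarrow> b \<in> I \<Longrightarrow>
      smooth_map (open_submfd (N a) {x \<in> topspace (fst (N a)). h a x \<in> V b}) (N b)
        (\<lambda>x. inv_into (topspace (fst (N b))) (h b) (h a x))"
  obtains B where "smooth_manifold (X, B)"
    "\<And>a. a \<in> I \<Longrightarrow> diffeomorphism (N a) (open_submfd (X, B) (V a)) (h a)"
proof -
  let ?k = "\<lambda>a. inv_into (topspace (fst (N a))) (h a)"
  let ?p = "\<lambda>a. push_chart (fst (N a)) (h a)"
  define A where "A = {?p a c | a c. a \<in> I \<and> c \<in> snd (N a)}"
  have inj: "inj_on (h a) (topspace (fst (N a)))" and im: "h a ` topspace (fst (N a)) = V a" if "a \<in> I" for a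
    using homeomorphic_imp_injective_map[OF h[OF that]] homeomorphic_imp_surjective_map[OF h[OF that]]
      openin_subset[OF V[OF that]] by (simp_all add: inf_absorb2)
  have cc: "chart_of (fst (N a)) c" if "a \<in> I" "c \<in> snd (N a)" for a c
    by (rule smooth_manifold_chart_of[OF N[OF that(1)] that(2)])
  have p: "chart_of X (?p a c)" if "a \<in> I" "c \<in> snd (N a)" for a c
    by (rule chart_of_push[OF h[OF that(1)] V[OF that(1)] cc[OF that]])
  have trans: "smooth_transition (?p a c) (?p b d)"
    if a: "a \<in> I" "c \<in> snd (N a)" and b: "b \<in> I" "d \<in> snd (N b)" for a b c d
  proof -
    let ?O = "{x \<in> topspace (fst (N a)). h a x \<in> V b}"
    let ?W = "{x \<in> chart_dom c. h a x \<in> h b ` chart_dom d}"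
    have cs: "chart_dom c \<subseteq> topspace (fst (N a))" "chart_dom d \<subseteq> topspace (fst (N b))"
      using chart_of_subset[OF cc[OF a]] chart_of_subset[OF cc[OF b]] .
    have ha: "continuous_map (fst (N a)) X (h a)"
      using homeomorphic_imp_continuous_map[OF h[OF a(1)]] by (simp add: continuous_map_in_subtopology)
    have O: "openin (fst (N a)) ?O" by (rule openin_continuous_map_preimage[OF ha V[OF b(1)]])
    have "openin (fst (N a)) {x \<in> topspace (fst (N a)). h a x \<in> chart_dom (?p b d)}"
      by (rule openin_continuous_map_preimage[OF ha chart_of_openin[OF p[OF b]]])
    then have "openin (fst (N a)) (chart_dom c \<inter> {x \<in> topspace (fst (N a)). h a x \<in> chart_dom (?p b d)})"
      using chart_of_openin[OF cc[OF a]] by (rule openin_Int[rotated])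
    moreover have "chart_dom c \<inter> {x \<in> topspace (fst (N a)). h a x \<in> chart_dom (?p b d)} = ?W"
      using cs(1) by auto
    ultimately have W: "openin (fst (N a)) ?W" by simp
    have WO: "?W \<subseteq> ?O" using cs im[OF b(1)] by blast
    let ?r = "(chart_dim c, chart_dom c \<inter> ?W, chart_map c)"
    have r: "?r \<in> snd (open_submfd (N a) ?O)"
      using smooth_manifold_restrict_chart[OF N[OF a(1)] a(2) W] WO by auto
    have "smooth_wrt ?r d ?W (\<lambda>x. ?k b (h a x))"
    proof (rule smooth_map_smooth_wrt[OF smooth_manifold_open_submfd[OF N[OF a(1)] O] N[OF b(1)]
          tr[OF a(1) b(1)] r b(2)])
      show "openin (fst (open_submfd (N a) ?O)) ?W" using W WO O by (simp add: openin_open_subtopology)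
      show "(\<lambda>x. ?k b (h a x)) ` ?W \<subseteq> chart_dom d"
      proof clarify
        fix x y assume "h a x = h b y" "y \<in> chart_dom d"
        then show "?k b (h a x) \<in> chart_dom d" using inj[OF b(1)] cs(2) by (simp add: subset_iff)
      qed
    qed auto
    then have "smooth_wrt c d ?W (\<lambda>x. ?k b (h a x))"
      using smooth_wrt_restrict_source[OF cc[OF a] W, of ?W d "\<lambda>x. ?k b (h a x)"] by auto
    then have "smooth_wrt c (?p b d) ?W (h a)" by (simp add: smooth_wrt_push_target)
    then have "smooth_wrt (?p a c) (?p b d) (h a ` ?W) (\<lambda>x. x)"
      using smooth_wrt_push_source[OF p[OF a] cc[OF a] inj[OF a(1)], of ?W "?p b d" "\<lambda>x. x"] by auto
    moreover have "h a ` ?W = chart_dom (?p a c) \<inter> chart_dom (?p b d)" by auto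
    ultimately show ?thesis by (simp add: smooth_transition_iff)
  qed
  have "smooth_atlas X A"
    unfolding smooth_atlas_def
  proof (intro conjI ballI)
    show "chart_of X c" if "c \<in> A" for c
    proof -
      from that obtain a c' where "c = ?p a c'" "a \<in> I" "c' \<in> snd (N a)" unfolding A_def by blast
      then show ?thesis using p by simp
    qed
    show "smoothly_compatible c d" if "c \<in> A" "d \<in> A" for c d
    proof -
      from that obtain a c' b d' where "c = ?p a c'" "a \<in> I" "c' \<in> snd (N a)"
        "d = ?p b d'" "b \<in> I" "d' \<in> snd (N b)" unfolding A_def by blast
      then show ?thesis using trans by (simp add: smoothly_compatible_def)
    qed
    show "(\<Union>c\<in>A. chart_dom c) = topspace X"
    proof (rule subset_antisym)
      show "(\<Union>c\<in>A. chart_dom c) \<subseteq> topspace X"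
        by (intro UN_least chart_of_subset) fact
      show "topspace X \<subseteq> (\<Union>c\<in>A. chart_dom c)"
      proof
        fix x assume "x \<in> topspace X"
        then obtain a where a: "a \<in> I" "x \<in> V a" using cov by blast
        then obtain y where y: "y \<in> topspace (fst (N a))" "x = h a y" using im by blast
        from smooth_manifold_chart_at[OF N[OF a(1)] y(1)] obtain c where c: "c \<in> snd (N a)" "y \<in> chart_dom c" .
        have "?p a c \<in> A" unfolding A_def using a(1) c(1) by blast
        moreover have "x \<in> chart_dom (?p a c)" using c y by simp
        ultimately show "x \<in> (\<Union>c\<in>A. chart_dom c)" by (rule UN_I)
      qed
    qed
  qed
  note B = smooth_manifold_generated[OF X this]
  let ?B = "generated_structure X A"
  have "diffeomorphism (N a) (open_submfd (X, ?B) (V a)) (h a)" if a: "a \<in> I" for a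
    unfolding diffeomorphism_def
  proof (intro conjI)
    let ?M = "open_submfd (X, ?B) (V a)"
    have M: "smooth_manifold ?M" using V[OF a] by (intro smooth_manifold_open_submfd[OF B(1)]) simp
    have top: "topspace (fst ?M) = V a" using openin_subset[OF V[OF a]] by (simp add: inf_absorb2)
    show "bij_betw (h a) (topspace (fst (N a))) (topspace (fst ?M))"
      using inj[OF a] im[OF a] top by (simp add: bij_betw_def)
    have at: "\<exists>c. c \<in> snd (N a) \<and> x \<in> chart_dom c \<and> ?p a c \<in> snd ?M" if x: "x \<in> topspace (fst (N a))" for x
    proof -
      from smooth_manifold_chart_at[OF N[OF a] x] obtain c where c: "c \<in> snd (N a)" "x \<in> chart_dom c" .
      have "?p a c \<in> A" unfolding A_def using a c(1) by blast
      then have "?p a c \<in> ?B" using B(2) by (rule rev_subsetD)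
      moreover have "chart_dom (?p a c) \<subseteq> V a" using im[OF a] chart_of_subset[OF cc[OF a c(1)]] by auto
      ultimately show ?thesis using c by (intro exI[of _ c] conjI) simp_all
    qed
    have idw: "smooth_wrt c c (chart_dom c) (\<lambda>x. ?k a (h a x))" if "c \<in> snd (N a)" for c
      by (rule smooth_wrt_cong[OF smooth_wrt_id[OF cc[OF a that] chart_of_openin[OF cc[OF a that]]] cc[OF a that]])
        (use chart_of_subset[OF cc[OF a that]] inj[OF a] in \<open>auto simp: subset_iff\<close>)
    show "smooth_map (N a) ?M (h a)"
    proof (rule smooth_mapI[OF N[OF a]])
      fix x assume "x \<in> topspace (fst (N a))"
      then show "h a x \<in> topspace (fst ?M)" using im[OF a] top by blast
    next
      fix x assume "x \<in> topspace (fst (N a))"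
      from at[OF this] obtain c where c: "c \<in> snd (N a)" "x \<in> chart_dom c" "?p a c \<in> snd ?M" by blast
      then show "smooth_at (N a) ?M (h a) x"
        using idw[OF c(1)] chart_of_openin[OF cc[OF a c(1)]]
        unfolding smooth_at_def by (intro bexI[OF _ c(1)] bexI[OF _ c(3)] exI[of _ "chart_dom c"] conjI)
          (simp_all add: smooth_wrt_push_target)
    qed
    show "smooth_map ?M (N a) (?k a)"
    proof (rule smooth_mapI[OF M])
      fix y assume "y \<in> topspace (fst ?M)"
      then have "y \<in> h a ` topspace (fst (N a))" using im[OF a] top by simp
      then show "?k a y \<in> topspace (fst (N a))" by (rule inv_into_into)
    next
      fix y assume "y \<in> topspace (fst ?M)"
      then have "y \<in> h a ` topspace (fst (N a))" using im[OF a] top by simp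
      then obtain x where x: "x \<in> topspace (fst (N a))" "y = h a x" by blast
      from at[OF x(1)] obtain c where c: "c \<in> snd (N a)" "x \<in> chart_dom c" "?p a c \<in> snd ?M" by blast
      have pc: "chart_of (fst ?M) (?p a c)" by (rule smooth_manifold_chart_of[OF M c(3)])
      have "?k a ` chart_dom (?p a c) \<subseteq> chart_dom c"
        using inj[OF a] chart_of_subset[OF cc[OF a c(1)]] by (auto simp: subset_iff)
      moreover have "smooth_wrt (?p a c) c (chart_dom (?p a c)) (?k a)"
        using smooth_wrt_push_source[OF p[OF a c(1)] cc[OF a c(1)] inj[OF a], of "chart_dom c" c "?k a"]
          idw[OF c(1)] by simp
      ultimately show "smooth_at ?M (N a) (?k a) y"
        using chart_of_openin[OF pc] x c
        unfolding smooth_at_def by (intro bexI[OF _ c(3)] bexI[OF _ c(1)] exI[of _ "chart_dom (?p a c)"] conjI) simp_all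
    qed
  qed
  then show thesis using that[OF B(1)] by blast
qed


subsection \<open>Products\<close>

definition join_coords :: "nat \<Rightarrow> (nat \<Rightarrow> real) \<Rightarrow> (nat \<Rightarrow> real) \<Rightarrow> nat \<Rightarrow> real" where
  "join_coords m x y = (\<lambda>i. if i < m then x i else y (i - m))"

definition first_coords :: "nat \<Rightarrow> (nat \<Rightarrow> real) \<Rightarrow> nat \<Rightarrow> real" where
  "first_coords m z = (\<lambda>i. if i < m then z i else 0)"

definition last_coords :: "nat \<Rightarrow> (nat \<Rightarrow> real) \<Rightarrow> nat \<Rightarrow> real" where
  "last_coords m z = (\<lambda>i. z (m + i))"

lemma prod_chart_simps [simp]:
  "chart_dim (prod_chart c d) = chart_dim c + chart_dim d"
  "chart_dom (prod_chart c d) = chart_dom c \<times> chart_dom d"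
  "chart_map (prod_chart c d) (x, y) = join_coords (chart_dim c) (chart_map c x) (chart_map d y)"
  by (auto simp: prod_chart_def join_coords_def)

lemma first_join: "x \<in> topspace (Euclidean_space m) \<Longrightarrow> first_coords m (join_coords m x y) = x"
  by (auto simp: first_coords_def join_coords_def fun_eq_iff mem_Euclidean_space)

lemma last_join: "last_coords m (join_coords m x y) = y"
  by (auto simp: last_coords_def join_coords_def fun_eq_iff)

lemma join_first_last: "join_coords m (first_coords m z) (last_coords m z) = z"
  by (auto simp: first_coords_def last_coords_def join_coords_def fun_eq_iff)

lemma smooth_eucl_join:
  assumes F: "smooth_eucl k m W F" and H: "smooth_eucl k n W H"
  shows "smooth_eucl k (m + n) W (\<lambda>x. join_coords m (F x) (H x))"
proof -
  have "(\<lambda>x. join_coords m (F x) (H x)) \<in> W \<rightarrow> topspace (Euclidean_space (m + n))"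
  proof
    fix x assume "x \<in> W"
    then have "F x \<in> topspace (Euclidean_space m)" "H x \<in> topspace (Euclidean_space n)"
      using assms unfolding smooth_eucl_iff by blast+
    then show "join_coords m (F x) (H x) \<in> topspace (Euclidean_space (m + n))"
      by (simp add: mem_Euclidean_space join_coords_def)
  qed
  moreover have "C_diff l k W (\<lambda>x. join_coords m (F x) (H x) j)" for l j
    using assms by (cases "j < m") (auto simp: smooth_eucl_iff join_coords_def)
  ultimately show ?thesis using F by (simp add: smooth_eucl_iff)
qed

lemma smooth_eucl_first:
  assumes "openin (Euclidean_space (m + n)) W" shows "smooth_eucl (m + n) m W (first_coords m)"
proof -
  have "C_diff l (m + n) W (\<lambda>x. first_coords m x j)" for l j
    using C_diff_coordinate[OF assms] C_diff_const[OF assms] by (cases "j < m") (auto simp: first_coords_def)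
  then show ?thesis using assms by (auto simp: smooth_eucl_iff mem_Euclidean_space first_coords_def)
qed

lemma smooth_eucl_last:
  assumes "openin (Euclidean_space (m + n)) W" shows "smooth_eucl (m + n) n W (last_coords m)"
proof -
  have "C_diff l (m + n) W (\<lambda>x. last_coords m x j)" for l j
    using C_diff_coordinate[OF assms] by (simp add: last_coords_def)
  moreover have "last_coords m \<in> W \<rightarrow> topspace (Euclidean_space n)"
    using openin_subset[OF assms] by (auto simp: mem_Euclidean_space last_coords_def)
  ultimately show ?thesis using assms by (simp add: smooth_eucl_iff)
qed

lemma continuous_map_Euclidean_coordinate:
  "continuous_map (Euclidean_space k) euclideanreal (\<lambda>x. x i)"
  unfolding Euclidean_space_def
  using continuous_map_product_coordinates[of i UNIV "\<lambda>_. euclideanreal"]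
  by (intro continuous_map_from_subtopology) simp

lemma homeomorphic_maps_join:
  "homeomorphic_maps (prod_topology (Euclidean_space m) (Euclidean_space n)) (Euclidean_space (m + n))
     (\<lambda>(x, y). join_coords m x y) (\<lambda>z. (first_coords m z, last_coords m z))"
  unfolding homeomorphic_maps_def
proof (intro conjI ballI)
  let ?P = "prod_topology (Euclidean_space m) (Euclidean_space n)"
  note coord = continuous_map_Euclidean_coordinate
  have f: "continuous_map ?P euclideanreal (\<lambda>p. fst p i)" for i
    using continuous_map_compose[OF continuous_map_fst coord] by (simp add: o_def)
  have s: "continuous_map ?P euclideanreal (\<lambda>p. snd p i)" for i
    using continuous_map_compose[OF continuous_map_snd coord] by (simp add: o_def)
  have "continuous_map ?P (Euclidean_space (m + n))
      (\<lambda>p i. if i < m + n then join_coords m (fst p) (snd p) i else 0)"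
    unfolding continuous_map_componentwise_Euclidean_space
    using f s by (auto simp: join_coords_def)
  then show "continuous_map ?P (Euclidean_space (m + n)) (\<lambda>(x, y). join_coords m x y)"
    by (rule continuous_map_eq) (auto simp: join_coords_def fun_eq_iff mem_Euclidean_space)
  have "continuous_map (subtopology (Euclidean_space (m + n)) (topspace (Euclidean_space (m + n)))) (Euclidean_space m) (first_coords m)"
    "continuous_map (subtopology (Euclidean_space (m + n)) (topspace (Euclidean_space (m + n)))) (Euclidean_space n) (last_coords m)"
    using smooth_eucl_continuous_map[OF smooth_eucl_first[OF openin_topspace]]
      smooth_eucl_continuous_map[OF smooth_eucl_last[OF openin_topspace]] .
  then show "continuous_map (Euclidean_space (m + n)) ?P (\<lambda>z. (first_coords m z, last_coords m z))"
    by (simp add: continuous_map_pairwise o_def)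
qed (auto simp: first_join last_join join_first_last)

lemma chart_of_prod:
  assumes c: "chart_of X c" and d: "chart_of Y d"
  shows "chart_of (prod_topology X Y) (prod_chart c d)"
proof -
  let ?m = "chart_dim c" and ?n = "chart_dim d"
  let ?A = "chart_map c ` chart_dom c" and ?B = "chart_map d ` chart_dom d"
  let ?J = "\<lambda>(x, y). join_coords ?m x y"
  have AB: "openin (Euclidean_space ?m) ?A" "openin (Euclidean_space ?n) ?B"
    using c d by (simp_all add: chart_of_def)
  have J: "homeomorphic_map (prod_topology (Euclidean_space ?m) (Euclidean_space ?n)) (Euclidean_space (?m + ?n)) ?J"
    using homeomorphic_maps_join homeomorphic_map_maps by blast
  have im: "chart_map (prod_chart c d) ` (chart_dom c \<times> chart_dom d) = ?J ` (?A \<times> ?B)"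
    by (force simp: image_iff)
  have AB': "openin (prod_topology (Euclidean_space ?m) (Euclidean_space ?n)) (?A \<times> ?B)"
    using AB by (simp add: openin_prod_Times_iff)
  have op: "openin (Euclidean_space (?m + ?n)) (?J ` (?A \<times> ?B))"
    using homeomorphic_imp_open_map[OF J] AB' by (simp add: open_map_def)
  have J': "homeomorphic_map (subtopology (prod_topology (Euclidean_space ?m) (Euclidean_space ?n)) (?A \<times> ?B))
      (subtopology (Euclidean_space (?m + ?n)) (?J ` (?A \<times> ?B))) ?J"
  proof (rule homeomorphic_map_subtopologies[OF J])
    show "?J ` (topspace (prod_topology (Euclidean_space ?m) (Euclidean_space ?n)) \<inter> (?A \<times> ?B)) =
        topspace (Euclidean_space (?m + ?n)) \<inter> ?J ` (?A \<times> ?B)"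
      using openin_subset[OF AB'] openin_subset[OF op] by (simp add: inf_absorb2)
  qed
  obtain k where k: "homeomorphic_maps (subtopology X (chart_dom c)) (subtopology (Euclidean_space ?m) ?A) (chart_map c) k"
    using c unfolding chart_of_def homeomorphic_map_maps by blast
  obtain l where l: "homeomorphic_maps (subtopology Y (chart_dom d)) (subtopology (Euclidean_space ?n) ?B) (chart_map d) l"
    using d unfolding chart_of_def homeomorphic_map_maps by blast
  have "homeomorphic_map (prod_topology (subtopology X (chart_dom c)) (subtopology Y (chart_dom d)))
      (prod_topology (subtopology (Euclidean_space ?m) ?A) (subtopology (Euclidean_space ?n) ?B))
      (\<lambda>(x, y). (chart_map c x, chart_map d y))"
    using homeomorphic_maps_prod[of "subtopology X (chart_dom c)" "subtopology Y (chart_dom d)"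
        "subtopology (Euclidean_space ?m) ?A" "subtopology (Euclidean_space ?n) ?B" "chart_map c" "chart_map d" k l] k l
      homeomorphic_map_maps by blast
  then have 1: "homeomorphic_map (subtopology (prod_topology X Y) (chart_dom c \<times> chart_dom d))
      (subtopology (prod_topology (Euclidean_space ?m) (Euclidean_space ?n)) (?A \<times> ?B))
      (\<lambda>(x, y). (chart_map c x, chart_map d y))"
    by (simp add: subtopology_Times)
  have "homeomorphic_map (subtopology (prod_topology X Y) (chart_dom c \<times> chart_dom d))
      (subtopology (Euclidean_space (?m + ?n)) (?J ` (?A \<times> ?B))) (chart_map (prod_chart c d))"
    by (rule homeomorphic_map_eq[OF homeomorphic_map_compose[OF 1 J']]) auto
  moreover have "openin (prod_topology X Y) (chart_dom c \<times> chart_dom d)"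
    using chart_of_openin[OF c] chart_of_openin[OF d] by (simp add: openin_prod_Times_iff)
  ultimately show ?thesis
    using op unfolding chart_of_def prod_chart_simps im by simp
qed

lemma chart_map_mem_Euclidean_space:
  "chart_of X c \<Longrightarrow> x \<in> chart_dom c \<Longrightarrow> chart_map c x \<in> topspace (Euclidean_space (chart_dim c))"
  using openin_subset by (fastforce simp: chart_of_def)

lemma smooth_wrt_fst:
  assumes c: "chart_of X c" and d: "chart_of Y d"
    and W: "openin (prod_topology X Y) W" "W \<subseteq> chart_dom c \<times> chart_dom d"
  shows "smooth_wrt (prod_chart c d) c W fst"
  unfolding smooth_wrt_def prod_chart_simps
proof (rule smooth_eucl_cong[OF smooth_eucl_first])
  note p = chart_of_prod[OF c d]
  show "openin (Euclidean_space (chart_dim c + chart_dim d)) (chart_map (prod_chart c d) ` W)"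
    using chart_of_open_image[OF p W(1)] W(2) by simp
  fix z assume "z \<in> chart_map (prod_chart c d) ` W"
  then obtain x y where "(x, y) \<in> W" and z: "z = chart_map (prod_chart c d) (x, y)" by auto
  then have "x \<in> chart_dom c" "y \<in> chart_dom d" using W by auto
  then show "first_coords (chart_dim c) z = coord_rep (prod_chart c d) c fst z"
    using coord_rep_eq[OF p, of "(x, y)" c fst] z chart_map_mem_Euclidean_space[OF c]
    by (simp add: first_join)
qed

lemma smooth_wrt_snd:
  assumes c: "chart_of X c" and d: "chart_of Y d"
    and W: "openin (prod_topology X Y) W" "W \<subseteq> chart_dom c \<times> chart_dom d"
  shows "smooth_wrt (prod_chart c d) d W snd"
  unfolding smooth_wrt_def prod_chart_simps
proof (rule smooth_eucl_cong[OF smooth_eucl_last])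
  note p = chart_of_prod[OF c d]
  show "openin (Euclidean_space (chart_dim c + chart_dim d)) (chart_map (prod_chart c d) ` W)"
    using chart_of_open_image[OF p W(1)] W(2) by simp
  fix z assume "z \<in> chart_map (prod_chart c d) ` W"
  then obtain x y where "(x, y) \<in> W" and z: "z = chart_map (prod_chart c d) (x, y)" by auto
  then have "x \<in> chart_dom c" "y \<in> chart_dom d" using W by auto
  then show "last_coords (chart_dim c) z = coord_rep (prod_chart c d) d snd z"
    using coord_rep_eq[OF p, of "(x, y)" d snd] z by (simp add: last_join)
qed

lemma smooth_wrt_pair:
  assumes "smooth_wrt e c W f" "smooth_wrt e d W g"
  shows "smooth_wrt e (prod_chart c d) W (\<lambda>x. (f x, g x))"
  using smooth_eucl_join[OF assms[unfolded smooth_wrt_def]]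
  by (simp add: smooth_wrt_def coord_rep_def)

lemma second_countable_prod_topology:
  assumes "second_countable X" "second_countable Y"
  shows "second_countable (prod_topology X Y)"
proof -
  obtain B where B: "countable B" "\<And>V. V \<in> B \<Longrightarrow> openin X V"
    "\<And>U x. openin X U \<Longrightarrow> x \<in> U \<Longrightarrow> \<exists>V\<in>B. x \<in> V \<and> V \<subseteq> U"
    using assms(1) unfolding second_countable_def by metis
  obtain C where C: "countable C" "\<And>V. V \<in> C \<Longrightarrow> openin Y V"
    "\<And>U x. openin Y U \<Longrightarrow> x \<in> U \<Longrightarrow> \<exists>V\<in>C. x \<in> V \<and> V \<subseteq> U"
    using assms(2) unfolding second_countable_def by metis
  let ?D = "(\<lambda>(U, V). U \<times> V) ` (B \<times> C)"
  have "\<exists>V\<in>?D. z \<in> V \<and> V \<subseteq> W" if W: "openin (prod_topology X Y) W" "z \<in> W" for W z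
  proof -
    obtain x y where z: "z = (x, y)" by (cases z)
    have "(x, y) \<in> W" using W(2) z by simp
    then have "\<exists>U V. openin X U \<and> openin Y V \<and> x \<in> U \<and> y \<in> V \<and> U \<times> V \<subseteq> W"
      using W(1)[unfolded openin_prod_topology_alt, rule_format] by simp
    then obtain U V where UV: "openin X U" "openin Y V" "x \<in> U" "y \<in> V" "U \<times> V \<subseteq> W"
      by (elim exE conjE)
    obtain U' where U': "U' \<in> B" "x \<in> U'" "U' \<subseteq> U" using B(3)[OF UV(1,3)] by blast
    obtain V' where V': "V' \<in> C" "y \<in> V'" "V' \<subseteq> V" using C(3)[OF UV(2,4)] by blast
    have "U' \<times> V' \<in> ?D" "U' \<times> V' \<subseteq> W" using U' V' UV by auto
    then show ?thesis using U' V' z by (intro bexI[of _ "U' \<times> V'"]) simp_all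
  qed
  moreover have "countable ?D" using B(1) C(1) by simp
  moreover have "openin (prod_topology X Y) V" if "V \<in> ?D" for V
    using that B(2) C(2) by (auto simp: openin_prod_Times_iff)
  ultimately show ?thesis
    unfolding second_countable_def by (intro exI[of _ ?D] conjI allI impI ballI) (simp only: | elim conjE)+
qed

lemma fst_prod_mfd [simp]: "fst (prod_mfd M N) = prod_topology (fst M) (fst N)"
  by (simp add: prod_mfd_def)

lemma
  assumes M: "smooth_manifold M" and N: "smooth_manifold N"
  shows smooth_manifold_prod: "smooth_manifold (prod_mfd M N)"
    and prod_chart_mem: "c \<in> snd M \<Longrightarrow> d \<in> snd N \<Longrightarrow> prod_chart c d \<in> snd (prod_mfd M N)"
proof -
  let ?X = "prod_topology (fst M) (fst N)"
  let ?A = "{prod_chart c d | c d. c \<in> snd M \<and> d \<in> snd N}"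
  have H: "Hausdorff_space ?X"
    using M N by (simp add: smooth_manifold_def Hausdorff_space_prod_topology)
  have S: "second_countable_space ?X"
    using M N unfolding smooth_manifold_def second_countable_space_iff
    by (intro second_countable_prod_topology) simp_all
  have p: "chart_of ?X (prod_chart c d)" if "c \<in> snd M" "d \<in> snd N" for c d
    by (intro chart_of_prod smooth_manifold_chart_of[OF M] smooth_manifold_chart_of[OF N] that)
  have trans: "smooth_transition (prod_chart c d) (prod_chart c' d')"
    if "c \<in> snd M" "d \<in> snd N" "c' \<in> snd M" "d' \<in> snd N" for c d c' d'
  proof -
    have ch: "chart_of (fst M) c" "chart_of (fst M) c'" "chart_of (fst N) d" "chart_of (fst N) d'"
      using smooth_manifold_chart_of[OF M] smooth_manifold_chart_of[OF N] that by simp_all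
    let ?W = "chart_dom (prod_chart c d) \<inter> chart_dom (prod_chart c' d')"
    have W: "openin ?X ?W" using chart_of_openin[OF p] that by (intro openin_Int) blast+
    have W': "?W \<subseteq> chart_dom c \<times> chart_dom d" by auto
    have "smooth_wrt (prod_chart c d) c' ?W (\<lambda>p. fst p)"
      by (rule smooth_wrt_compose[OF smooth_wrt_fst[OF ch(1,3) W W']
          smooth_manifold_transition[OF M that(1,3), unfolded smooth_transition_iff] p[OF that(1,2)] ch(1)]) auto
    moreover have "smooth_wrt (prod_chart c d) d' ?W (\<lambda>p. snd p)"
      by (rule smooth_wrt_compose[OF smooth_wrt_snd[OF ch(1,3) W W']
          smooth_manifold_transition[OF N that(2,4), unfolded smooth_transition_iff] p[OF that(1,2)] ch(3)]) auto
    ultimately show ?thesis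
      using smooth_wrt_pair[of "prod_chart c d" c' ?W "\<lambda>p. fst p" d' "\<lambda>p. snd p"]
      by (simp add: smooth_transition_iff)
  qed
  have A: "smooth_atlas ?X ?A"
    unfolding smooth_atlas_def
  proof (intro conjI ballI)
    show "chart_of ?X e" if "e \<in> ?A" for e
    proof -
      from that obtain c d where "e = prod_chart c d" "c \<in> snd M" "d \<in> snd N" by blast
      then show ?thesis using p by simp
    qed
    show "smoothly_compatible e e'" if "e \<in> ?A" "e' \<in> ?A" for e e'
    proof -
      from that obtain c d c' d' where "e = prod_chart c d" "c \<in> snd M" "d \<in> snd N"
        "e' = prod_chart c' d'" "c' \<in> snd M" "d' \<in> snd N" by blast
      then show ?thesis using trans by (simp add: smoothly_compatible_def)
    qed
    show "(\<Union>c\<in>?A. chart_dom c) = topspace ?X"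
    proof (rule subset_antisym)
      show "(\<Union>c\<in>?A. chart_dom c) \<subseteq> topspace ?X" by (intro UN_least chart_of_subset) fact
      show "topspace ?X \<subseteq> (\<Union>c\<in>?A. chart_dom c)"
      proof
        fix z assume "z \<in> topspace ?X"
        then obtain x y where z: "z = (x, y)" "x \<in> topspace (fst M)" "y \<in> topspace (fst N)" by auto
        from smooth_manifold_chart_at[OF M z(2)] obtain c where c: "c \<in> snd M" "x \<in> chart_dom c" .
        from smooth_manifold_chart_at[OF N z(3)] obtain d where d: "d \<in> snd N" "y \<in> chart_dom d" .
        have "prod_chart c d \<in> ?A" using c d by blast
        moreover have "z \<in> chart_dom (prod_chart c d)" using c d z by simp
        ultimately show "z \<in> (\<Union>c\<in>?A. chart_dom c)" by (rule UN_I)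
      qed
    qed
  qed
  note * = smooth_manifold_generated[OF H S A]
  show "smooth_manifold (prod_mfd M N)" using *(1) by (simp add: prod_mfd_def)
  show "prod_chart c d \<in> snd (prod_mfd M N)" if "c \<in> snd M" "d \<in> snd N"
    using *(2) that unfolding prod_mfd_def snd_conv by blast
qed

lemma prod_mfd_charts_at:
  assumes M: "smooth_manifold M" and N: "smooth_manifold N"
    and z: "z \<in> topspace (fst (prod_mfd M N))"
  obtains c d where "c \<in> snd M" "d \<in> snd N" "chart_of (fst M) c" "chart_of (fst N) d"
    "prod_chart c d \<in> snd (prod_mfd M N)" "z \<in> chart_dom c \<times> chart_dom d"
    "openin (prod_topology (fst M) (fst N)) (chart_dom c \<times> chart_dom d)"
proof -
  from z obtain x y where z': "z = (x, y)" "x \<in> topspace (fst M)" "y \<in> topspace (fst N)" by auto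
  from smooth_manifold_chart_at[OF M z'(2)] obtain c where c: "c \<in> snd M" "x \<in> chart_dom c" .
  from smooth_manifold_chart_at[OF N z'(3)] obtain d where d: "d \<in> snd N" "y \<in> chart_dom d" .
  have ch: "chart_of (fst M) c" "chart_of (fst N) d"
    using smooth_manifold_chart_of[OF M c(1)] smooth_manifold_chart_of[OF N d(1)] .
  show thesis
    using that[OF c(1) d(1) ch prod_chart_mem[OF M N c(1) d(1)]] z' c(2) d(2)
      chart_of_openin[OF ch(1)] chart_of_openin[OF ch(2)] by (simp add: openin_prod_Times_iff)
qed

lemma smooth_map_fst:
  assumes M: "smooth_manifold M" and N: "smooth_manifold N"
  shows "smooth_map (prod_mfd M N) M fst"
proof (rule smooth_mapI[OF smooth_manifold_prod[OF M N]])
  fix z assume z: "z \<in> topspace (fst (prod_mfd M N))"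
  obtain c d where *: "c \<in> snd M" "d \<in> snd N" "chart_of (fst M) c" "chart_of (fst N) d"
    "prod_chart c d \<in> snd (prod_mfd M N)" "z \<in> chart_dom c \<times> chart_dom d"
    "openin (prod_topology (fst M) (fst N)) (chart_dom c \<times> chart_dom d)"
    by (rule prod_mfd_charts_at[OF M N z])
  show "smooth_at (prod_mfd M N) M fst z"
    using * smooth_wrt_fst[OF *(3,4,7)]
    unfolding smooth_at_def by (intro bexI[OF _ *(5)] bexI[OF _ *(1)] exI[of _ "chart_dom c \<times> chart_dom d"] conjI) auto
qed auto

lemma smooth_map_snd:
  assumes M: "smooth_manifold M" and N: "smooth_manifold N"
  shows "smooth_map (prod_mfd M N) N snd"
proof (rule smooth_mapI[OF smooth_manifold_prod[OF M N]])
  fix z assume z: "z \<in> topspace (fst (prod_mfd M N))"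
  obtain c d where *: "c \<in> snd M" "d \<in> snd N" "chart_of (fst M) c" "chart_of (fst N) d"
    "prod_chart c d \<in> snd (prod_mfd M N)" "z \<in> chart_dom c \<times> chart_dom d"
    "openin (prod_topology (fst M) (fst N)) (chart_dom c \<times> chart_dom d)"
    by (rule prod_mfd_charts_at[OF M N z])
  show "smooth_at (prod_mfd M N) N snd z"
    using * smooth_wrt_snd[OF *(3,4,7)]
    unfolding smooth_at_def by (intro bexI[OF _ *(5)] bexI[OF _ *(2)] exI[of _ "chart_dom c \<times> chart_dom d"] conjI) auto
qed auto

lemma smooth_map_pair:
  assumes P: "smooth_manifold P" and M: "smooth_manifold M" and N: "smooth_manifold N"
    and f: "smooth_map P M f" and g: "smooth_map P N g"
  shows "smooth_map P (prod_mfd M N) (\<lambda>x. (f x, g x))"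
proof (rule smooth_mapI[OF P])
  show "(f p, g p) \<in> topspace (fst (prod_mfd M N))" if "p \<in> topspace (fst P)" for p
    using smooth_map_funcset[OF f that] smooth_map_funcset[OF g that] by simp
  fix p assume p: "p \<in> topspace (fst P)"
  from smooth_map_charts_at[OF f p] obtain e c where
    1: "e \<in> snd P" "c \<in> snd M" "p \<in> chart_dom e" "f ` chart_dom e \<subseteq> chart_dom c"
    "smooth_wrt e c (chart_dom e) f" .
  from smooth_manifold_chart_at[OF N smooth_map_funcset[OF g p]] obtain d
    where d: "d \<in> snd N" "g p \<in> chart_dom d" .
  have ec: "chart_of (fst P) e" and dc: "chart_of (fst N) d"
    using smooth_manifold_chart_of[OF P 1(1)] smooth_manifold_chart_of[OF N d(1)] .
  let ?W = "{x \<in> chart_dom e. g x \<in> chart_dom d}"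
  have W: "openin (fst P) ?W"
    by (rule openin_smooth_preimage[OF P N g chart_of_openin[OF ec] chart_of_openin[OF dc]])
  have "smooth_wrt e c ?W f" by (rule smooth_wrt_subset[OF 1(5) ec W]) auto
  moreover have "smooth_wrt e d ?W g" by (rule smooth_map_smooth_wrt[OF P N g 1(1) d(1) W]) auto
  ultimately have "smooth_wrt e (prod_chart c d) ?W (\<lambda>x. (f x, g x))" by (rule smooth_wrt_pair)
  then show "smooth_at P (prod_mfd M N) (\<lambda>x. (f x, g x)) p"
    using 1(3,4) d(2) W
    unfolding smooth_at_def by (intro bexI[OF _ 1(1)] bexI[OF _ prod_chart_mem[OF M N 1(2) d(1)]] exI[of _ ?W] conjI) auto
qed

section \<open>The circle as a smooth manifold\<close>

definition circle_chart :: "real \<Rightarrow> real \<Rightarrow> complex chart" where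
  "circle_chart a b =
     (1, cis ` {a<..<b}, \<lambda>z i. if i = 0 then the_inv_into {a<..<b} cis z else 0)"

lemma circle_chart_simps [simp]:
  "chart_dim (circle_chart a b) = 1" "chart_dom (circle_chart a b) = cis ` {a<..<b}"
  by (simp_all add: circle_chart_def)

lemma cis_eq_cis_iff: "cis s = cis t \<longleftrightarrow> (\<exists>k::int. t = s + 2 * pi * k)"
  using sin_cos_eq_iff[of t s] by (auto simp: complex_eq_iff)

lemma inj_on_cis_interval:
  assumes "b - a \<le> 2 * pi" shows "inj_on cis {a<..<b}"
proof (rule inj_onI)
  fix s t assume st: "s \<in> {a<..<b}" "t \<in> {a<..<b}" "cis s = cis t"
  then obtain k :: int where k: "t = s + 2 * pi * k" using cis_eq_cis_iff by blast
  have "\<bar>t - s\<bar> < 2 * pi" using st(1,2) assms by auto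
  then have "2 * pi * \<bar>real_of_int k\<bar> < 2 * pi * 1" using k by (simp add: abs_mult)
  then have "\<bar>real_of_int k\<bar> < 1" by (simp only: mult_less_cancel_left_pos pi_gt_zero mult_pos_pos zero_less_numeral)
  then have "k = 0" by linarith
  then show "s = t" using k by simp
qed

lemma circle_eq_cis: "z \<in> circle \<Longrightarrow> \<exists>t. z = cis t"
  using cis_Arg[of z] by (intro exI[of _ "Arg z"]) (force simp: sgn_div_norm)

lemma Arg_cis: "- pi < t \<Longrightarrow> t < pi \<Longrightarrow> Arg (cis t) = t"
  by (rule cis_Arg_unique) (auto simp: sgn_div_norm)

text \<open>An arc of the circle, rotated so that its midpoint is \<open>1\<close>, avoids the branch cut of the
  argument. This gives openness of arcs and continuity of the angle at once.\<close>

lemma arc_eq: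
  assumes "a < b" "b - a \<le> 2 * pi"
  shows "cis ` {a<..<b} =
    circle \<inter> {z. z * cis (- ((a + b) / 2)) \<in> - \<real>\<^sub>\<le>\<^sub>0 \<and> \<bar>Arg (z * cis (- ((a + b) / 2)))\<bar> < (b - a) / 2}"
    (is "_ = circle \<inter> ?S")
proof (rule subset_antisym)
  let ?m = "(a + b) / 2"
  show "cis ` {a<..<b} \<subseteq> circle \<inter> ?S"
  proof clarify
    fix t assume t: "t \<in> {a<..<b}"
    have 1: "cis t * cis (- ?m) = cis (t - ?m)" by (simp add: cis_mult)
    have b: "\<bar>t - ?m\<bar> < (b - a) / 2" using t by (auto simp: abs_less_iff field_simps)
    have r: "- pi < t - ?m" "t - ?m < pi" using t assms(2) by (auto simp: field_simps)
    have A: "Arg (cis (t - ?m)) = t - ?m" by (rule Arg_cis[OF r])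
    have "cis (t - ?m) \<notin> \<real>\<^sub>\<le>\<^sub>0"
    proof
      assume "cis (t - ?m) \<in> \<real>\<^sub>\<le>\<^sub>0"
      then have "Re (cis (t - ?m)) \<le> 0" "Im (cis (t - ?m)) = 0" by (auto simp: complex_nonpos_Reals_iff)
      then have "cis (t - ?m) = cis pi"
        using sin_cos_squared_add[of "t - ?m"] by (auto simp: complex_eq_iff power2_eq_1_iff)
      then obtain k :: int where k: "pi = (t - ?m) + 2 * pi * k" using cis_eq_cis_iff by blast
      then have "0 < 2 * pi * k" "2 * pi * k < 2 * pi * 1" using r by linarith+
      then have "0 < real_of_int k" "real_of_int k < 1"
        using pi_gt_zero by (auto simp: zero_less_mult_iff)
      then have "0 < k" "k < 1" by simp_all
      then show False by linarith
    qed
    then show "cis t \<in> circle \<inter> ?S" using b A 1 by simp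
  qed
  show "circle \<inter> ?S \<subseteq> cis ` {a<..<b}"
  proof clarify
    fix z assume z: "z \<in> circle" and *: "\<bar>Arg (z * cis (- ?m))\<bar> < (b - a) / 2"
    let ?t = "?m + Arg (z * cis (- ?m))"
    have "norm (z * cis (- ?m)) = 1" using z by (simp add: norm_mult)
    then have "cis (Arg (z * cis (- ?m))) = z * cis (- ?m)"
      using cis_Arg[of "z * cis (- ?m)"] by (force simp: sgn_div_norm)
    then have "cis ?t = cis ?m * (z * cis (- ?m))" by (simp add: cis_mult[symmetric])
    also have "\<dots> = z * (cis ?m * cis (- ?m))" by (simp only: ac_simps)
    also have "\<dots> = z" by (simp add: cis_mult)
    finally have "z = cis ?t" by simp
    moreover have "?t \<in> {a<..<b}" using * by (auto simp: abs_less_iff field_simps)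
    ultimately show "z \<in> cis ` {a<..<b}" by (rule image_eqI)
  qed
qed

lemma openin_arc:
  assumes "a < b" "b - a \<le> 2 * pi"
  shows "openin (top_of_set circle) (cis ` {a<..<b})"
proof -
  let ?f = "\<lambda>z. z * cis (- ((a + b) / 2))"
  have abs_less: "x \<in> {- r<..<r} \<longleftrightarrow> \<bar>x\<bar> < r" for x r :: real by auto
  have "open {z. ?f z \<in> - \<real>\<^sub>\<le>\<^sub>0}"
    using open_vimage[of "- \<real>\<^sub>\<le>\<^sub>0" ?f] by (simp add: vimage_def open_Compl continuous_on_mult_right)
  moreover have "continuous_on {z. ?f z \<in> - \<real>\<^sub>\<le>\<^sub>0} (\<lambda>z. Arg (?f z))"
    by (intro continuous_on_Arg' continuous_intros) auto
  ultimately have "open ({z. ?f z \<in> - \<real>\<^sub>\<le>\<^sub>0} \<inter> (\<lambda>z. Arg (?f z)) -` {- ((b - a) / 2)<..<(b - a) / 2})"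
    by (intro continuous_open_preimage) simp_all
  moreover have "{z. ?f z \<in> - \<real>\<^sub>\<le>\<^sub>0} \<inter> (\<lambda>z. Arg (?f z)) -` {- ((b - a) / 2)<..<(b - a) / 2}
      = {z. ?f z \<in> - \<real>\<^sub>\<le>\<^sub>0 \<and> \<bar>Arg (?f z)\<bar> < (b - a) / 2}"
    unfolding vimage_def abs_less by blast
  ultimately show ?thesis unfolding arc_eq[OF assms] by (simp add: openin_open_Int)
qed

lemma continuous_on_angle:
  assumes "a < b" "b - a \<le> 2 * pi"
  shows "continuous_on (cis ` {a<..<b}) (the_inv_into {a<..<b} cis)"
proof -
  let ?m = "(a + b) / 2"
  have c: "continuous_on (cis ` {a<..<b}) (\<lambda>z. ?m + Arg (z * cis (- ?m)))"
    using arc_eq[OF assms] by (intro continuous_on_Arg' continuous_intros) auto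
  have e: "?m + Arg (cis t * cis (- ?m)) = t" if t: "t \<in> {a<..<b}" for t
  proof -
    have "- pi < t - ?m" "t - ?m < pi" using t assms(2) by (auto simp: field_simps)
    then have "Arg (cis (t - ?m)) = t - ?m" by (rule Arg_cis)
    then show ?thesis by (simp add: cis_mult)
  qed
  show ?thesis
  proof (rule continuous_on_eq[OF c])
    fix z assume "z \<in> cis ` {a<..<b}"
    then obtain t where t: "t \<in> {a<..<b}" "z = cis t" by blast
    then show "?m + Arg (z * cis (- ?m)) = the_inv_into {a<..<b} cis z"
      using e[OF t(1)] the_inv_into_f_f[OF inj_on_cis_interval[OF assms(2)] t(1)] by simp
  qed
qed

lemma circle_chart_cis:
  "b - a \<le> 2 * pi \<Longrightarrow> t \<in> {a<..<b} \<Longrightarrow> chart_map (circle_chart a b) (cis t) = (\<lambda>i. if i = 0 then t else 0)"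
  using the_inv_into_f_f[OF inj_on_cis_interval, of b a t] by (simp add: circle_chart_def fun_eq_iff)

lemma chart_of_circle:
  assumes "a < b" "b - a \<le> 2 * pi"
  shows "chart_of (top_of_set circle) (circle_chart a b)"
proof -
  let ?D = "cis ` {a<..<b}" and ?f = "chart_map (circle_chart a b)"
  have D: "openin (top_of_set circle) ?D" by (rule openin_arc[OF assms])
  have Dc: "?D \<subseteq> circle" using openin_subset[OF D] by simp
  have im: "?f ` ?D = {x \<in> topspace (Euclidean_space 1). x 0 \<in> {a<..<b}}"
  proof (rule subset_antisym)
    show "?f ` ?D \<subseteq> {x \<in> topspace (Euclidean_space 1). x 0 \<in> {a<..<b}}"
      using circle_chart_cis[OF assms(2)] by (auto simp: mem_Euclidean_space)
    show "{x \<in> topspace (Euclidean_space 1). x 0 \<in> {a<..<b}} \<subseteq> ?f ` ?D"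
    proof
      fix x assume x: "x \<in> {x \<in> topspace (Euclidean_space 1). x 0 \<in> {a<..<b}}"
      then have "x = ?f (cis (x 0))"
        using circle_chart_cis[OF assms(2), of "x 0"] by (auto simp: mem_Euclidean_space fun_eq_iff)
      then show "x \<in> ?f ` ?D" using x by blast
    qed
  qed
  have op: "openin (Euclidean_space 1) (?f ` ?D)"
    unfolding im by (rule openin_continuous_map_preimage[OF continuous_map_Euclidean_coordinate]) auto
  have sub: "subtopology (top_of_set circle) ?D = top_of_set ?D"
    using Dc by (simp add: subtopology_subtopology inf_absorb2)
  have "homeomorphic_maps (top_of_set ?D) (subtopology (Euclidean_space 1) (?f ` ?D)) ?f (\<lambda>x. cis (x 0))"
    unfolding homeomorphic_maps_def
  proof (intro conjI ballI)
    have "continuous_map (top_of_set ?D) (Euclidean_space 1)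
        (\<lambda>z i. if i < 1 then (\<lambda>i. the_inv_into {a<..<b} cis z) i else 0)"
      unfolding continuous_map_componentwise_Euclidean_space using continuous_on_angle[OF assms] by simp
    then show "continuous_map (top_of_set ?D) (subtopology (Euclidean_space 1) (?f ` ?D)) ?f"
      by (auto simp: continuous_map_in_subtopology circle_chart_def less_Suc_eq_0_disj cong: if_cong)
    have "continuous_map (subtopology (Euclidean_space 1) (?f ` ?D)) euclideanreal (\<lambda>x. x 0)"
      by (rule continuous_map_from_subtopology[OF continuous_map_Euclidean_coordinate])
    moreover have "continuous_map euclideanreal euclidean cis"
      by (auto intro: continuous_on_cis)
    ultimately have "continuous_map (subtopology (Euclidean_space 1) (?f ` ?D)) euclidean (\<lambda>x. cis (x 0))"
      using continuous_map_compose[of _ euclideanreal "\<lambda>x. x 0" euclidean cis] by (simp add: o_def)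
    then show "continuous_map (subtopology (Euclidean_space 1) (?f ` ?D)) (top_of_set ?D) (\<lambda>x. cis (x 0))"
      unfolding continuous_map_in_subtopology im by auto
    show "cis (?f z 0) = z" if "z \<in> topspace (top_of_set ?D)" for z
      using that circle_chart_cis[OF assms(2)] by auto
    show "?f (cis (x 0)) = x" if "x \<in> topspace (subtopology (Euclidean_space 1) (?f ` ?D))" for x
      using that circle_chart_cis[OF assms(2), of "x 0"] unfolding im
      by (auto simp: mem_Euclidean_space fun_eq_iff)
  qed
  then have "homeomorphic_map (top_of_set ?D) (subtopology (Euclidean_space 1) (?f ` ?D)) ?f"
    using homeomorphic_map_maps by blast
  then show ?thesis
    using D op sub by (simp add: chart_of_def)
qed

lemma smooth_eucl_1_map:
  assumes W: "openin (Euclidean_space n) W" and g: "\<And>k. C_diff k n W g"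
  shows "smooth_eucl n 1 W (\<lambda>x i. if i = 0 then g x else 0)"
proof -
  have "C_diff k n W (\<lambda>x. if j = 0 then g x else 0)" for j :: nat and k
    using g C_diff_const[OF W] by (cases "j = 0") auto
  then show ?thesis using W by (auto simp: smooth_eucl_iff mem_Euclidean_space)
qed

text \<open>Two angle functions differ by a constant multiple of \<open>2 \<pi>\<close> near each common point.\<close>

lemma smooth_transition_circle:
  assumes c: "a < b" "b - a \<le> 2 * pi" and d: "a' < b'" "b' - a' \<le> 2 * pi"
  shows "smooth_transition (circle_chart a b) (circle_chart a' b')"
  unfolding smooth_transition_iff
proof (rule smooth_wrt_local)
  let ?c = "circle_chart a b" and ?d = "circle_chart a' b'"
  note cc = chart_of_circle[OF c] and dc = chart_of_circle[OF d]
  fix z assume z: "z \<in> chart_dom ?c \<inter> chart_dom ?d"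
  then obtain s t where st: "s \<in> {a<..<b}" "t \<in> {a'<..<b'}" "z = cis s" "z = cis t" by auto
  then obtain k :: int where k: "t = s + 2 * pi * k" using cis_eq_cis_iff by blast
  have cis_k: "cis (x + 2 * pi * k) = cis x" for x using cis_eq_cis_iff by metis
  \<comment> \<open>On the arc \<open>W\<close> given by \<open>Q\<close>, the second angle is the first one plus \<open>2 \<pi> k\<close>, with this \<open>k\<close> throughout.\<close>
  define Q where "Q = {x \<in> topspace (Euclidean_space 1). x 0 \<in> {a' - 2 * pi * k<..<b' - 2 * pi * k}}"
  have Q: "openin (Euclidean_space 1) Q"
    unfolding Q_def by (rule openin_continuous_map_preimage[OF continuous_map_Euclidean_coordinate]) auto
  define W where "W = {z \<in> chart_dom ?c. chart_map ?c z \<in> Q}"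
  have W: "openin (top_of_set circle) W"
    unfolding W_def using chart_of_open_preimage[OF cc] Q by simp
  have W_iff: "w \<in> W \<longleftrightarrow> (\<exists>x. w = cis x \<and> x \<in> {a<..<b} \<and> x + 2 * pi * k \<in> {a'<..<b'})" for w
  proof
    assume "w \<in> W"
    then obtain x where x: "x \<in> {a<..<b}" "w = cis x" "chart_map ?c w \<in> Q" by (auto simp: W_def)
    then show "\<exists>x. w = cis x \<and> x \<in> {a<..<b} \<and> x + 2 * pi * k \<in> {a'<..<b'}"
      using circle_chart_cis[OF c(2) x(1)] by (intro exI[of _ x]) (auto simp: Q_def)
  next
    assume "\<exists>x. w = cis x \<and> x \<in> {a<..<b} \<and> x + 2 * pi * k \<in> {a'<..<b'}"
    then obtain x where x: "w = cis x" "x \<in> {a<..<b}" "x + 2 * pi * k \<in> {a'<..<b'}" by blast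
    then show "w \<in> W"
      using circle_chart_cis[OF c(2) x(2)] by (auto simp: W_def Q_def mem_Euclidean_space)
  qed
  have Wd: "W \<subseteq> chart_dom ?c \<inter> chart_dom ?d"
  proof
    fix w assume "w \<in> W"
    then obtain x where x: "w = cis x" "x \<in> {a<..<b}" "x + 2 * pi * k \<in> {a'<..<b'}" using W_iff by blast
    then show "w \<in> chart_dom ?c \<inter> chart_dom ?d"
      using cis_k[of x] by (auto intro: image_eqI[of _ cis "x + 2 * pi * k"])
  qed
  have o: "openin (Euclidean_space 1) (chart_map ?c ` W)"
    using chart_of_open_image[OF cc W] Wd by simp
  have "smooth_wrt ?c ?d W (\<lambda>x. x)"
    unfolding smooth_wrt_def circle_chart_simps
  proof (rule smooth_eucl_cong)
    show "smooth_eucl 1 1 (chart_map ?c ` W) (\<lambda>x i. if i = 0 then x 0 + 2 * pi * k else 0)"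
      by (intro smooth_eucl_1_map[OF o] C_diff_add[OF o] C_diff_coordinate[OF o] C_diff_const[OF o])
    fix y assume "y \<in> chart_map ?c ` W"
    then obtain w where w: "w \<in> W" "y = chart_map ?c w" by (elim imageE)
    then obtain x where x: "w = cis x" "x \<in> {a<..<b}" "x + 2 * pi * k \<in> {a'<..<b'}" using W_iff by blast
    have "w \<in> chart_dom ?c" using w Wd by blast
    then have "coord_rep ?c ?d (\<lambda>x. x) y = chart_map ?d w"
      using coord_rep_eq[OF cc, of w ?d "\<lambda>x. x"] w by simp
    also have "\<dots> = (\<lambda>i. if i = 0 then x + 2 * pi * k else 0)"
      using circle_chart_cis[OF d(2) x(3)] cis_k[of x] x(1) by simp
    moreover have "y 0 = x" unfolding w(2) x(1) circle_chart_cis[OF c(2) x(2)] by simp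
    ultimately show "(\<lambda>i. if i = 0 then y 0 + 2 * pi * k else 0) = coord_rep ?c ?d (\<lambda>x. x) y"
      by (simp only:)
  qed
  moreover have "z \<in> W" using W_iff st k by blast
  ultimately show "\<exists>V. z \<in> V \<and> V \<subseteq> chart_dom ?c \<inter> chart_dom ?d \<and> smooth_wrt ?c ?d V (\<lambda>x. x)"
    using Wd by blast
qed

lemma second_countable_euclidean: "second_countable (euclidean :: 'a::second_countable_topology topology)"
proof -
  obtain B :: "'a set set" where B: "countable B" "\<And>C. C \<in> B \<Longrightarrow> open C"
    "\<And>S. open S \<Longrightarrow> \<exists>U. U \<subseteq> B \<and> S = \<Union>U" using univ_second_countable by blast
  have "second_countable_space (euclidean :: 'a topology)"
    unfolding second_countable_space_def using B by (metis open_openin)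
  then show ?thesis by (simp add: second_countable_space_iff)
qed

lemma fst_circle_mfd [simp]: "fst circle_mfd = top_of_set circle"
  by (simp add: circle_mfd_def)

lemma
  shows smooth_manifold_circle: "smooth_manifold circle_mfd"
    and circle_chart_mem: "a < b \<Longrightarrow> b - a \<le> 2 * pi \<Longrightarrow> circle_chart a b \<in> snd circle_mfd"
proof -
  have H: "Hausdorff_space (top_of_set circle)"
    by (intro Hausdorff_space_subtopology) (simp add: Hausdorff_space_euclidean)
  have S: "second_countable_space (top_of_set circle)"
    by (simp add: second_countable_space_iff second_countable_subtopology second_countable_euclidean)
  have mem: "\<exists>a b. c = circle_chart a b \<and> a < b \<and> b - a \<le> 2 * pi" if "c \<in> circle_atlas" for c
    using that unfolding circle_atlas_def circle_chart_def by blast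
  have mem': "circle_chart a b \<in> circle_atlas" if "a < b" "b - a \<le> 2 * pi" for a b
    using that unfolding circle_atlas_def circle_chart_def by blast
  have A: "smooth_atlas (top_of_set circle) circle_atlas"
    unfolding smooth_atlas_def
  proof (intro conjI ballI)
    show "chart_of (top_of_set circle) c" if "c \<in> circle_atlas" for c
      using mem[OF that] chart_of_circle by blast
    show "smoothly_compatible c d" if "c \<in> circle_atlas" "d \<in> circle_atlas" for c d
      using mem[OF that(1)] mem[OF that(2)] smooth_transition_circle unfolding smoothly_compatible_def by blast
    show "(\<Union>c\<in>circle_atlas. chart_dom c) = topspace (top_of_set circle)"
    proof (rule subset_antisym)
      show "(\<Union>c\<in>circle_atlas. chart_dom c) \<subseteq> topspace (top_of_set circle)"
        by (intro UN_least chart_of_subset) fact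
      show "topspace (top_of_set circle) \<subseteq> (\<Union>c\<in>circle_atlas. chart_dom c)"
      proof
        fix z assume "z \<in> topspace (top_of_set circle)"
        then obtain t where t: "z = cis t" using circle_eq_cis by auto
        have "circle_chart (t - 1) (t + 1) \<in> circle_atlas" using pi_gt3 by (intro mem') auto
        moreover have "z \<in> chart_dom (circle_chart (t - 1) (t + 1))" using t by auto
        ultimately show "z \<in> (\<Union>c\<in>circle_atlas. chart_dom c)" by (rule UN_I)
      qed
    qed
  qed
  note * = smooth_manifold_generated[OF H S A]
  show "smooth_manifold circle_mfd" using *(1) by (simp add: circle_mfd_def)
  show "circle_chart a b \<in> snd circle_mfd" if "a < b" "b - a \<le> 2 * pi"
    using *(2) mem'[OF that] by (auto simp: circle_mfd_def)
qed

text \<open>Angles add under multiplication. The target arc has length \<open>4 < 2 \<pi>\<close>, which leaves room for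
  the sum of two angles from arcs of length \<open>2\<close>.\<close>

lemma smooth_map_circle_mult:
  "smooth_map (prod_mfd circle_mfd circle_mfd) circle_mfd (\<lambda>p. fst p * snd p)"
proof (rule smooth_mapI[OF smooth_manifold_prod[OF smooth_manifold_circle smooth_manifold_circle]])
  fix p assume p: "p \<in> topspace (fst (prod_mfd circle_mfd circle_mfd))"
  then show "fst p * snd p \<in> topspace (fst circle_mfd)" by (auto simp: norm_mult)
  obtain s t where st: "p = (cis s, cis t)" using p circle_eq_cis[of "fst p"] circle_eq_cis[of "snd p"]
    by (metis fst_circle_mfd fst_prod_mfd mem_Times_iff prod.collapse topspace_prod_topology topspace_euclidean_subtopology)
  let ?c = "circle_chart (s - 1) (s + 1)" and ?d = "circle_chart (t - 1) (t + 1)"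
  let ?e = "circle_chart (s + t - 2) (s + t + 2)" and ?p = "prod_chart (circle_chart (s - 1) (s + 1)) (circle_chart (t - 1) (t + 1))"
  have len: "(s + 1) - (s - 1) \<le> 2 * pi" "(t + 1) - (t - 1) \<le> 2 * pi" "(s + t + 2) - (s + t - 2) \<le> 2 * pi"
    using pi_gt3 by auto
  have m: "?c \<in> snd circle_mfd" "?d \<in> snd circle_mfd" "?e \<in> snd circle_mfd"
    by (intro circle_chart_mem len; simp)+
  have pm: "?p \<in> snd (prod_mfd circle_mfd circle_mfd)"
    by (rule prod_chart_mem[OF smooth_manifold_circle smooth_manifold_circle m(1,2)])
  have pc: "chart_of (fst (prod_mfd circle_mfd circle_mfd)) ?p"
    by (rule smooth_manifold_chart_of[OF smooth_manifold_prod[OF smooth_manifold_circle smooth_manifold_circle] pm])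
  have o: "openin (Euclidean_space (chart_dim ?p)) (chart_map ?p ` chart_dom ?p)"
    using pc unfolding chart_of_def by blast
  have dom: "\<exists>x y. q = (cis x, cis y) \<and> x \<in> {s - 1<..<s + 1} \<and> y \<in> {t - 1<..<t + 1}" if "q \<in> chart_dom ?p" for q
    using that unfolding prod_chart_simps circle_chart_simps by blast
  have sum: "x + y \<in> {s + t - 2<..<s + t + 2}" if "x \<in> {s - 1<..<s + 1}" "y \<in> {t - 1<..<t + 1}" for x y :: real
    using that by auto
  have "smooth_wrt ?p ?e (chart_dom ?p) (\<lambda>p. fst p * snd p)"
    unfolding smooth_wrt_def
  proof (rule smooth_eucl_cong)
    show "smooth_eucl (chart_dim ?p) (chart_dim ?e) (chart_map ?p ` chart_dom ?p) (\<lambda>x i. if i = 0 then x 0 + x 1 else 0)"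
      unfolding circle_chart_simps(1)
      by (intro smooth_eucl_1_map[OF o] C_diff_add[OF o] C_diff_coordinate[OF o])
    fix z assume "z \<in> chart_map ?p ` chart_dom ?p"
    then obtain q where q: "q \<in> chart_dom ?p" "z = chart_map ?p q" by (elim imageE)
    from dom[OF q(1)] obtain x y where xy: "q = (cis x, cis y)" "x \<in> {s - 1<..<s + 1}" "y \<in> {t - 1<..<t + 1}" by blast
    have z: "z 0 + z 1 = x + y"
      unfolding q(2) xy(1) prod_chart_simps circle_chart_cis[OF len(1) xy(2)] circle_chart_cis[OF len(2) xy(3)]
      by (simp add: join_coords_def)
    have "coord_rep ?p ?e (\<lambda>p. fst p * snd p) z = chart_map ?e (cis (x + y))"
      using coord_rep_eq[OF pc q(1), of ?e "\<lambda>p. fst p * snd p"] q(2) xy(1) by (simp add: cis_mult)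
    also have "\<dots> = (\<lambda>i. if i = 0 then x + y else 0)"
      by (rule circle_chart_cis[OF len(3) sum[OF xy(2,3)]])
    finally show "(\<lambda>i. if i = 0 then z 0 + z 1 else 0) = coord_rep ?p ?e (\<lambda>p. fst p * snd p) z"
      by (simp only: z)
  qed
  moreover have "(\<lambda>p. fst p * snd p) ` chart_dom ?p \<subseteq> chart_dom ?e"
  proof clarify
    fix z w assume "(z, w) \<in> chart_dom ?p"
    from dom[OF this] obtain x y where xy: "z = cis x" "w = cis y" "x \<in> {s - 1<..<s + 1}" "y \<in> {t - 1<..<t + 1}" by blast
    then have "fst (z, w) * snd (z, w) = cis (x + y)" by (simp add: cis_mult)
    then show "fst (z, w) * snd (z, w) \<in> chart_dom ?e" using sum[OF xy(3,4)] by auto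
  qed
  moreover have "p \<in> chart_dom ?p" using st by simp
  ultimately show "smooth_at (prod_mfd circle_mfd circle_mfd) circle_mfd (\<lambda>p. fst p * snd p) p"
    using chart_of_openin[OF pc]
    unfolding smooth_at_def by (intro bexI[OF _ pm] bexI[OF _ m(3)] exI[of _ "chart_dom ?p"] conjI) (simp only: subset_refl)+
qed

lemma smooth_map_circle_inverse: "smooth_map circle_mfd circle_mfd inverse"
proof (rule smooth_mapI[OF smooth_manifold_circle])
  fix z assume z: "z \<in> topspace (fst circle_mfd)"
  then show "inverse z \<in> topspace (fst circle_mfd)" by (simp add: norm_inverse)
  obtain s where s: "z = cis s" using z circle_eq_cis[of z] by auto
  let ?c = "circle_chart (s - 1) (s + 1)" and ?e = "circle_chart (- s - 1) (- s + 1)"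
  have len: "(s + 1) - (s - 1) \<le> 2 * pi" "(- s + 1) - (- s - 1) \<le> 2 * pi" using pi_gt3 by auto
  have m: "?c \<in> snd circle_mfd" "?e \<in> snd circle_mfd" by (intro circle_chart_mem len; simp)+
  have cc: "chart_of (fst circle_mfd) ?c" by (rule smooth_manifold_chart_of[OF smooth_manifold_circle m(1)])
  have o: "openin (Euclidean_space (chart_dim ?c)) (chart_map ?c ` chart_dom ?c)"
    using cc unfolding chart_of_def by blast
  have neg: "- x \<in> {- s - 1<..<- s + 1}" if "x \<in> {s - 1<..<s + 1}" for x :: real
    using that by auto
  have "smooth_wrt ?c ?e (chart_dom ?c) inverse"
    unfolding smooth_wrt_def
  proof (rule smooth_eucl_cong)
    show "smooth_eucl (chart_dim ?c) (chart_dim ?e) (chart_map ?c ` chart_dom ?c) (\<lambda>x i. if i = 0 then (- 1) * x 0 else 0)"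
      unfolding circle_chart_simps(1)
      by (intro smooth_eucl_1_map[OF o[unfolded circle_chart_simps(1)]] C_diff_mult[OF o[unfolded circle_chart_simps(1)]]
          C_diff_const[OF o[unfolded circle_chart_simps(1)]] C_diff_coordinate[OF o[unfolded circle_chart_simps(1)]])
    fix y assume "y \<in> chart_map ?c ` chart_dom ?c"
    then obtain q where q: "q \<in> chart_dom ?c" "y = chart_map ?c q" by (elim imageE)
    from q(1) obtain x where x: "q = cis x" "x \<in> {s - 1<..<s + 1}" by auto
    have y: "(- 1) * y 0 = - x" unfolding q(2) x(1) circle_chart_cis[OF len(1) x(2)] by simp
    have "coord_rep ?c ?e inverse y = chart_map ?e (cis (- x))"
      using coord_rep_eq[OF cc q(1), of ?e inverse] q(2) x(1) by (simp add: cis_inverse)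
    also have "\<dots> = (\<lambda>i. if i = 0 then - x else 0)" by (rule circle_chart_cis[OF len(2) neg[OF x(2)]])
    finally show "(\<lambda>i. if i = 0 then (- 1) * y 0 else 0) = coord_rep ?c ?e inverse y" by (simp only: y)
  qed
  moreover have "inverse ` chart_dom ?c \<subseteq> chart_dom ?e"
  proof clarify
    fix w assume "w \<in> chart_dom ?c"
    then obtain x where x: "w = cis x" "x \<in> {s - 1<..<s + 1}" by auto
    then have "inverse w = cis (- x)" by (simp add: cis_inverse)
    then show "inverse w \<in> chart_dom ?e" using neg[OF x(2)] by auto
  qed
  moreover have "z \<in> chart_dom ?c" using s by simp
  ultimately show "smooth_at circle_mfd circle_mfd inverse z"
    using chart_of_openin[OF cc]
    unfolding smooth_at_def by (intro bexI[OF _ m(1)] bexI[OF _ m(2)] exI[of _ "chart_dom ?c"] conjI) (simp only: subset_refl)+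
qed

lemma smooth_map_mult:
  assumes M: "smooth_manifold M" and f: "smooth_map M circle_mfd f" and g: "smooth_map M circle_mfd g"
  shows "smooth_map M circle_mfd (\<lambda>x. f x * g x)"
  using smooth_map_compose[OF M smooth_manifold_prod[OF smooth_manifold_circle smooth_manifold_circle]
      smooth_map_pair[OF M smooth_manifold_circle smooth_manifold_circle f g] smooth_map_circle_mult]
  by simp

lemma smooth_map_inverse:
  assumes M: "smooth_manifold M" and f: "smooth_map M circle_mfd f"
  shows "smooth_map M circle_mfd (\<lambda>x. inverse (f x))"
  by (rule smooth_map_compose[OF M smooth_manifold_circle f smooth_map_circle_inverse])

section \<open>Groupoids and twists\<close>

lemma algebraic_groupoidD:
  assumes "algebraic_groupoid G"
  shows "u \<in> units G \<Longrightarrow> u \<in> arrows G"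
    and "x \<in> arrows G \<Longrightarrow> rng G x \<in> units G" and "x \<in> arrows G \<Longrightarrow> src G x \<in> units G"
    and "u \<in> units G \<Longrightarrow> rng G u = u" and "u \<in> units G \<Longrightarrow> src G u = u"
    and "x \<in> arrows G \<Longrightarrow> y \<in> arrows G \<Longrightarrow> src G x = rng G y \<Longrightarrow> mul G x y \<in> arrows G"
    and "x \<in> arrows G \<Longrightarrow> y \<in> arrows G \<Longrightarrow> src G x = rng G y \<Longrightarrow> rng G (mul G x y) = rng G x"
    and "x \<in> arrows G \<Longrightarrow> y \<in> arrows G \<Longrightarrow> src G x = rng G y \<Longrightarrow> src G (mul G x y) = src G y"
    and "x \<in> arrows G \<Longrightarrow> y \<in> arrows G \<Longrightarrow> z \<in> arrows G \<Longrightarrow> src G x = rng G y \<Longrightarrow> src G y = rng G z \<Longrightarrow>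
      mul G (mul G x y) z = mul G x (mul G y z)"
    and "x \<in> arrows G \<Longrightarrow> mul G (rng G x) x = x" and "x \<in> arrows G \<Longrightarrow> mul G x (src G x) = x"
    and "x \<in> arrows G \<Longrightarrow> ginv G x \<in> arrows G"
    and "x \<in> arrows G \<Longrightarrow> rng G (ginv G x) = src G x" and "x \<in> arrows G \<Longrightarrow> src G (ginv G x) = rng G x"
    and "x \<in> arrows G \<Longrightarrow> mul G x (ginv G x) = rng G x" and "x \<in> arrows G \<Longrightarrow> mul G (ginv G x) x = src G x"
  using assms unfolding algebraic_groupoid_def composable_def by auto

text \<open>Homomorphisms of groupoids are only required to respect products. They preserve units because the
  units are the idempotents.\<close>

lemma idempotent_arrow_unit:
  assumes G: "algebraic_groupoid G" and x: "x \<in> arrows G" "src G x = rng G x" "mul G x x = x"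
  shows "x \<in> units G"
proof -
  note g = algebraic_groupoidD[OF G]
  have "mul G (ginv G x) (mul G x x) = mul G (mul G (ginv G x) x) x"
    using g(9)[of "ginv G x" x x] g(12,14) x by simp
  also have "\<dots> = x" using g(16)[of x] g(10)[of x] x by simp
  finally have "x = mul G (ginv G x) x" using x(3) by simp
  then show ?thesis using g(3)[of x] g(16)[of x] x by simp
qed

lemma groupoid_hom_unit:
  assumes G: "algebraic_groupoid G" and H: "algebraic_groupoid H" and f: "groupoid_hom G H f"
    and u: "u \<in> units G"
  shows "f u \<in> units H"
proof (rule idempotent_arrow_unit[OF H])
  note g = algebraic_groupoidD[OF G]
  have "(u, u) \<in> composable G" using u g(1,4,5) by (simp add: composable_def)
  then have "(f u, f u) \<in> composable H" and m: "f (mul G u u) = mul H (f u) (f u)"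
    using f unfolding groupoid_hom_def by auto
  then show "f u \<in> arrows H" "src H (f u) = rng H (f u)" by (simp_all add: composable_def)
  show "mul H (f u) (f u) = f u" using m g(10)[of u] g(1,4) u by simp
qed

lemma groupoid_homD:
  assumes "groupoid_hom G H f" "x \<in> arrows G" "y \<in> arrows G" "src G x = rng G y"
  shows "f x \<in> arrows H" "f y \<in> arrows H" "src H (f x) = rng H (f y)" "f (mul G x y) = mul H (f x) (f y)"
  using assms unfolding groupoid_hom_def composable_def by auto

lemma groupoid_hom_rng_src:
  assumes G: "algebraic_groupoid G" and H: "algebraic_groupoid H" and f: "groupoid_hom G H f"
    and x: "x \<in> arrows G"
  shows "rng H (f x) = f (rng G x)" "src H (f x) = f (src G x)"
proof -
  note g = algebraic_groupoidD[OF G] and h = algebraic_groupoidD[OF H]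
  have "src H (f (rng G x)) = rng H (f x)" "src H (f x) = rng H (f (src G x))"
    using groupoid_homD(3)[OF f, of "rng G x" x] groupoid_homD(3)[OF f, of x "src G x"] x g by simp_all
  moreover have "f (rng G x) \<in> units H" "f (src G x) \<in> units H"
    using groupoid_hom_unit[OF G H f] g(2,3) x by simp_all
  ultimately show "rng H (f x) = f (rng G x)" "src H (f x) = f (src G x)" using h(4,5) by simp_all
qed

locale twist =
  fixes G :: "'g groupoid" and E :: "'e groupoid" and \<iota> :: "complex \<times> 'g \<Rightarrow> 'e" and \<pi> :: "'e \<Rightarrow> 'g"
  assumes twist: "topological_twist G E \<iota> \<pi>"
begin

abbreviation act :: "complex \<Rightarrow> 'e \<Rightarrow> 'e" where "act \<equiv> twist_action E \<iota> \<pi>"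

lemma alg: "algebraic_groupoid G" "algebraic_groupoid E"
  using twist by (simp_all add: topological_twist_def topological_groupoid_def)

lemmas E_laws = algebraic_groupoidD[OF alg(2)]
lemmas G_laws = algebraic_groupoidD[OF alg(1)]

lemma hom_pi: "groupoid_hom E G \<pi>"
  using twist by (simp add: topological_twist_def)

lemma pi_arrow: "x \<in> arrows E \<Longrightarrow> \<pi> x \<in> arrows G"
  using hom_pi by (auto simp: groupoid_hom_def)

lemma pi_rng: "x \<in> arrows E \<Longrightarrow> rng G (\<pi> x) = \<pi> (rng E x)"
  and pi_src: "x \<in> arrows E \<Longrightarrow> src G (\<pi> x) = \<pi> (src E x)"
  using groupoid_hom_rng_src[OF alg(2,1) hom_pi] by simp_all

lemma pi_rng_unit: "x \<in> arrows E \<Longrightarrow> \<pi> (rng E x) \<in> units G"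
  using groupoid_hom_unit[OF alg(2,1) hom_pi] E_laws(2) by simp

lemma iota_one_pi: "y \<in> units E \<Longrightarrow> \<iota> (1, \<pi> y) = y"
  using twist by (simp add: topological_twist_def)

lemma iota_homeo:
  "homeomorphic_maps (prod_topology (top_of_set circle) (unit_top G)) (subtopology (gtop E) (preim E \<pi> (units G)))
     \<iota> (inv_into (circle \<times> units G) \<iota>)"
proof -
  have "topspace (prod_topology (top_of_set circle) (unit_top G)) = circle \<times> units G"
    using G_laws(1) by auto
  moreover have "homeomorphic_map (prod_topology (top_of_set circle) (unit_top G))
      (subtopology (gtop E) (preim E \<pi> (units G))) \<iota>"
    using twist by (simp add: topological_twist_def trivial_circle_bundle_def)
  ultimately show ?thesis using homeomorphic_map_inv_into by metis
qed

lemma iota_inj: "inj_on \<iota> (circle \<times> units G)"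
  using iota_homeo G_laws(1) unfolding homeomorphic_maps_def
  by (intro inj_on_inverseI[of _ "inv_into (circle \<times> units G) \<iota>"]) auto

lemma iota_image: "\<iota> ` (circle \<times> units G) = preim E \<pi> (units G)"
proof -
  have "homeomorphic_map (prod_topology (top_of_set circle) (unit_top G)) (subtopology (gtop E) (preim E \<pi> (units G))) \<iota>"
    using iota_homeo homeomorphic_map_maps by blast
  from homeomorphic_imp_surjective_map[OF this] show ?thesis
    using G_laws(1) by (auto simp: preim_def inf_absorb2 subset_iff Int_absorb1 Int_absorb2)
qed

lemma iota_mult:
  assumes "z \<in> circle" "w \<in> circle" "u \<in> units G"
  shows "\<iota> (z, u) \<in> arrows E" "src E (\<iota> (z, u)) = rng E (\<iota> (w, u))"
    "\<iota> (z * w, u) = mul E (\<iota> (z, u)) (\<iota> (w, u))"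
proof -
  have h: "groupoid_hom (trivial_circle_bundle G) E \<iota>" using twist by (simp add: topological_twist_def)
  show "\<iota> (z, u) \<in> arrows E" "src E (\<iota> (z, u)) = rng E (\<iota> (w, u))"
    "\<iota> (z * w, u) = mul E (\<iota> (z, u)) (\<iota> (w, u))"
    using groupoid_homD[OF h, of "(z, u)" "(w, u)"] assms G_laws(1)
    by (simp_all add: trivial_circle_bundle_def)
qed

text \<open>The image \<open>\<iota> (1, u)\<close> is idempotent, hence a unit of \<open>E\<close>, and injectivity of \<open>\<iota>\<close> identifies the unit of
  \<open>G\<close> below it.\<close>

lemma iota_one_unit:
  assumes u: "u \<in> units G"
  shows "\<iota> (1, u) \<in> units E" "\<pi> (\<iota> (1, u)) = u"
proof -
  have 1: "(1::complex) \<in> circle" by simp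
  show y: "\<iota> (1, u) \<in> units E"
    using idempotent_arrow_unit[OF alg(2) iota_mult(1,2)[OF 1 1 u]] iota_mult(3)[OF 1 1 u] by simp
  then have "\<iota> (1, \<pi> (\<iota> (1, u))) = \<iota> (1, u)" by (rule iota_one_pi)
  moreover have "\<pi> (\<iota> (1, u)) \<in> units G" using groupoid_hom_unit[OF alg(2,1) hom_pi y] .
  ultimately have "(1, \<pi> (\<iota> (1, u))) = ((1::complex), u)" using u by (intro inj_onD[OF iota_inj]) auto
  then show "\<pi> (\<iota> (1, u)) = u" by simp
qed

lemma iota_ends:
  assumes z: "z \<in> circle" and u: "u \<in> units G"
  shows "rng E (\<iota> (z, u)) = \<iota> (1, u)" "src E (\<iota> (z, u)) = \<iota> (1, u)" "\<pi> (\<iota> (z, u)) = u"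
proof -
  have 1: "(1::complex) \<in> circle" by simp
  note y = iota_one_unit[OF u]
  show r: "rng E (\<iota> (z, u)) = \<iota> (1, u)" using iota_mult(2)[OF 1 z u] E_laws(5)[OF y(1)] by simp
  show "src E (\<iota> (z, u)) = \<iota> (1, u)" using iota_mult(2)[OF z 1 u] E_laws(4)[OF y(1)] by simp
  have a: "\<iota> (z, u) \<in> arrows E" by (rule iota_mult(1)[OF z z u])
  have "\<pi> (\<iota> (z, u)) \<in> units G" using iota_image z u by (auto simp: preim_def)
  then have "\<pi> (\<iota> (z, u)) = rng G (\<pi> (\<iota> (z, u)))" using G_laws(4) by simp
  also have "\<dots> = u" using pi_rng[OF a] r y(2) by simp
  finally show "\<pi> (\<iota> (z, u)) = u" .
qed

lemma iota_composable:
  assumes x: "x \<in> arrows E" and z: "z \<in> circle"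
  shows "\<iota> (z, \<pi> (rng E x)) \<in> arrows E" "src E (\<iota> (z, \<pi> (rng E x))) = rng E x"
    "rng E (\<iota> (z, \<pi> (rng E x))) = rng E x"
  using iota_mult(1)[OF z z pi_rng_unit[OF x]] iota_ends[OF z pi_rng_unit[OF x]] iota_one_pi[OF E_laws(2)[OF x]]
  by simp_all

lemma act_arrow:
  assumes x: "x \<in> arrows E" and z: "z \<in> circle"
  shows "act z x \<in> arrows E" "rng E (act z x) = rng E x" "\<pi> (act z x) = \<pi> x"
proof -
  note c = iota_composable[OF x z]
  show "act z x \<in> arrows E" "rng E (act z x) = rng E x"
    using E_laws(6,7)[OF c(1) x c(2)] c(3) by (simp_all add: twist_action_def)
  have "\<pi> (act z x) = mul G (\<pi> (rng E x)) (\<pi> x)"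
    using groupoid_homD(4)[OF hom_pi c(1) x c(2)] iota_ends(3)[OF z pi_rng_unit[OF x]]
    by (simp add: twist_action_def)
  then show "\<pi> (act z x) = \<pi> x" using G_laws(10)[OF pi_arrow[OF x]] pi_rng[OF x] by simp
qed

lemma act_one: "x \<in> arrows E \<Longrightarrow> act 1 x = x"
  using iota_one_pi[OF E_laws(2)] E_laws(10) by (simp add: twist_action_def)

lemma act_act:
  assumes x: "x \<in> arrows E" and z: "z \<in> circle" and w: "w \<in> circle"
  shows "act (z * w) x = act z (act w x)"
proof -
  note cz = iota_composable[OF x z] and cw = iota_composable[OF x w]
  have "act z (act w x) = mul E (\<iota> (z, \<pi> (rng E x))) (mul E (\<iota> (w, \<pi> (rng E x))) x)"
    using act_arrow(2)[OF x w] by (simp add: twist_action_def)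
  also have "\<dots> = mul E (mul E (\<iota> (z, \<pi> (rng E x))) (\<iota> (w, \<pi> (rng E x)))) x"
    using E_laws(9)[OF cz(1) cw(1) x] cz cw by simp
  also have "\<dots> = act (z * w) x"
    using iota_mult(3)[OF z w pi_rng_unit[OF x]] by (simp add: twist_action_def)
  finally show ?thesis by simp
qed

text \<open>Division recovers \<open>z\<close> from \<open>z \<cdot> x\<close> and \<open>x\<close>. This gives freeness of the action, and its continuity
  gives continuous inverses of the parametrisations below.\<close>

lemma act_ginv:
  assumes x: "x \<in> arrows E" and z: "z \<in> circle"
  shows "mul E (act z x) (ginv E x) = \<iota> (z, \<pi> (rng E x))"
  using iota_composable[OF x z] E_laws(9)[of "\<iota> (z, \<pi> (rng E x))" x "ginv E x"] x
    E_laws(11)[of "\<iota> (z, \<pi> (rng E x))"] E_laws(12,13,15)[OF x]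
  by (simp add: twist_action_def)

text \<open>For \<open>x\<close>, \<open>y\<close> in one fibre, the element of the circle that moves \<open>y\<close> to \<open>x\<close>.\<close>

definition quot :: "'e \<Rightarrow> 'e \<Rightarrow> complex" where
  "quot x y = fst (inv_into (circle \<times> units G) \<iota> (mul E x (ginv E y)))"

text \<open>A unit of \<open>E\<close> is determined by its image in \<open>G\<close>. Hence two arrows in one fibre have the same source
  and range, they can be divided, and the quotient lies over a unit.\<close>

lemma same_fibre:
  assumes x: "x \<in> arrows E" and y: "y \<in> arrows E" and xy: "\<pi> x = \<pi> y"
  shows "src E x = src E y" "rng E x = rng E y" "mul E x (ginv E y) \<in> preim E \<pi> (units G)"
proof -
  show s: "src E x = src E y"
    using iota_one_pi[OF E_laws(3)[OF x]] iota_one_pi[OF E_laws(3)[OF y]] pi_src[OF x] pi_src[OF y] xy by simp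
  show r: "rng E x = rng E y"
    using iota_one_pi[OF E_laws(2)[OF x]] iota_one_pi[OF E_laws(2)[OF y]] pi_rng[OF x] pi_rng[OF y] xy by simp
  have c: "src E x = rng E (ginv E y)" using s E_laws(13)[OF y] by simp
  have "\<pi> (mul E x (ginv E y)) = mul G (\<pi> y) (\<pi> (ginv E y))"
    using groupoid_homD(4)[OF hom_pi x E_laws(12)[OF y] c] xy by simp
  also have "\<dots> = \<pi> (mul E y (ginv E y))"
    using groupoid_homD(4)[OF hom_pi y E_laws(12)[OF y]] E_laws(13)[OF y] by simp
  also have "\<dots> = \<pi> (rng E y)" using E_laws(15)[OF y] by simp
  finally show "mul E x (ginv E y) \<in> preim E \<pi> (units G)"
    using pi_rng_unit[OF y] E_laws(6)[OF x E_laws(12)[OF y] c] by (simp add: preim_def)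
qed

lemma act_quot:
  assumes x: "x \<in> arrows E" and y: "y \<in> arrows E" and xy: "\<pi> x = \<pi> y"
  shows "quot x y \<in> circle" "act (quot x y) y = x"
proof -
  note f = same_fibre[OF x y xy]
  have c: "src E x = rng E (ginv E y)" using f(1) E_laws(13)[OF y] by simp
  from f(3) obtain z u where zu: "z \<in> circle" "u \<in> units G" "mul E x (ginv E y) = \<iota> (z, u)"
    using iota_image by blast
  have q: "quot x y = z"
    using zu inv_into_f_f[OF iota_inj, of "(z, u)"] by (simp add: quot_def)
  show "quot x y \<in> circle" using q zu(1) by simp
  have "rng E x = \<iota> (1, u)"
    using iota_ends(1)[OF zu(1,2)] E_laws(7)[OF x E_laws(12)[OF y] c] zu(3) by simp
  then have u: "u = \<pi> (rng E y)" using f(2) iota_one_unit(2)[OF zu(2)] by simp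
  have "act (quot x y) y = mul E (mul E x (ginv E y)) y"
    using q zu(3) u by (simp add: twist_action_def)
  also have "\<dots> = mul E x (mul E (ginv E y) y)"
    using E_laws(9)[OF x E_laws(12)[OF y] y c] E_laws(14)[OF y] by simp
  also have "\<dots> = x" using E_laws(16)[OF y] E_laws(11)[OF x] f(1) by simp
  finally show "act (quot x y) y = x" .
qed

lemma quot_act:
  assumes y: "y \<in> arrows E" and z: "z \<in> circle"
  shows "quot (act z y) y = z"
  using act_ginv[OF y z] inv_into_f_f[OF iota_inj, of "(z, \<pi> (rng E y))"] z pi_rng_unit[OF y]
  by (simp add: quot_def)

lemma continuous_act:
  assumes z: "continuous_map X (top_of_set circle) z" and x: "continuous_map X (gtop E) x"
  shows "continuous_map X (gtop E) (\<lambda>t. act (z t) (x t))"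
proof -
  have tg: "topological_groupoid E" and cpi: "continuous_map (gtop E) (gtop G) \<pi>"
    using twist by (simp_all add: topological_twist_def)
  have xt: "x t \<in> arrows E" "z t \<in> circle" if "t \<in> topspace X" for t
    using continuous_map_image_subset_topspace[OF x] continuous_map_image_subset_topspace[OF z] that by auto
  have "continuous_map (gtop E) (gtop E) (rng E)"
    using tg by (simp add: topological_groupoid_def continuous_map_in_subtopology)
  then have "continuous_map X (gtop G) (\<pi> \<circ> (rng E \<circ> x))"
    by (intro continuous_map_compose[OF _ cpi] continuous_map_compose[OF x])
  then have "continuous_map X (unit_top G) (\<lambda>t. \<pi> (rng E (x t)))"
    using xt pi_rng_unit by (auto simp: continuous_map_in_subtopology o_def)
  then have "continuous_map X (prod_topology (top_of_set circle) (unit_top G)) (\<lambda>t. (z t, \<pi> (rng E (x t))))"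
    using z by (simp add: continuous_map_pairwise o_def)
  moreover have "continuous_map (prod_topology (top_of_set circle) (unit_top G)) (gtop E) \<iota>"
    using iota_homeo by (auto simp: homeomorphic_maps_def continuous_map_in_subtopology)
  ultimately have "continuous_map X (gtop E) (\<iota> \<circ> (\<lambda>t. (z t, \<pi> (rng E (x t)))))"
    by (rule continuous_map_compose)
  then have "continuous_map X (prod_topology (gtop E) (gtop E)) (\<lambda>t. (\<iota> (z t, \<pi> (rng E (x t))), x t))"
    using x by (simp add: continuous_map_pairwise o_def)
  then have "continuous_map X (subtopology (prod_topology (gtop E) (gtop E)) (composable E))
      (\<lambda>t. (\<iota> (z t, \<pi> (rng E (x t))), x t))"
    using xt iota_composable by (auto simp: continuous_map_in_subtopology composable_def)
  moreover have "continuous_map (subtopology (prod_topology (gtop E) (gtop E)) (composable E)) (gtop E) (\<lambda>(x, y). mul E x y)"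
    using tg by (simp add: topological_groupoid_def)
  ultimately have "continuous_map X (gtop E) ((\<lambda>(x, y). mul E x y) \<circ> (\<lambda>t. (\<iota> (z t, \<pi> (rng E (x t))), x t)))"
    by (rule continuous_map_compose)
  then show ?thesis by (simp add: o_def twist_action_def)
qed

lemma continuous_quot:
  assumes x: "continuous_map X (gtop E) x" and y: "continuous_map X (gtop E) y"
    and xy: "\<And>t. t \<in> topspace X \<Longrightarrow> \<pi> (x t) = \<pi> (y t)"
  shows "continuous_map X (top_of_set circle) (\<lambda>t. quot (x t) (y t))"
proof -
  have tg: "topological_groupoid E" using twist by (simp add: topological_twist_def)
  have xt: "x t \<in> arrows E" "y t \<in> arrows E" if "t \<in> topspace X" for t
    using continuous_map_image_subset_topspace[OF x] continuous_map_image_subset_topspace[OF y] that by auto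
  have "continuous_map (gtop E) (gtop E) (ginv E)" using tg by (simp add: topological_groupoid_def)
  then have "continuous_map X (gtop E) (ginv E \<circ> y)" by (rule continuous_map_compose[OF y])
  then have "continuous_map X (prod_topology (gtop E) (gtop E)) (\<lambda>t. (x t, ginv E (y t)))"
    using x by (simp add: continuous_map_pairwise o_def)
  then have "continuous_map X (subtopology (prod_topology (gtop E) (gtop E)) (composable E)) (\<lambda>t. (x t, ginv E (y t)))"
    using xt same_fibre(1)[OF _ _ xy] E_laws(12,13) by (auto simp: continuous_map_in_subtopology composable_def)
  moreover have "continuous_map (subtopology (prod_topology (gtop E) (gtop E)) (composable E)) (gtop E) (\<lambda>(x, y). mul E x y)"
    using tg by (simp add: topological_groupoid_def)
  ultimately have "continuous_map X (gtop E) ((\<lambda>(x, y). mul E x y) \<circ> (\<lambda>t. (x t, ginv E (y t))))"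
    by (rule continuous_map_compose)
  then have "continuous_map X (subtopology (gtop E) (preim E \<pi> (units G))) (\<lambda>t. mul E (x t) (ginv E (y t)))"
    using xt same_fibre(3)[OF _ _ xy] by (auto simp: continuous_map_in_subtopology o_def)
  moreover have "continuous_map (subtopology (gtop E) (preim E \<pi> (units G)))
      (prod_topology (top_of_set circle) (unit_top G)) (inv_into (circle \<times> units G) \<iota>)"
    using iota_homeo by (simp add: homeomorphic_maps_def)
  ultimately have "continuous_map X (prod_topology (top_of_set circle) (unit_top G))
      (inv_into (circle \<times> units G) \<iota> \<circ> (\<lambda>t. mul E (x t) (ginv E (y t))))"
    by (rule continuous_map_compose)
  from continuous_map_compose[OF this continuous_map_fst] show ?thesis
    by (simp add: o_def quot_def)
qed

end


section \<open>Local sections and the parametrisations they define\<close>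

locale twist_sections = twist G E \<iota> \<pi>
  for G :: "'g groupoid" and E :: "'e groupoid" and \<iota> :: "complex \<times> 'g \<Rightarrow> 'e" and \<pi> :: "'e \<Rightarrow> 'g" +
  fixes A :: "'g chart set" and I :: "'i set" and U :: "'i \<Rightarrow> 'g set" and \<sigma> :: "'i \<Rightarrow> 'g \<Rightarrow> 'e"
  assumes mfd: "smooth_manifold (gtop G, A)"
    and U_open: "\<And>a. a \<in> I \<Longrightarrow> openin (gtop G) (U a)"
    and U_cover: "(\<Union>a\<in>I. U a) = arrows G"
    and sec_cont: "\<And>a. a \<in> I \<Longrightarrow> continuous_map (subtopology (gtop G) (U a)) (gtop E) (\<sigma> a)"
    and pi_sec: "\<And>a \<gamma>. a \<in> I \<Longrightarrow> \<gamma> \<in> U a \<Longrightarrow> \<pi> (\<sigma> a \<gamma>) = \<gamma>"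
    and cocycle: "\<And>a b. a \<in> I \<Longrightarrow> b \<in> I \<Longrightarrow>
      smooth_map (open_submfd (gtop G, A) (U a \<inter> U b)) circle_mfd (\<lambda>\<gamma>. quot (\<sigma> a \<gamma>) (\<sigma> b \<gamma>))"
begin

abbreviation V :: "'i \<Rightarrow> 'e set" where "V a \<equiv> preim E \<pi> (U a)"

text \<open>The parametrisation \<open>\<psi>\<^sub>a\<close> of \<open>\<pi>\<^sup>-\<^sup>1(U\<^sub>a)\<close> by \<open>\<T> \<times> U\<^sub>a\<close>.\<close>

definition param :: "'i \<Rightarrow> complex \<times> 'g \<Rightarrow> 'e" where
  "param a = (\<lambda>(z, \<gamma>). act z (\<sigma> a \<gamma>))"

lemma U_sub: "a \<in> I \<Longrightarrow> U a \<subseteq> arrows G"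
  using U_open openin_subset by blast

lemma sec_arrow: "a \<in> I \<Longrightarrow> \<gamma> \<in> U a \<Longrightarrow> \<sigma> a \<gamma> \<in> arrows E"
  using continuous_map_image_subset_topspace[OF sec_cont, of a] U_sub[of a] by auto

lemma pi_cont: "continuous_map (gtop E) (gtop G) \<pi>"
  using twist by (simp add: topological_twist_def)

lemma openin_preim: "openin (gtop G) W \<Longrightarrow> openin (gtop E) (preim E \<pi> W)"
  unfolding preim_def by (rule openin_continuous_map_preimage[OF pi_cont])

lemma V_open: "a \<in> I \<Longrightarrow> openin (gtop E) (V a)"
  by (rule openin_preim[OF U_open])

lemma V_cover: "(\<Union>a\<in>I. V a) = arrows E"
  using U_cover pi_arrow by (auto simp: preim_def)

lemma param_props:
  assumes a: "a \<in> I" and z: "z \<in> circle" and y: "\<gamma> \<in> U a"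
  shows "param a (z, \<gamma>) \<in> arrows E" "\<pi> (param a (z, \<gamma>)) = \<gamma>" "quot (param a (z, \<gamma>)) (\<sigma> a \<gamma>) = z"
  using act_arrow[OF sec_arrow[OF a y] z] quot_act[OF sec_arrow[OF a y] z] pi_sec[OF a y]
  by (simp_all add: param_def)

lemma param_surj:
  assumes a: "a \<in> I" and x: "x \<in> V a"
  shows "quot x (\<sigma> a (\<pi> x)) \<in> circle" "param a (quot x (\<sigma> a (\<pi> x)), \<pi> x) = x"
proof -
  have x': "x \<in> arrows E" "\<pi> x \<in> U a" using x by (auto simp: preim_def)
  show "quot x (\<sigma> a (\<pi> x)) \<in> circle" "param a (quot x (\<sigma> a (\<pi> x)), \<pi> x) = x"
    using act_quot[OF x'(1) sec_arrow[OF a x'(2)]] pi_sec[OF a x'(2)] by (simp_all add: param_def)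
qed

lemma param_inj: "a \<in> I \<Longrightarrow> inj_on (param a) (circle \<times> U a)"
  by (rule inj_on_inverseI[of _ "\<lambda>x. (quot x (\<sigma> a (\<pi> x)), \<pi> x)"]) (auto simp: param_props)

text \<open>The inverse of \<open>param a\<close> sends \<open>x\<close> to the pair of \<open>quot x (\<sigma> a (\<pi> x))\<close> and \<open>\<pi> x\<close>; it is continuous because
  division in \<open>E\<close> is. The subspace \<open>S\<close> of \<open>G\<close> makes the lemma applicable to the part of \<open>E\<close> over a
  submanifold.\<close>

lemma param_homeomorphic_map:
  assumes a: "a \<in> I"
  shows "homeomorphic_map (prod_topology (top_of_set circle) (subtopology (subtopology (gtop G) S) (U a)))
      (subtopology (subtopology (gtop E) (preim E \<pi> S)) (V a)) (param a)"
proof -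
  let ?P = "prod_topology (top_of_set circle) (subtopology (subtopology (gtop G) S) (U a))"
  let ?X = "subtopology (subtopology (gtop E) (preim E \<pi> S)) (V a)"
  have tP: "topspace ?P = circle \<times> (S \<inter> U a)" using U_sub[OF a] by auto
  have tX: "topspace ?X = preim E \<pi> S \<inter> V a" by (auto simp: preim_def)
  have "homeomorphic_maps ?P ?X (param a) (\<lambda>x. (quot x (\<sigma> a (\<pi> x)), \<pi> x))"
    unfolding homeomorphic_maps_def
  proof (intro conjI ballI)
    have s: "continuous_map ?P (subtopology (gtop G) (U a)) snd"
      using continuous_map_snd[of "top_of_set circle" "subtopology (subtopology (gtop G) S) (U a)"]
      by (auto simp: continuous_map_in_subtopology)
    have "continuous_map ?P (gtop E) (\<lambda>p. act (fst p) ((\<sigma> a \<circ> snd) p))"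
      by (intro continuous_act continuous_map_fst continuous_map_compose[OF s sec_cont[OF a]])
    then have "continuous_map ?P (gtop E) (param a)" by (simp add: param_def o_def case_prod_unfold)
    then show "continuous_map ?P ?X (param a)"
      using param_props[OF a] tP unfolding continuous_map_in_subtopology tP by (auto simp: preim_def)
    have i: "continuous_map ?X (gtop E) (\<lambda>x. x)" by (intro continuous_map_from_subtopology) simp
    have p: "continuous_map ?X (gtop G) \<pi>" by (intro continuous_map_from_subtopology pi_cont)
    have pU: "continuous_map ?X (subtopology (gtop G) (U a)) \<pi>"
      using p by (auto simp: continuous_map_in_subtopology preim_def)
    have "continuous_map ?X (top_of_set circle) (\<lambda>x. quot x ((\<sigma> a \<circ> \<pi>) x))"
      by (rule continuous_quot[OF i continuous_map_compose[OF pU sec_cont[OF a]]])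
        (auto simp: preim_def pi_sec[OF a])
    moreover have "continuous_map ?X (subtopology (subtopology (gtop G) S) (U a)) \<pi>"
      using p by (auto simp: continuous_map_in_subtopology preim_def)
    ultimately show "continuous_map ?X ?P (\<lambda>x. (quot x (\<sigma> a (\<pi> x)), \<pi> x))"
      by (simp add: continuous_map_pairwise o_def)
    show "(quot (param a p) (\<sigma> a (\<pi> (param a p))), \<pi> (param a p)) = p" if "p \<in> topspace ?P" for p
      using that param_props[OF a] unfolding tP by auto
    show "param a (quot x (\<sigma> a (\<pi> x)), \<pi> x) = x" if "x \<in> topspace ?X" for x
      using that param_surj[OF a] unfolding tX by auto
  qed
  then show ?thesis using homeomorphic_map_maps by blast
qed

text \<open>Countably many of the sets \<open>U a\<close> cover \<open>G\<close>, and above each of them \<open>E\<close> is homeomorphic to a product of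
  second countable spaces.\<close>

lemma second_countable_total: "second_countable (gtop E)"
proof -
  have sG: "second_countable (gtop G)"
    using mfd by (simp add: smooth_manifold_def second_countable_space_iff)
  have "\<exists>\<V>. countable \<V> \<and> \<V> \<subseteq> U ` I \<and> \<Union>\<V> = arrows G"
    by (rule Lindelof_spaceD[OF second_countable_imp_Lindelof_space[OF sG]]) (use U_open U_cover in auto)
  then obtain J where J: "countable J" "J \<subseteq> I" "(\<Union>a\<in>J. U a) = arrows G"
    by (metis countable_subset_image)
  have "\<exists>B. countable B \<and> (\<forall>W\<in>B. openin (gtop E) W) \<and>
      (\<forall>W x. openin (gtop E) W \<and> x \<in> W \<and> x \<in> V a \<longrightarrow> (\<exists>W'\<in>B. x \<in> W' \<and> W' \<subseteq> W))" if a: "a \<in> J" for a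
  proof -
    have aI: "a \<in> I" using a J by blast
    have "second_countable (prod_topology (top_of_set circle) (subtopology (subtopology (gtop G) (arrows G)) (U a)))"
      using sG second_countable_euclidean
      by (intro second_countable_prod_topology second_countable_subtopology)
    moreover have "prod_topology (top_of_set circle) (subtopology (subtopology (gtop G) (arrows G)) (U a))
        homeomorphic_space subtopology (subtopology (gtop E) (preim E \<pi> (arrows G))) (V a)"
      using param_homeomorphic_map[OF aI] homeomorphic_map_imp_homeomorphic_space by blast
    ultimately have "second_countable (subtopology (subtopology (gtop E) (preim E \<pi> (arrows G))) (V a))"
      using homeomorphic_space_second_countability by blast
    moreover have "preim E \<pi> (arrows G) \<inter> V a = V a" using U_sub[OF aI] by (auto simp: preim_def)
    ultimately have "second_countable (subtopology (gtop E) (V a))" by (simp add: subtopology_subtopology)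
    then obtain B where B: "countable B" "\<And>W. W \<in> B \<Longrightarrow> openin (subtopology (gtop E) (V a)) W"
      "\<And>W x. openin (subtopology (gtop E) (V a)) W \<Longrightarrow> x \<in> W \<Longrightarrow> \<exists>W'\<in>B. x \<in> W' \<and> W' \<subseteq> W"
      unfolding second_countable_def by metis
    have "\<exists>W'\<in>B. x \<in> W' \<and> W' \<subseteq> W" if "openin (gtop E) W" "x \<in> W" "x \<in> V a" for W x
    proof -
      have "openin (subtopology (gtop E) (V a)) (W \<inter> V a)" using that(1) by (auto simp: openin_subtopology)
      from B(3)[OF this, of x] that show ?thesis by auto
    qed
    moreover have "openin (gtop E) W" if "W \<in> B" for W
      using B(2)[OF that] V_open[OF aI] by (simp add: openin_open_subtopology)
    ultimately show ?thesis using B(1) by blast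
  qed
  then obtain B where B: "\<And>a. a \<in> J \<Longrightarrow> countable (B a)" "\<And>a W. a \<in> J \<Longrightarrow> W \<in> B a \<Longrightarrow> openin (gtop E) W"
    "\<And>a W x. a \<in> J \<Longrightarrow> openin (gtop E) W \<Longrightarrow> x \<in> W \<Longrightarrow> x \<in> V a \<Longrightarrow> \<exists>W'\<in>B a. x \<in> W' \<and> W' \<subseteq> W"
    by metis
  show ?thesis
    unfolding second_countable_def
  proof (intro exI[of _ "\<Union>a\<in>J. B a"] conjI allI impI ballI)
    show "countable (\<Union>a\<in>J. B a)" using J(1) B(1) by blast
    show "openin (gtop E) W" if "W \<in> (\<Union>a\<in>J. B a)" for W using that B(2) by blast
    fix W x assume W: "openin (gtop E) W \<and> x \<in> W"
    then have x: "x \<in> arrows E" using openin_subset by blast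
    then obtain a where a: "a \<in> J" "\<pi> x \<in> U a" using J(3) pi_arrow[OF x] by blast
    then have "x \<in> V a" using x by (simp add: preim_def)
    from B(3)[OF a(1) conjunct1[OF W] conjunct2[OF W] this] obtain W'
      where W': "W' \<in> B a" "x \<in> W'" "W' \<subseteq> W" by (elim bexE conjE)
    have "W' \<in> (\<Union>a\<in>J. B a)" using a(1) W'(1) by (rule UN_I)
    then show "\<exists>V\<in>(\<Union>a\<in>J. B a). x \<in> V \<and> V \<subseteq> W" using W'(2,3) by (intro bexI[of _ W'] conjI)
  qed
qed

abbreviation param_mfd :: "'g mfd \<Rightarrow> 'i \<Rightarrow> (complex \<times> 'g) mfd" where
  "param_mfd N a \<equiv> prod_mfd circle_mfd (open_submfd N (U a))"

text \<open>The change of parametrisation from \<open>a\<close> to \<open>b\<close> is \<open>(z, \<gamma>) \<mapsto> (z c(\<gamma>), \<gamma>)\<close>, where \<open>c\<close> is the cocycle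
  \<open>quot (\<sigma> a \<gamma>) (\<sigma> b \<gamma>)\<close>. The gluing is carried out over a subspace \<open>S\<close> of \<open>G\<close> with a smooth structure of
  its own, because it is needed twice: over \<open>G\<close> itself, and over the unit space.\<close>

lemma glue_over:
  assumes S: "S \<subseteq> arrows G" and N: "smooth_manifold (subtopology (gtop G) S, AS)"
    and coc: "\<And>a b. a \<in> I \<Longrightarrow> b \<in> I \<Longrightarrow>
      smooth_map (open_submfd (subtopology (gtop G) S, AS) (U a \<inter> U b)) circle_mfd (\<lambda>\<gamma>. quot (\<sigma> a \<gamma>) (\<sigma> b \<gamma>))"
  obtains B where "smooth_manifold (subtopology (gtop E) (preim E \<pi> S), B)"
    "\<And>a. a \<in> I \<Longrightarrow> diffeomorphism (param_mfd (subtopology (gtop G) S, AS) a)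
       (open_submfd (subtopology (gtop E) (preim E \<pi> S), B) (preim E \<pi> S \<inter> V a)) (param a)"
proof -
  let ?N = "(subtopology (gtop G) S, AS)" and ?X = "subtopology (gtop E) (preim E \<pi> S)"
  let ?W = "\<lambda>a. preim E \<pi> S \<inter> V a"
  have US: "openin (fst ?N) (S \<inter> U a)" if "a \<in> I" for a
    using U_open[OF that] by (auto simp: openin_subtopology)
  have oU: "open_submfd ?N (U a) = open_submfd ?N (S \<inter> U a)" if "a \<in> I" for a
    using open_submfd_Int_topspace[OF N, of "U a"] S by (simp add: inf_absorb2)
  have NU: "smooth_manifold (open_submfd ?N (U a))" if "a \<in> I" for a
    unfolding oU[OF that] by (rule smooth_manifold_open_submfd[OF N US[OF that]])
  have P: "smooth_manifold (param_mfd ?N a)" if "a \<in> I" for a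
    by (rule smooth_manifold_prod[OF smooth_manifold_circle NU[OF that]])
  have topP: "topspace (fst (param_mfd ?N a)) = circle \<times> (S \<inter> U a)" if "a \<in> I" for a
    using U_sub[OF that] by auto
  have H: "Hausdorff_space ?X"
    using twist by (intro Hausdorff_space_subtopology) (simp add: topological_twist_def topological_groupoid_def)
  have SC: "second_countable_space ?X"
    by (simp add: second_countable_space_iff second_countable_subtopology second_countable_total)
  have W: "openin ?X (?W a)" if "a \<in> I" for a
    using V_open[OF that] by (auto simp: openin_subtopology)
  have cov: "(\<Union>a\<in>I. ?W a) = topspace ?X" using V_cover by (auto simp: preim_def)
  have h: "homeomorphic_map (fst (param_mfd ?N a)) (subtopology ?X (?W a)) (param a)" if "a \<in> I" for a
  proof -
    have "subtopology ?X (?W a) = subtopology ?X (V a)"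
      by (simp add: subtopology_subtopology)
    then show ?thesis using param_homeomorphic_map[OF that, of S] by simp
  qed
  have tr: "smooth_map (open_submfd (param_mfd ?N a) {x \<in> topspace (fst (param_mfd ?N a)). param a x \<in> ?W b})
      (param_mfd ?N b) (\<lambda>x. inv_into (topspace (fst (param_mfd ?N b))) (param b) (param a x))"
    if a: "a \<in> I" and b: "b \<in> I" for a b
  proof -
    let ?O = "{x \<in> topspace (fst (param_mfd ?N a)). param a x \<in> ?W b}"
    let ?Q = "open_submfd (param_mfd ?N a) ?O"
    have Oi: "z \<in> circle" "\<gamma> \<in> S" "\<gamma> \<in> U a" "\<gamma> \<in> U b" if "(z, \<gamma>) \<in> ?O" for z \<gamma>
      using that param_props(2)[OF a, of z \<gamma>] unfolding topP[OF a] by (auto simp: preim_def)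
    have "continuous_map (fst (param_mfd ?N a)) ?X (param a)"
      using homeomorphic_imp_continuous_map[OF h[OF a]] by (simp add: continuous_map_in_subtopology)
    then have O: "openin (fst (param_mfd ?N a)) ?O" by (rule openin_continuous_map_preimage[OF _ W[OF b]])
    have Q: "smooth_manifold ?Q" by (rule smooth_manifold_open_submfd[OF P[OF a] O])
    have f: "smooth_map ?Q circle_mfd fst"
      by (rule smooth_map_restrict[OF P[OF a] O smooth_map_fst[OF smooth_manifold_circle NU[OF a]]])
    have s: "smooth_map ?Q ?N snd"
      by (rule smooth_map_from_open[OF smooth_map_restrict[OF P[OF a] O smooth_map_snd[OF smooth_manifold_circle NU[OF a]]]])
    have UU: "openin (fst ?N) (S \<inter> U a \<inter> (S \<inter> U b))" using US[OF a] US[OF b] by blast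
    have "open_submfd ?N (U a \<inter> U b) = open_submfd ?N (S \<inter> U a \<inter> (S \<inter> U b))"
      using oU[OF a] oU[OF b] open_submfd_open_submfd[of ?N] by (metis Int_commute)
    moreover have snd_O: "snd p \<in> S \<inter> U a \<inter> (S \<inter> U b)" if "p \<in> topspace (fst ?Q)" for p
      using Oi[of "fst p" "snd p"] that by simp
    ultimately have sab: "smooth_map ?Q (open_submfd ?N (U a \<inter> U b)) snd"
      using smooth_map_into_open[OF Q N UU s snd_O] by simp
    have sb: "smooth_map ?Q (open_submfd ?N (U b)) snd"
      unfolding oU[OF b] by (rule smooth_map_into_open[OF Q N US[OF b] s]) (use snd_O in blast)
    have NUU: "smooth_manifold (open_submfd ?N (U a \<inter> U b))"
      using smooth_manifold_open_submfd[OF N UU] \<open>open_submfd ?N (U a \<inter> U b) = _\<close> by simp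
    have "smooth_map ?Q (param_mfd ?N b)
        (\<lambda>x. (fst x * quot (\<sigma> a (snd x)) (\<sigma> b (snd x)), snd x))"
      by (intro smooth_map_pair[OF Q smooth_manifold_circle NU[OF b] _ sb] smooth_map_mult[OF Q f]
          smooth_map_compose[OF Q NUU sab coc[OF a b]])
    then show ?thesis
    proof (rule smooth_map_cong[OF Q])
      fix x assume "x \<in> topspace (fst ?Q)"
      then obtain z \<gamma> where x: "x = (z, \<gamma>)" "(z, \<gamma>) \<in> ?O" by (cases x) auto
      note o = Oi[OF x(2)]
      have q: "quot (\<sigma> a \<gamma>) (\<sigma> b \<gamma>) \<in> circle" "act (quot (\<sigma> a \<gamma>) (\<sigma> b \<gamma>)) (\<sigma> b \<gamma>) = \<sigma> a \<gamma>"
        using act_quot[OF sec_arrow[OF a o(3)] sec_arrow[OF b o(4)]] pi_sec[OF a o(3)] pi_sec[OF b o(4)] by simp_all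
      have "param b (z * quot (\<sigma> a \<gamma>) (\<sigma> b \<gamma>), \<gamma>) = param a (z, \<gamma>)"
        using act_act[OF sec_arrow[OF b o(4)] o(1) q(1)] q(2) by (simp add: param_def)
      moreover have "(z * quot (\<sigma> a \<gamma>) (\<sigma> b \<gamma>), \<gamma>) \<in> topspace (fst (param_mfd ?N b))"
        unfolding topP[OF b] using o q(1) by (simp add: norm_mult)
      moreover have "inj_on (param b) (topspace (fst (param_mfd ?N b)))"
        unfolding topP[OF b] by (rule inj_on_subset[OF param_inj[OF b]]) auto
      ultimately have "inv_into (topspace (fst (param_mfd ?N b))) (param b) (param a (z, \<gamma>))
          = (z * quot (\<sigma> a \<gamma>) (\<sigma> b \<gamma>), \<gamma>)" by (metis inv_into_f_f)
      then show "(fst x * quot (\<sigma> a (snd x)) (\<sigma> b (snd x)), snd x) =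
          inv_into (topspace (fst (param_mfd ?N b))) (param b) (param a x)" using x(1) by simp
    qed
  qed
  obtain B where "smooth_manifold (?X, B)"
    "\<And>a. a \<in> I \<Longrightarrow> diffeomorphism (param_mfd ?N a) (open_submfd (?X, B) (?W a)) (param a)"
    by (rule glue_smooth_manifolds[OF H SC P W cov h tr]) blast+
  then show thesis by (rule that)
qed

end

section \<open>Differentials of product maps\<close>

lemma partial_deriv_coordinate: "partial_deriv i (\<lambda>y. y j) y = (if i = j then 1 else 0)"
  unfolding partial_deriv_def by (cases "i = j") simp_all

lemma last_coords_update: "last_coords m (y(i := t)) = (if i < m then last_coords m y else (last_coords m y)(i - m := t))"
  by (auto simp: last_coords_def fun_eq_iff)

lemma sum_split_lessThan: "(\<Sum>i<m + n :: nat. f i) = (\<Sum>i<m. f i) + (\<Sum>i<n. f (m + i) :: real)"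
  by (induction n) (auto simp: algebra_simps)

text \<open>The map is the product of an identity with \<open>F\<close>. Its partial derivatives are \<open>0\<close>, \<open>1\<close>, or those of \<open>F\<close>,
  the last because they are derivatives of literally the same functions of one variable.\<close>

lemma differential_join:
  "differential (m + n) (m + n') (\<lambda>y. join_coords m (first_coords m y) (F (last_coords m y))) y v =
     join_coords m (first_coords m v) (differential n n' F (last_coords m y) (last_coords m v))"
proof
  fix j
  let ?H = "\<lambda>y. join_coords m (first_coords m y) (F (last_coords m y))"
  show "differential (m + n) (m + n') ?H y v j =
      join_coords m (first_coords m v) (differential n n' F (last_coords m y) (last_coords m v)) j"
  proof (cases "j < m")
    case True
    then have "(\<lambda>y. ?H y j) = (\<lambda>y. y j)" by (simp add: join_coords_def first_coords_def)
    then have "differential (m + n) (m + n') ?H y v j = (\<Sum>i<m + n. (if i = j then 1 else 0) * v i)"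
      using True by (simp add: differential_def partial_deriv_coordinate)
    also have "\<dots> = (\<Sum>i<m + n. if i = j then v i else 0)" by (rule sum.cong) auto
    also have "\<dots> = v j" using True by simp
    finally show ?thesis using True by (simp add: join_coords_def first_coords_def)
  next
    case False
    then have H: "(\<lambda>y. ?H y j) = (\<lambda>y. F (last_coords m y) (j - m))" by (simp add: join_coords_def)
    have 1: "partial_deriv i (\<lambda>y. F (last_coords m y) (j - m)) y = 0" if "i < m" for i
      using that by (simp add: partial_deriv_def last_coords_update)
    have 2: "partial_deriv (m + i) (\<lambda>y. F (last_coords m y) (j - m)) y =
        partial_deriv i (\<lambda>x. F x (j - m)) (last_coords m y)" for i
      by (simp add: partial_deriv_def last_coords_update) (simp add: last_coords_def)
    show ?thesis
      using False 1 2 unfolding differential_def H sum_split_lessThan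
      by (auto simp: join_coords_def last_coords_def)
  qed
qed

lemma differential_cong:
  assumes "openin (Euclidean_space n) W" "y \<in> W" "\<And>x. x \<in> W \<Longrightarrow> F x = H x"
  shows "differential n m F y = differential n m H y"
proof -
  have "partial_deriv i (\<lambda>x. F x j) y = partial_deriv i (\<lambda>x. H x j) y" if "i < n" for i j
    using partial_deriv_cong(1)[OF assms(1) _ assms(2) that, of "\<lambda>x. F x j" "\<lambda>x. H x j"] assms(3) by simp
  then show ?thesis unfolding differential_def by (intro ext if_cong refl sum.cong) simp
qed

lemma inj_on_differential_join:
  assumes "inj_on (differential n n' F (last_coords m y)) (topspace (Euclidean_space n))"
  shows "inj_on (differential (m + n) (m + n') (\<lambda>y. join_coords m (first_coords m y) (F (last_coords m y))) y)
    (topspace (Euclidean_space (m + n)))"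
proof (rule inj_onI)
  fix v w assume v: "v \<in> topspace (Euclidean_space (m + n))" and w: "w \<in> topspace (Euclidean_space (m + n))"
  let ?D = "differential n n' F (last_coords m y)"
  assume "differential (m + n) (m + n') (\<lambda>y. join_coords m (first_coords m y) (F (last_coords m y))) y v =
    differential (m + n) (m + n') (\<lambda>y. join_coords m (first_coords m y) (F (last_coords m y))) y w"
  then have eq: "join_coords m (first_coords m v) (?D (last_coords m v)) =
      join_coords m (first_coords m w) (?D (last_coords m w))" by (simp only: differential_join)
  have fm: "first_coords m x \<in> topspace (Euclidean_space m)" for x
    by (simp add: mem_Euclidean_space first_coords_def)
  have "first_coords m v = first_coords m w"
    using arg_cong[OF eq, of "first_coords m"] by (simp only: first_join[OF fm])
  moreover have "?D (last_coords m v) = ?D (last_coords m w)"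
    using arg_cong[OF eq, of "last_coords m"] by (simp only: last_join)
  then have "last_coords m v = last_coords m w"
    by (rule inj_onD[OF assms]) (use v w in \<open>auto simp: mem_Euclidean_space last_coords_def\<close>)
  ultimately show "v = w" by (metis join_first_last)
qed


section \<open>The smooth structure of a twist\<close>

lemma smooth_map_from_parametrisations:
  assumes M: "smooth_manifold M" and N: "\<And>a. a \<in> I \<Longrightarrow> smooth_manifold (N a)"
    and W: "\<And>a. a \<in> I \<Longrightarrow> openin (fst M) (W a)" and cov: "topspace (fst M) \<subseteq> (\<Union>a\<in>I. W a)"
    and h: "\<And>a. a \<in> I \<Longrightarrow> diffeomorphism (N a) (open_submfd M (W a)) (h a)"
    and f: "\<And>a. a \<in> I \<Longrightarrow> smooth_map (N a) S (\<lambda>x. f (h a x))"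
  shows "smooth_map M S f"
proof (rule smooth_map_local)
  fix p assume "p \<in> topspace (fst M)"
  then obtain a where a: "a \<in> I" "p \<in> W a" using cov by blast
  let ?MW = "open_submfd M (W a)" and ?k = "inv_into (topspace (fst (N a))) (h a)"
  have MW: "smooth_manifold ?MW" by (rule smooth_manifold_open_submfd[OF M W[OF a(1)]])
  have hd: "bij_betw (h a) (topspace (fst (N a))) (topspace (fst ?MW))" and k: "smooth_map ?MW (N a) ?k"
    using h[OF a(1)] by (simp_all add: diffeomorphism_def)
  have "smooth_map ?MW S (\<lambda>x. f (h a (?k x)))"
    by (rule smooth_map_compose[OF MW N[OF a(1)] k f[OF a(1)]])
  then have "smooth_map ?MW S f"
  proof (rule smooth_map_cong[OF MW])
    fix x assume "x \<in> topspace (fst ?MW)"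
    then have "h a (?k x) = x" using hd by (intro f_inv_into_f) (simp add: bij_betw_def)
    then show "f (h a (?k x)) = f x" by simp
  qed
  then show "\<exists>U. openin (fst M) U \<and> p \<in> U \<and> smooth_map (open_submfd M U) S f"
    using W[OF a(1)] a(2) by blast
qed

context twist_sections
begin

abbreviation base :: "'g mfd" where "base \<equiv> (gtop G, A)"

text \<open>The condition to which everything is reduced: in the structure \<open>B\<close>, the maps \<open>\<psi>\<^sub>a\<close> are diffeomorphisms
  onto open submanifolds. It exhibits smoothness of a map out of \<open>E\<close> as smoothness of its compositions
  with the \<open>\<psi>\<^sub>a\<close>, so at most one \<open>B\<close> satisfies it.\<close>

definition parametrised_by :: "'e chart set \<Rightarrow> bool" where
  "parametrised_by B \<longleftrightarrow> smooth_manifold (gtop E, B) \<and>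
     (\<forall>a\<in>I. diffeomorphism (param_mfd base a) (open_submfd (gtop E, B) (V a)) (param a))"

lemma base_U: "a \<in> I \<Longrightarrow> smooth_manifold (open_submfd base (U a))"
  using mfd U_open by (intro smooth_manifold_open_submfd) auto

lemma param_mfd_smooth: "a \<in> I \<Longrightarrow> smooth_manifold (param_mfd base a)"
  by (intro smooth_manifold_prod smooth_manifold_circle base_U)

lemma topspace_param_mfd: "a \<in> I \<Longrightarrow> topspace (fst (param_mfd base a)) = circle \<times> U a"
  using U_sub[of a] by auto

lemma param_mfd_fst: "a \<in> I \<Longrightarrow> smooth_map (param_mfd base a) circle_mfd fst"
  by (intro smooth_map_fst smooth_manifold_circle base_U)

lemma param_mfd_snd: "a \<in> I \<Longrightarrow> smooth_map (param_mfd base a) (open_submfd base (U a)) snd"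
  by (intro smooth_map_snd smooth_manifold_circle base_U)

lemma smooth_map_parametrised:
  assumes B: "parametrised_by B" and f: "\<And>a. a \<in> I \<Longrightarrow> smooth_map (param_mfd base a) S (\<lambda>x. f (param a x))"
  shows "smooth_map (gtop E, B) S f"
proof (rule smooth_map_from_parametrisations[of "(gtop E, B)" I "param_mfd base" V param S f])
  show "smooth_manifold (gtop E, B)" using B by (simp add: parametrised_by_def)
  show "diffeomorphism (param_mfd base a) (open_submfd (gtop E, B) (V a)) (param a)" if "a \<in> I" for a
    using B that by (simp add: parametrised_by_def)
  show "topspace (fst (gtop E, B)) \<subseteq> (\<Union>a\<in>I. V a)" using V_cover by simp
  show "smooth_manifold (param_mfd base a)" if "a \<in> I" for a by (rule param_mfd_smooth[OF that])
  show "openin (fst (gtop E, B)) (V a)" if "a \<in> I" for a using V_open[OF that] by simp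
  show "smooth_map (param_mfd base a) S (\<lambda>x. f (param a x))" if "a \<in> I" for a by (rule f[OF that])
qed

lemma parametrised_by_param_smooth:
  assumes "parametrised_by B" "a \<in> I"
  shows "smooth_map (param_mfd base a) (gtop E, B) (param a)"
proof (rule smooth_map_from_open)
  show "smooth_map (param_mfd base a) (open_submfd (gtop E, B) (V a)) (param a)"
    using assms by (simp add: parametrised_by_def diffeomorphism_def)
qed

lemma parametrised_by_unique:
  assumes B: "parametrised_by B" and B': "parametrised_by B'"
  shows "B = B'"
proof (rule smooth_structure_eqI)
  show "smooth_manifold (gtop E, B)" "smooth_manifold (gtop E, B')"
    using B B' by (simp_all add: parametrised_by_def)
  show "smooth_map (gtop E, B) (gtop E, B') (\<lambda>x. x)"
    using parametrised_by_param_smooth[OF B'] by (intro smooth_map_parametrised[OF B]) simp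
  show "smooth_map (gtop E, B') (gtop E, B) (\<lambda>x. x)"
    using parametrised_by_param_smooth[OF B] by (intro smooth_map_parametrised[OF B']) simp
qed

lemma parametrised_by_exists: "\<exists>B. parametrised_by B"
proof -
  have G: "subtopology (gtop G) (arrows G) = gtop G" by simp
  have EE: "preim E \<pi> (arrows G) = arrows E" using pi_arrow by (auto simp: preim_def)
  have EV: "arrows E \<inter> V a = V a" for a by (auto simp: preim_def)
  obtain B where "smooth_manifold (subtopology (gtop E) (preim E \<pi> (arrows G)), B)"
    "\<And>a. a \<in> I \<Longrightarrow> diffeomorphism (param_mfd (subtopology (gtop G) (arrows G), A) a)
       (open_submfd (subtopology (gtop E) (preim E \<pi> (arrows G)), B) (preim E \<pi> (arrows G) \<inter> V a)) (param a)"
    by (rule glue_over[of "arrows G" A]) (use mfd cocycle in simp_all)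
  then show ?thesis unfolding parametrised_by_def EE EV G subtopology_topspace by blast
qed

text \<open>In the parametrisations, \<open>\<pi>\<close> is the second projection, the action is multiplication on the circle,
  \<open>\<sigma>\<^sub>a\<close> is \<open>\<gamma> \<mapsto> (1, \<gamma>)\<close>, and the inverses of the \<open>\<psi>\<^sub>a\<close> are local trivialisations.\<close>

lemma parametrised_by_imp_twist_structure:
  assumes B: "parametrised_by B"
  shows "twist_structure G A E \<iota> \<pi> I U \<sigma> B"
proof -
  let ?M = "(gtop E, B)"
  have M: "smooth_manifold ?M" using B by (simp add: parametrised_by_def)
  have D: "diffeomorphism (param_mfd base a) (open_submfd ?M (V a)) (param a)" if "a \<in> I" for a
    using B that by (simp add: parametrised_by_def)
  have MV: "smooth_manifold (open_submfd ?M (V a))" if "a \<in> I" for a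
    using V_open[OF that] by (intro smooth_manifold_open_submfd[OF M]) simp
  have topV: "topspace (fst (open_submfd ?M (V a))) = V a" if "a \<in> I" for a
    using openin_subset[OF V_open[OF that]] by (simp add: inf_absorb2)
  have V_at: "\<exists>a\<in>I. x \<in> V a" if "x \<in> arrows E" for x using that V_cover by blast
  have bij: "bij_betw (param a) (circle \<times> U a) (V a)" if "a \<in> I" for a
    using D[OF that] unfolding diffeomorphism_def topspace_param_mfd[OF that] topV[OF that] by blast
  define k where "k a = inv_into (circle \<times> U a) (param a)" for a
  have kd: "diffeomorphism (open_submfd ?M (V a)) (param_mfd base a) (k a)" if "a \<in> I" for a
    using diffeomorphism_inverse[OF param_mfd_smooth[OF that] D[OF that]]
    unfolding k_def topspace_param_mfd[OF that] .
  have ks: "smooth_map (open_submfd ?M (V a)) (param_mfd base a) (k a)" if "a \<in> I" for a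
    using kd[OF that] by (simp add: diffeomorphism_def)
  have k: "k a x = (quot x (\<sigma> a (\<pi> x)), \<pi> x)" if "a \<in> I" "x \<in> V a" for a x
    unfolding k_def using param_surj[OF that] that by (intro inv_into_f_eq param_inj) (auto simp: preim_def)
  have pi_smooth: "smooth_map ?M base \<pi>"
  proof (rule smooth_map_parametrised[OF B])
    fix a assume a: "a \<in> I"
    show "smooth_map (param_mfd base a) base (\<lambda>p. \<pi> (param a p))"
    proof (rule smooth_map_cong[OF param_mfd_smooth[OF a]])
      show "smooth_map (param_mfd base a) base snd"
        by (rule smooth_map_from_open[OF param_mfd_snd[OF a]])
      show "snd p = \<pi> (param a p)" if "p \<in> topspace (fst (param_mfd base a))" for p
        using that param_props(2)[OF a] unfolding topspace_param_mfd[OF a] by auto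
    qed
  qed
  have act_smooth: "smooth_map (prod_mfd circle_mfd ?M) ?M (\<lambda>(z, x). act z x)"
  proof (rule smooth_map_local)
    let ?C = "prod_mfd circle_mfd ?M"
    have C: "smooth_manifold ?C" by (rule smooth_manifold_prod[OF smooth_manifold_circle M])
    fix p assume p: "p \<in> topspace (fst ?C)"
    then have "snd p \<in> arrows E" by auto
    then obtain a where a: "a \<in> I" "snd p \<in> V a" using V_at by blast
    let ?O = "circle \<times> V a"
    let ?Q = "open_submfd ?C ?O"
    have O: "openin (fst ?C) ?O" using V_open[OF a(1)] by (simp add: openin_prod_Times_iff)
    have Q: "smooth_manifold ?Q" by (rule smooth_manifold_open_submfd[OF C O])
    have topQ: "topspace (fst ?Q) = ?O" using openin_subset[OF O] by (simp add: inf_absorb2)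
    have f: "smooth_map ?Q circle_mfd fst"
      by (rule smooth_map_restrict[OF C O smooth_map_fst[OF smooth_manifold_circle M]])
    have sq: "smooth_map ?Q ?M snd"
      by (rule smooth_map_restrict[OF C O smooth_map_snd[OF smooth_manifold_circle M]])
    have "smooth_map ?Q (open_submfd ?M (V a)) snd"
    proof (rule smooth_map_into_open[OF Q M _ sq])
      show "openin (fst ?M) (V a)" using V_open[OF a(1)] by simp
      show "snd q \<in> V a" if "q \<in> topspace (fst ?Q)" for q using that unfolding topQ by auto
    qed
    then have kq: "smooth_map ?Q (param_mfd base a) (\<lambda>q. k a (snd q))"
      by (rule smooth_map_compose[OF Q MV[OF a(1)] _ ks[OF a(1)]])
    have "smooth_map ?Q (param_mfd base a) (\<lambda>q. (fst q * fst (k a (snd q)), snd (k a (snd q))))"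
      by (intro smooth_map_pair[OF Q smooth_manifold_circle base_U[OF a(1)]] smooth_map_mult[OF Q f]
          smooth_map_compose[OF Q param_mfd_smooth[OF a(1)] kq] param_mfd_fst param_mfd_snd a(1))
    then have "smooth_map ?Q ?M (\<lambda>q. param a (fst q * fst (k a (snd q)), snd (k a (snd q))))"
      by (rule smooth_map_compose[OF Q param_mfd_smooth[OF a(1)] _ parametrised_by_param_smooth[OF B a(1)]])
    then have "smooth_map ?Q ?M (\<lambda>(z, x). act z x)"
    proof (rule smooth_map_cong[OF Q])
      fix q assume "q \<in> topspace (fst ?Q)"
      then obtain z x where q: "q = (z, x)" "z \<in> circle" "x \<in> V a" unfolding topQ by blast
      then have x: "x \<in> arrows E" "\<pi> x \<in> U a" by (auto simp: preim_def)
      note s = param_surj[OF a(1) q(3)]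
      have "param a (z * quot x (\<sigma> a (\<pi> x)), \<pi> x) = act z (param a (quot x (\<sigma> a (\<pi> x)), \<pi> x))"
        using act_act[OF sec_arrow[OF a(1) x(2)] q(2) s(1)] by (simp add: param_def)
      then show "param a (fst q * fst (k a (snd q)), snd (k a (snd q))) = (\<lambda>(z, x). act z x) q"
        using q k[OF a(1) q(3)] s(2) by simp
    qed
    then show "\<exists>U. openin (fst ?C) U \<and> p \<in> U \<and> smooth_map (open_submfd ?C U) ?M (\<lambda>(z, x). act z x)"
      using O p a(2) by (intro exI[of _ ?O]) auto
  qed
  have triv: "\<exists>W. openin (fst base) W \<and> m \<in> W \<and> (\<exists>\<Phi>. local_trivialization ?M base \<pi> act W \<Phi>)"
    if m: "m \<in> topspace (fst base)" for m
  proof -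
    obtain a where a: "a \<in> I" "m \<in> U a" using m U_cover by auto
    have Va: "{x \<in> topspace (fst ?M). \<pi> x \<in> U a} = V a" by (simp add: preim_def)
    have "local_trivialization ?M base \<pi> act (U a) (k a)"
      unfolding local_trivialization_def Let_def Va
    proof (intro conjI ballI)
      show "diffeomorphism (open_submfd ?M (V a)) (param_mfd base a) (k a)" by (rule kd[OF a(1)])
      show "snd (k a x) = \<pi> x" if "x \<in> V a" for x using k[OF a(1) that] by simp
      show "k a (act z x) = (z * fst (k a x), snd (k a x))" if "z \<in> circle" "x \<in> V a" for z x
      proof -
        have x: "x \<in> arrows E" "\<pi> x \<in> U a" using that(2) by (auto simp: preim_def)
        have zx: "act z x \<in> V a" using act_arrow[OF x(1) that(1)] x(2) by (simp add: preim_def)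
        note s = param_surj[OF a(1) that(2)] and y = sec_arrow[OF a(1) x(2)]
        have "act z x = act (z * quot x (\<sigma> a (\<pi> x))) (\<sigma> a (\<pi> x))"
          using act_act[OF y that(1) s(1)] s(2) by (simp add: param_def)
        moreover have "z * quot x (\<sigma> a (\<pi> x)) \<in> circle" using that(1) s(1) by (simp add: norm_mult)
        ultimately have "quot (act z x) (\<sigma> a (\<pi> x)) = z * quot x (\<sigma> a (\<pi> x))"
          using quot_act[OF y] by simp
        then show ?thesis using k[OF a(1) zx] k[OF a(1) that(2)] act_arrow(3)[OF x(1) that(1)] by simp
      qed
    qed
    then show ?thesis using U_open[OF a(1)] a(2) by auto
  qed
  have fibre: "\<exists>!z. z \<in> circle \<and> act z x = y" if "x \<in> arrows E" "y \<in> arrows E" "\<pi> x = \<pi> y" for x y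
    using act_quot[OF that(2,1)] that quot_act[OF that(1)] by (intro ex1I[of _ "quot y x"]) auto
  have "smooth_principal_circle_bundle ?M base \<pi> act"
    unfolding smooth_principal_circle_bundle_def
    using M mfd pi_smooth act_smooth act_one act_act act_arrow(3) fibre triv by auto
  moreover have "smooth_map (open_submfd base (U a)) ?M (\<sigma> a)" if a: "a \<in> I" for a
  proof -
    have "smooth_map (open_submfd base (U a)) (param_mfd base a) (\<lambda>\<gamma>. (1, \<gamma>))"
      by (intro smooth_map_pair base_U[OF a] smooth_manifold_circle smooth_map_id smooth_map_const) simp
    then have "smooth_map (open_submfd base (U a)) ?M (\<lambda>\<gamma>. param a (1, \<gamma>))"
      by (rule smooth_map_compose[OF base_U[OF a] param_mfd_smooth[OF a] _ parametrised_by_param_smooth[OF B a]])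
    then show ?thesis
      by (rule smooth_map_cong[OF base_U[OF a]]) (use sec_arrow[OF a] act_one in \<open>auto simp: param_def\<close>)
  qed
  ultimately show ?thesis using M by (simp add: twist_structure_def)
qed

text \<open>Smoothness of \<open>\<psi>\<^sub>a\<close> is that of the action and of \<open>\<sigma>\<^sub>a\<close>. For the inverse, use a local trivialisation
  \<open>\<Phi>\<close> with first component \<open>\<Phi>\<^sub>1\<close>: from \<open>x = z \<cdot> \<sigma>\<^sub>a(\<pi>(x))\<close> and equivariance, \<open>z = \<Phi>\<^sub>1(x) / \<Phi>\<^sub>1(\<sigma>\<^sub>a(\<pi>(x)))\<close>.\<close>

lemma twist_structure_imp_parametrised_by:
  assumes B: "twist_structure G A E \<iota> \<pi> I U \<sigma> B"
  shows "parametrised_by B"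
proof -
  let ?M = "(gtop E, B)"
  have M: "smooth_manifold ?M" and P: "smooth_principal_circle_bundle ?M base \<pi> act"
    and sec: "\<And>a. a \<in> I \<Longrightarrow> smooth_map (open_submfd base (U a)) ?M (\<sigma> a)"
    using B by (simp_all add: twist_structure_def)
  have pi_smooth: "smooth_map ?M base \<pi>" and act_smooth: "smooth_map (prod_mfd circle_mfd ?M) ?M (\<lambda>(z, x). act z x)"
    and triv: "\<And>m. m \<in> topspace (fst base) \<Longrightarrow>
      \<exists>W. openin (fst base) W \<and> m \<in> W \<and> (\<exists>\<Phi>. local_trivialization ?M base \<pi> act W \<Phi>)"
    using P unfolding smooth_principal_circle_bundle_def by blast+
  have "diffeomorphism (param_mfd base a) (open_submfd ?M (V a)) (param a)" if a: "a \<in> I" for a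
    unfolding diffeomorphism_def topspace_param_mfd[OF a]
  proof (intro conjI)
    let ?MV = "open_submfd ?M (V a)"
    have V: "openin (fst ?M) (V a)" using V_open[OF a] by simp
    have MV: "smooth_manifold ?MV" by (rule smooth_manifold_open_submfd[OF M V])
    have topV: "topspace (fst ?MV) = V a" using openin_subset[OF V] by (simp add: inf_absorb2)
    show bij: "bij_betw (param a) (circle \<times> U a) (topspace (fst ?MV))"
      unfolding topV
    proof (rule bij_betwI')
      show "param a p = param a q \<longleftrightarrow> p = q" if "p \<in> circle \<times> U a" "q \<in> circle \<times> U a" for p q
        using inj_onD[OF param_inj[OF a]] that by blast
      show "param a p \<in> V a" if "p \<in> circle \<times> U a" for p
        using that param_props[OF a] by (auto simp: preim_def)
      show "\<exists>p\<in>circle \<times> U a. x = param a p" if "x \<in> V a" for x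
        using param_surj[OF a that] that by (intro bexI[of _ "(quot x (\<sigma> a (\<pi> x)), \<pi> x)"]) (auto simp: preim_def)
    qed
    have "smooth_map (param_mfd base a) (prod_mfd circle_mfd ?M) (\<lambda>p. (fst p, \<sigma> a (snd p)))"
      by (intro smooth_map_pair[OF param_mfd_smooth[OF a] smooth_manifold_circle M] param_mfd_fst[OF a]
          smooth_map_compose[OF param_mfd_smooth[OF a] base_U[OF a] param_mfd_snd[OF a] sec[OF a]])
    then have "smooth_map (param_mfd base a) ?M (\<lambda>p. (\<lambda>(z, x). act z x) (fst p, \<sigma> a (snd p)))"
      by (rule smooth_map_compose[OF param_mfd_smooth[OF a] smooth_manifold_prod[OF smooth_manifold_circle M] _ act_smooth])
    then have "smooth_map (param_mfd base a) ?M (param a)"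
      by (simp add: param_def case_prod_unfold)
    then show "smooth_map (param_mfd base a) ?MV (param a)"
      by (rule smooth_map_into_open[OF param_mfd_smooth[OF a] M V])
        (use param_props[OF a] topspace_param_mfd[OF a] in \<open>auto simp: preim_def\<close>)
    let ?k = "inv_into (circle \<times> U a) (param a)"
    have k: "?k x = (quot x (\<sigma> a (\<pi> x)), \<pi> x)" if "x \<in> V a" for x
      using param_surj[OF a that] that by (intro inv_into_f_eq param_inj[OF a]) (auto simp: preim_def)
    show "smooth_map ?MV (param_mfd base a) ?k"
    proof (rule smooth_map_local)
      fix x0 assume "x0 \<in> topspace (fst ?MV)"
      then have x0: "x0 \<in> arrows E" "\<pi> x0 \<in> U a" unfolding topV by (auto simp: preim_def)
      then have "\<pi> x0 \<in> topspace (fst base)" using pi_arrow by simp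
      from triv[OF this] obtain W \<Phi> where W: "openin (fst base) W" "\<pi> x0 \<in> W"
        and \<Phi>: "local_trivialization ?M base \<pi> act W \<Phi>" by blast
      let ?PW = "preim E \<pi> W"
      have PW: "{x \<in> topspace (fst ?M). \<pi> x \<in> W} = ?PW" by (simp add: preim_def)
      have oPW: "openin (fst ?M) ?PW" using openin_preim W(1) by simp
      have BW: "smooth_manifold (open_submfd base W)" by (rule smooth_manifold_open_submfd[OF mfd W(1)])
      have \<Phi>s: "smooth_map (open_submfd ?M ?PW) (prod_mfd circle_mfd (open_submfd base W)) \<Phi>"
        and \<Phi>act: "\<And>z x. z \<in> circle \<Longrightarrow> x \<in> ?PW \<Longrightarrow> fst (\<Phi> (act z x)) = z * fst (\<Phi> x)"
        using \<Phi> unfolding local_trivialization_def Let_def PW diffeomorphism_def by simp_all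
      have MPW: "smooth_manifold (open_submfd ?M ?PW)" by (rule smooth_manifold_open_submfd[OF M oPW])
      have \<Phi>1: "smooth_map (open_submfd ?M ?PW) circle_mfd (\<lambda>x. fst (\<Phi> x))"
        by (rule smooth_map_compose[OF MPW smooth_manifold_prod[OF smooth_manifold_circle BW] \<Phi>s
              smooth_map_fst[OF smooth_manifold_circle BW]])
      let ?O = "V a \<inter> ?PW"
      let ?Q = "open_submfd ?M ?O"
      have O: "openin (fst ?M) ?O" using V oPW by blast
      have Q: "smooth_manifold ?Q" by (rule smooth_manifold_open_submfd[OF M O])
      have topQ: "topspace (fst ?Q) = ?O" using openin_subset[OF O] by (simp add: inf_absorb2)
      have i: "smooth_map ?Q (open_submfd ?M ?PW) (\<lambda>x. x)"
        by (rule smooth_map_into_open[OF Q M oPW smooth_map_restrict[OF M O smooth_map_id[OF M]]])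
          (use topQ in blast)
      have piQ: "smooth_map ?Q (open_submfd base (U a)) \<pi>"
        by (rule smooth_map_into_open[OF Q mfd _ smooth_map_restrict[OF M O pi_smooth]])
          (use U_open[OF a] topQ in \<open>auto simp: preim_def\<close>)
      have "smooth_map ?Q ?M (\<lambda>x. \<sigma> a (\<pi> x))"
        by (rule smooth_map_compose[OF Q base_U[OF a] piQ sec[OF a]])
      then have sQ: "smooth_map ?Q (open_submfd ?M ?PW) (\<lambda>x. \<sigma> a (\<pi> x))"
      proof (rule smooth_map_into_open[OF Q M oPW])
        fix x assume "x \<in> topspace (fst ?Q)"
        then have "\<pi> x \<in> U a" "\<pi> x \<in> W" unfolding topQ by (auto simp: preim_def)
        then show "\<sigma> a (\<pi> x) \<in> ?PW" using sec_arrow[OF a] pi_sec[OF a] by (simp add: preim_def)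
      qed
      have "smooth_map ?Q (param_mfd base a) (\<lambda>x. (fst (\<Phi> x) * inverse (fst (\<Phi> (\<sigma> a (\<pi> x)))), \<pi> x))"
        by (intro smooth_map_pair[OF Q smooth_manifold_circle base_U[OF a] _ piQ] smooth_map_mult[OF Q]
            smooth_map_inverse[OF Q] smooth_map_compose[OF Q MPW i \<Phi>1] smooth_map_compose[OF Q MPW sQ \<Phi>1])
      then have "smooth_map ?Q (param_mfd base a) ?k"
      proof (rule smooth_map_cong[OF Q])
        fix x assume "x \<in> topspace (fst ?Q)"
        then have x: "x \<in> V a" "x \<in> arrows E" "\<pi> x \<in> U a" "\<pi> x \<in> W"
          unfolding topQ by (auto simp: preim_def)
        have s: "\<sigma> a (\<pi> x) \<in> ?PW" using sec_arrow[OF a x(3)] pi_sec[OF a x(3)] x(4) by (simp add: preim_def)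
        then have "fst (\<Phi> (\<sigma> a (\<pi> x))) \<in> circle"
          using smooth_map_funcset[OF \<Phi>1, of "\<sigma> a (\<pi> x)"] openin_subset[OF oPW] by auto
        then have nz: "fst (\<Phi> (\<sigma> a (\<pi> x))) \<noteq> 0" by auto
        have "fst (\<Phi> x) = quot x (\<sigma> a (\<pi> x)) * fst (\<Phi> (\<sigma> a (\<pi> x)))"
          using \<Phi>act[OF param_surj(1)[OF a x(1)] s] param_surj(2)[OF a x(1)] by (simp add: param_def)
        then show "(fst (\<Phi> x) * inverse (fst (\<Phi> (\<sigma> a (\<pi> x)))), \<pi> x) = ?k x"
          using nz k[OF x(1)] by simp
      qed
      moreover have "?Q = open_submfd ?MV ?O" by (simp add: open_submfd_open_submfd)
      moreover have "openin (fst ?MV) ?O" using O V by (simp add: openin_open_subtopology)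
      moreover have "x0 \<in> ?O" using x0 W(2) by (simp add: preim_def)
      ultimately show "\<exists>U'. openin (fst ?MV) U' \<and> x0 \<in> U' \<and> smooth_map (open_submfd ?MV U') (param_mfd base a) ?k"
        by (intro exI[of _ ?O] conjI) (simp only:)+
    qed
  qed
  then show ?thesis using M by (simp add: parametrised_by_def)
qed

lemma twist_structure_iff: "twist_structure G A E \<iota> \<pi> I U \<sigma> B \<longleftrightarrow> parametrised_by B"
  using parametrised_by_imp_twist_structure twist_structure_imp_parametrised_by by blast

lemma ex1_twist_structure: "\<exists>!B. twist_structure G A E \<iota> \<pi> I U \<sigma> B"
  unfolding twist_structure_iff using parametrised_by_exists parametrised_by_unique by blast

text \<open>Equivariance gives \<open>f(\<psi>\<^sub>a(z, \<gamma>)) = z \<cdot> f(\<sigma>\<^sub>a(\<gamma>))\<close>, which is smooth as soon as \<open>f \<circ> \<sigma>\<^sub>a\<close> is.\<close>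

lemma smooth_map_iff_smooth_on_sections:
  assumes B: "twist_structure G A E \<iota> \<pi> I U \<sigma> B"
    and S: "smooth_principal_circle_bundle S base p actS"
    and eq: "\<And>z e. z \<in> circle \<Longrightarrow> e \<in> arrows E \<Longrightarrow> f (act z e) = actS z (f e)"
  shows "smooth_map (gtop E, B) S f \<longleftrightarrow> (\<forall>a\<in>I. smooth_map (open_submfd base (U a)) S (\<lambda>\<gamma>. f (\<sigma> a \<gamma>)))"
proof
  assume f: "smooth_map (gtop E, B) S f"
  have M: "smooth_manifold (gtop E, B)" and sec: "\<And>a. a \<in> I \<Longrightarrow> smooth_map (open_submfd base (U a)) (gtop E, B) (\<sigma> a)"
    using B by (simp_all add: twist_structure_def)
  show "\<forall>a\<in>I. smooth_map (open_submfd base (U a)) S (\<lambda>\<gamma>. f (\<sigma> a \<gamma>))"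
    using smooth_map_compose[OF base_U M sec f] by blast
next
  assume f: "\<forall>a\<in>I. smooth_map (open_submfd base (U a)) S (\<lambda>\<gamma>. f (\<sigma> a \<gamma>))"
  have SM: "smooth_manifold S" and aS: "smooth_map (prod_mfd circle_mfd S) S (\<lambda>(z, x). actS z x)"
    using S by (simp_all add: smooth_principal_circle_bundle_def)
  show "smooth_map (gtop E, B) S f"
  proof (rule smooth_map_parametrised[OF twist_structure_imp_parametrised_by[OF B]])
    fix a assume a: "a \<in> I"
    have "smooth_map (param_mfd base a) (prod_mfd circle_mfd S) (\<lambda>p. (fst p, f (\<sigma> a (snd p))))"
      by (intro smooth_map_pair[OF param_mfd_smooth[OF a] smooth_manifold_circle SM] param_mfd_fst[OF a]
          smooth_map_compose[OF param_mfd_smooth[OF a] base_U[OF a] param_mfd_snd[OF a] bspec[OF f a]])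
    then have "smooth_map (param_mfd base a) S (\<lambda>p. (\<lambda>(z, x). actS z x) (fst p, f (\<sigma> a (snd p))))"
      by (rule smooth_map_compose[OF param_mfd_smooth[OF a] smooth_manifold_prod[OF smooth_manifold_circle SM] _ aS])
    then show "smooth_map (param_mfd base a) S (\<lambda>p. f (param a p))"
      by (rule smooth_map_cong[OF param_mfd_smooth[OF a]])
        (use eq sec_arrow[OF a] topspace_param_mfd[OF a] in \<open>auto simp: param_def\<close>)
  qed
qed

end

context twist_sections
begin

text \<open>Over a submanifold \<open>S\<close> of \<open>G\<close>, the parametrisations of \<open>E\<close> restrict to parametrisations of its
  preimage, and in these the inclusion is the product of the identity of the circle with the inclusion
  of \<open>S\<close>. For the unit space, \<open>\<iota>\<close> could not be used instead: the units form a continuous section of \<open>E\<close>,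
  but this section need not be smooth.\<close>

lemma preim_embedded_submanifold:
  assumes B: "parametrised_by B" and S: "embedded_structure base S AS"
  shows "embedded_submanifold (gtop E, B) (preim E \<pi> S)"
proof -
  let ?N = "(subtopology (gtop G) S, AS)" and ?M = "(gtop E, B)" and ?T = "preim E \<pi> S"
  have M: "smooth_manifold ?M"
    and D: "\<And>a. a \<in> I \<Longrightarrow> diffeomorphism (param_mfd base a) (open_submfd ?M (V a)) (param a)"
    using B by (simp_all add: parametrised_by_def)
  have SG: "S \<subseteq> arrows G" and N: "smooth_manifold ?N" and imm: "immersion ?N base (\<lambda>x. x)"
    using S by (simp_all add: embedded_structure_def smooth_embedding_def)
  then have incl: "smooth_map ?N base (\<lambda>x. x)" by (simp add: immersion_def)
  have sub: "smooth_manifold (open_submfd ?N W) \<and> smooth_map (open_submfd ?N W) (open_submfd base W) (\<lambda>x. x)"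
    if W: "openin (gtop G) W" for W
  proof -
    have o: "openin (fst ?N) (topspace (fst ?N) \<inter> W)" using W by (auto simp: openin_subtopology)
    note eq = open_submfd_Int_topspace[OF N, of W]
    have NW: "smooth_manifold (open_submfd ?N W)" unfolding eq by (rule smooth_manifold_open_submfd[OF N o])
    have i: "smooth_map (open_submfd ?N W) base (\<lambda>x. x)" unfolding eq by (rule smooth_map_restrict[OF N o incl])
    have "smooth_map (open_submfd ?N W) (open_submfd base W) (\<lambda>x. x)"
      by (rule smooth_map_into_open[OF NW mfd _ i]) (use W in auto)
    with NW show ?thesis ..
  qed
  have NU: "smooth_manifold (open_submfd ?N (U a))"
    and inclU: "smooth_map (open_submfd ?N (U a)) (open_submfd base (U a)) (\<lambda>x. x)" if "a \<in> I" for a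
    using sub[OF U_open[OF that]] by simp_all
  have P: "smooth_manifold (param_mfd ?N a)" if "a \<in> I" for a
    by (rule smooth_manifold_prod[OF smooth_manifold_circle NU[OF that]])
  obtain B0 where M0': "smooth_manifold (subtopology (gtop E) ?T, B0)"
    and D0': "\<And>a. a \<in> I \<Longrightarrow> diffeomorphism (param_mfd ?N a)
       (open_submfd (subtopology (gtop E) ?T, B0) (?T \<inter> V a)) (param a)"
  proof (rule glue_over[OF SG N])
    fix a b assume ab: "a \<in> I" "b \<in> I"
    have o: "openin (gtop G) (U a \<inter> U b)" using U_open ab by blast
    show "smooth_map (open_submfd ?N (U a \<inter> U b)) circle_mfd (\<lambda>\<gamma>. quot (\<sigma> a \<gamma>) (\<sigma> b \<gamma>))"
      using smooth_map_compose[OF _ _ _ cocycle[OF ab], of "open_submfd ?N (U a \<inter> U b)" "\<lambda>x. x"]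
        sub[OF o] smooth_manifold_open_submfd[OF mfd, of "U a \<inter> U b"] o by simp
  qed blast
  let ?MT = "(subtopology (gtop E) ?T, B0)"
  note M0 = M0' and D0 = D0'
  have oV: "openin (fst ?MT) (?T \<inter> V a)" if "a \<in> I" for a
    using V_open[OF that] by (auto simp: openin_subtopology)
  have top0: "topspace (fst ?MT) = ?T" by (auto simp: preim_def)
  have param_smooth: "smooth_map (param_mfd ?N a) ?M (param a)" if a: "a \<in> I" for a
  proof -
    have "smooth_map (param_mfd ?N a) (param_mfd base a) (\<lambda>p. (fst p, snd p))"
      by (intro smooth_map_pair[OF P[OF a] smooth_manifold_circle base_U[OF a]]
          smooth_map_fst[OF smooth_manifold_circle NU[OF a]]
          smooth_map_compose[OF P[OF a] NU[OF a] smooth_map_snd[OF smooth_manifold_circle NU[OF a]] inclU[OF a]])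
    from smooth_map_compose[OF P[OF a] param_mfd_smooth[OF a] this parametrised_by_param_smooth[OF B a]]
    show ?thesis by simp
  qed
  have smooth: "smooth_map ?MT ?M (\<lambda>x. x)"
  proof (rule smooth_map_from_parametrisations[of ?MT I "param_mfd ?N" "\<lambda>a. ?T \<inter> V a" param ?M "\<lambda>x. x"])
    show "smooth_manifold ?MT" by (rule M0)
    show "topspace (fst ?MT) \<subseteq> (\<Union>a\<in>I. ?T \<inter> V a)" unfolding top0 using V_cover by (auto simp: preim_def)
    show "smooth_manifold (param_mfd ?N a)" if "a \<in> I" for a by (rule P[OF that])
    show "openin (fst ?MT) (?T \<inter> V a)" if "a \<in> I" for a by (rule oV[OF that])
    show "diffeomorphism (param_mfd ?N a) (open_submfd ?MT (?T \<inter> V a)) (param a)" if "a \<in> I" for a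
      by (rule D0[OF that])
    show "smooth_map (param_mfd ?N a) ?M (\<lambda>x. param a x)" if "a \<in> I" for a by (rule param_smooth[OF that])
  qed
  have "immersion ?MT ?M (\<lambda>x. x)"
    unfolding immersion_def
  proof (intro conjI ballI)
    show "smooth_map ?MT ?M (\<lambda>x. x)" by (rule smooth)
    fix x assume "x \<in> topspace (fst ?MT)"
    then have x: "x \<in> arrows E" "\<pi> x \<in> S" by (auto simp: preim_def)
    then obtain a where a: "a \<in> I" "x \<in> V a" using V_cover by blast
    define z u where "z = quot x (\<sigma> a (\<pi> x))" and "u = \<pi> x"
    have zu: "z \<in> circle" "u \<in> S" "u \<in> U a" "param a (z, u) = x"
      using param_surj[OF a] x(2) a(2) by (auto simp: z_def u_def preim_def)
    have uG: "u \<in> arrows G" using U_sub[OF a(1)] zu(3) by blast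
    have "u \<in> topspace (fst ?N)" using zu(2) uG by simp
    then obtain c d where cd: "c \<in> snd ?N" "d \<in> snd base" "u \<in> chart_dom c" "chart_dom c \<subseteq> chart_dom d"
      and inj: "inj_on (differential (chart_dim c) (chart_dim d) (coord_rep c d (\<lambda>x. x)) (chart_map c u))
        (topspace (Euclidean_space (chart_dim c)))"
      using imm unfolding immersion_def adapted_charts_def by (metis image_ident)
    have cc: "chart_of (fst ?N) c" by (rule smooth_manifold_chart_of[OF N cd(1)])
    have cS: "chart_dom c \<subseteq> S" using chart_of_subset[OF cc] by simp
    have oN: "openin (fst ?N) (S \<inter> U a)" using U_open[OF a(1)] by (auto simp: openin_subtopology)
    \<comment> \<open>Shrunk to \<open>U a\<close>, the charts that witness the immersion below can be multiplied by a chart of the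
      circle and transported to \<open>E\<close>.\<close>
    define c' where "c' = (chart_dim c, chart_dom c \<inter> (S \<inter> U a), chart_map c)"
    define d' where "d' = (chart_dim d, chart_dom d \<inter> U a, chart_map d)"
    have c': "c' \<in> snd (open_submfd ?N (U a))"
      using smooth_manifold_restrict_chart[OF N cd(1) oN] by (simp add: c'_def inf.coboundedI2)
    have d': "d' \<in> snd (open_submfd base (U a))"
      using smooth_manifold_restrict_chart[OF mfd cd(2)] U_open[OF a(1)] by (simp add: d'_def)
    from smooth_manifold_chart_at[OF smooth_manifold_circle, of z] zu(1) obtain k
      where k: "k \<in> snd circle_mfd" "z \<in> chart_dom k" by auto
    let ?pc = "prod_chart k c'" and ?pd = "prod_chart k d'"
    have C0: "?pc \<in> snd (param_mfd ?N a)"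
      by (rule prod_chart_mem[OF smooth_manifold_circle NU[OF a(1)] k(1) c'])
    have D0m: "?pd \<in> snd (param_mfd base a)"
      by (rule prod_chart_mem[OF smooth_manifold_circle base_U[OF a(1)] k(1) d'])
    let ?C = "push_chart (fst (param_mfd ?N a)) (param a) ?pc"
    let ?D = "push_chart (fst (param_mfd base a)) (param a) ?pd"
    have C: "?C \<in> snd ?MT" by (rule push_chart_mem[OF P[OF a(1)] M0 oV[OF a(1)] D0[OF a(1)] C0])
    have Dm: "?D \<in> snd ?M"
      using push_chart_mem[OF param_mfd_smooth[OF a(1)] M _ D[OF a(1)] D0m] V_open[OF a(1)] by simp
    have kc: "chart_of (fst circle_mfd) k" by (rule smooth_manifold_chart_of[OF smooth_manifold_circle k(1)])
    have ks: "chart_dom k \<subseteq> circle" using chart_of_subset[OF kc] by simp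
    have inj0: "inj_on (param a) (topspace (fst (param_mfd ?N a)))"
      by (rule inj_on_subset[OF param_inj[OF a(1)]]) auto
    have inj1: "inj_on (param a) (topspace (fst (param_mfd base a)))"
      unfolding topspace_param_mfd[OF a(1)] by (rule param_inj[OF a(1)])
    have mapC: "chart_map ?C (param a (w, v)) = join_coords (chart_dim k) (chart_map k w) (chart_map c v)"
      and mapD: "chart_map ?D (param a (w, v)) = join_coords (chart_dim k) (chart_map k w) (chart_map d v)"
      if "w \<in> chart_dom k" "v \<in> chart_dom c" "v \<in> U a" for w v
    proof -
      have "w \<in> circle" "v \<in> S" "v \<in> arrows G" using that ks cS SG by blast+
      then have "(w, v) \<in> topspace (fst (param_mfd ?N a))" "(w, v) \<in> topspace (fst (param_mfd base a))"
        using that(3) by simp_all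
      then show "chart_map ?C (param a (w, v)) = join_coords (chart_dim k) (chart_map k w) (chart_map c v)"
        "chart_map ?D (param a (w, v)) = join_coords (chart_dim k) (chart_map k w) (chart_map d v)"
        using chart_map_push[OF inj0, of "(w, v)" ?pc] chart_map_push[OF inj1, of "(w, v)" ?pd]
        by (simp_all add: c'_def d'_def)
    qed
    have domC: "chart_dom ?C = param a ` (chart_dom k \<times> (chart_dom c \<inter> (S \<inter> U a)))" by (simp add: c'_def)
    have xC: "x \<in> chart_dom ?C"
      unfolding domC using k(2) cd(3) zu by (intro image_eqI[of _ _ "(z, u)"]) auto
    have Csub: "chart_dom ?C \<subseteq> chart_dom ?D"
      unfolding push_chart_simps prod_chart_simps
      by (intro image_mono Sigma_mono) (use cd(4) in \<open>auto simp: c'_def d'_def\<close>)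
    have Cc: "chart_of (fst ?MT) ?C" by (rule smooth_manifold_chart_of[OF M0 C])
    let ?F = "coord_rep c d (\<lambda>x. x)"
    let ?J = "\<lambda>y. join_coords (chart_dim k) (first_coords (chart_dim k) y) (?F (last_coords (chart_dim k) y))"
    have rep: "coord_rep ?C ?D (\<lambda>x. x) y = ?J y" if y: "y \<in> chart_map ?C ` chart_dom ?C" for y
    proof -
      from y obtain q where q: "q \<in> chart_dom ?C" "y = chart_map ?C q" by (elim imageE)
      from q(1) obtain w v where wv: "q = param a (w, v)" "w \<in> chart_dom k" "v \<in> chart_dom c" "v \<in> U a"
        unfolding domC by blast
      have "coord_rep ?C ?D (\<lambda>x. x) y = chart_map ?D q"
        unfolding q(2) by (rule coord_rep_eq[OF Cc q(1)])
      also have "\<dots> = join_coords (chart_dim k) (chart_map k w) (chart_map d v)"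
        unfolding wv(1) by (rule mapD[OF wv(2-4)])
      also have "\<dots> = ?J y"
        unfolding q(2) wv(1) mapC[OF wv(2-4)] first_join[OF chart_map_mem_Euclidean_space[OF kc wv(2)]] last_join
        by (simp add: coord_rep_eq[OF cc wv(3)])
      finally show ?thesis .
    qed
    have xu: "last_coords (chart_dim k) (chart_map ?C x) = chart_map c u"
      using mapC[OF k(2) cd(3) zu(3)] unfolding zu(4) by (simp only: last_join)
    have dims: "chart_dim ?C = chart_dim k + chart_dim c" "chart_dim ?D = chart_dim k + chart_dim d"
      by (simp_all add: c'_def d'_def)
    have "inj_on (differential (chart_dim ?C) (chart_dim ?D) ?J (chart_map ?C x))
        (topspace (Euclidean_space (chart_dim ?C)))"
      unfolding dims by (rule inj_on_differential_join) (simp only: xu inj)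
    moreover have "differential (chart_dim ?C) (chart_dim ?D) (coord_rep ?C ?D (\<lambda>x. x)) (chart_map ?C x)
        = differential (chart_dim ?C) (chart_dim ?D) ?J (chart_map ?C x)"
      by (rule differential_cong[OF chart_of_open_image[OF Cc chart_of_openin[OF Cc] subset_refl] imageI[OF xC] rep])
    moreover have "adapted_charts ?MT ?M (\<lambda>x. x) x ?C ?D"
      unfolding adapted_charts_def using C Dm xC Csub by (simp only: image_ident simp_thms)
    ultimately show "\<exists>c d. adapted_charts ?MT ?M (\<lambda>x. x) x c d \<and>
        inj_on (differential (chart_dim c) (chart_dim d) (coord_rep c d (\<lambda>x. x)) (chart_map c x))
          (topspace (Euclidean_space (chart_dim c)))"
      by (intro exI[of _ ?C] exI[of _ ?D] conjI) (simp_all only:)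
  qed
  moreover have "embedding_map (subtopology (gtop E) ?T) (gtop E) (\<lambda>x. x)"
    unfolding embedding_map_def by (simp add: subtopology_restrict homeomorphic_map_id[unfolded id_def])
  moreover have "?T \<subseteq> topspace (fst ?M)" by (auto simp: preim_def)
  ultimately have "embedded_structure ?M ?T B0"
    using M0 by (simp add: embedded_structure_def smooth_embedding_def)
  then show ?thesis unfolding embedded_submanifold_def by blast
qed

end

theorem theorem4p15:
  fixes G :: "'g groupoid" and A A0 :: "'g chart set"
    and E :: "'e groupoid" and \<iota> :: "complex \<times> 'g \<Rightarrow> 'e" and \<pi> :: "'e \<Rightarrow> 'g"
    and I :: "'i set" and n :: "'i \<Rightarrow> nat" and U :: "'i \<Rightarrow> 'g set"
    and \<phi> :: "'i \<Rightarrow> 'g \<Rightarrow> nat \<Rightarrow> real" and \<sigma> :: "'i \<Rightarrow> 'g \<Rightarrow> 'e"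
  assumes lie: "lie_groupoid G A A0"
    and twist: "topological_twist G E \<iota> \<pi>"
    and atlas: "smooth_atlas (gtop G) ((\<lambda>a. (n a, U a, \<phi> a)) ` I)"
      "(\<lambda>a. (n a, U a, \<phi> a)) ` I \<subseteq> A"
    and sections: "\<And>a. a \<in> I \<Longrightarrow>
        continuous_map (subtopology (gtop G) (U a)) (subtopology (gtop E) (preim E \<pi> (U a))) (\<sigma> a)"
      "\<And>a \<gamma>. a \<in> I \<Longrightarrow> \<gamma> \<in> U a \<Longrightarrow> \<pi> (\<sigma> a \<gamma>) = \<gamma>"
    and transitions: "\<And>a a'. a \<in> I \<Longrightarrow> a' \<in> I \<Longrightarrow>
        smooth_map (open_submfd (gtop G, A) (U a \<inter> U a')) (prod_mfd circle_mfd (unit_top G, A0))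
          (\<lambda>\<gamma>. inv_into (circle \<times> units G) \<iota> (mul E (\<sigma> a \<gamma>) (ginv E (\<sigma> a' \<gamma>))))"
  shows "(\<exists>!B. twist_structure G A E \<iota> \<pi> I U \<sigma> B) \<and>
    (\<forall>B. twist_structure G A E \<iota> \<pi> I U \<sigma> B \<longrightarrow>
       embedded_submanifold (gtop E, B) (preim E \<pi> (units G)) \<and>
       (\<forall>(S :: 's mfd) p act f.
          smooth_principal_circle_bundle S (gtop G, A) p act \<and>
          continuous_map (gtop E) (fst S) f \<and>
          (\<forall>e\<in>arrows E. p (f e) = \<pi> e) \<and>
          (\<forall>z\<in>circle. \<forall>e\<in>arrows E. f (twist_action E \<iota> \<pi> z e) = act z (f e)) \<longrightarrow>
          (smooth_map (gtop E, B) S f \<longleftrightarrow>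
             (\<forall>a\<in>I. smooth_map (open_submfd (gtop G, A) (U a)) S (\<lambda>\<gamma>. f (\<sigma> a \<gamma>))))))"
proof -
  have GA: "smooth_manifold (gtop G, A)" and G0: "smooth_manifold (unit_top G, A0)"
    and emb: "smooth_embedding (unit_top G, A0) (gtop G, A) (\<lambda>u. u)"
    using lie by (simp_all add: lie_groupoid_def)
  interpret tw: twist G E \<iota> \<pi> by unfold_locales (rule twist)
  have U_open: "openin (gtop G) (U a)" if "a \<in> I" for a
    using atlas(1) that chart_of_openin[of "gtop G" "(n a, U a, \<phi> a)"] by (simp add: smooth_atlas_def)
  interpret twist_sections G E \<iota> \<pi> A I U \<sigma>
  proof
    show "smooth_manifold (gtop G, A)" by (rule GA)
    show "openin (gtop G) (U a)" if "a \<in> I" for a by (rule U_open[OF that])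
    show "(\<Union>a\<in>I. U a) = arrows G" using atlas(1) by (simp add: smooth_atlas_def)
    show "continuous_map (subtopology (gtop G) (U a)) (gtop E) (\<sigma> a)" if "a \<in> I" for a
      using sections(1)[OF that] by (simp add: continuous_map_in_subtopology)
    show "\<pi> (\<sigma> a \<gamma>) = \<gamma>" if "a \<in> I" "\<gamma> \<in> U a" for a \<gamma> by (rule sections(2)[OF that])
    show "smooth_map (open_submfd (gtop G, A) (U a \<inter> U b)) circle_mfd (\<lambda>\<gamma>. tw.quot (\<sigma> a \<gamma>) (\<sigma> b \<gamma>))"
      if ab: "a \<in> I" "b \<in> I" for a b
    proof -
      have "smooth_manifold (open_submfd (gtop G, A) (U a \<inter> U b))"
        using U_open ab by (intro smooth_manifold_open_submfd[OF GA]) auto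
      then show ?thesis
        unfolding tw.quot_def
        by (rule smooth_map_compose[OF _ smooth_manifold_prod[OF smooth_manifold_circle G0]
              transitions[OF ab] smooth_map_fst[OF smooth_manifold_circle G0]])
    qed
  qed
  have "embedded_structure (gtop G, A) (units G) A0"
    using G0 emb tw.G_laws(1) by (auto simp: embedded_structure_def)
  then have sub: "embedded_submanifold (gtop E, B) (preim E \<pi> (units G))"
    if "twist_structure G A E \<iota> \<pi> I U \<sigma> B" for B
    using preim_embedded_submanifold[OF twist_structure_imp_parametrised_by[OF that]] by blast
  show ?thesis
  proof (intro conjI allI impI)
    show "\<exists>!B. twist_structure G A E \<iota> \<pi> I U \<sigma> B" by (rule ex1_twist_structure)
  next
    fix B assume B: "twist_structure G A E \<iota> \<pi> I U \<sigma> B"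
    show "embedded_submanifold (gtop E, B) (preim E \<pi> (units G))" by (rule sub[OF B])
  next
    fix B and S :: "'s mfd" and p act f
    assume B: "twist_structure G A E \<iota> \<pi> I U \<sigma> B"
      and *: "smooth_principal_circle_bundle S (gtop G, A) p act \<and>
          continuous_map (gtop E) (fst S) f \<and>
          (\<forall>e\<in>arrows E. p (f e) = \<pi> e) \<and>
          (\<forall>z\<in>circle. \<forall>e\<in>arrows E. f (twist_action E \<iota> \<pi> z e) = act z (f e))"
    show "smooth_map (gtop E, B) S f \<longleftrightarrow>
        (\<forall>a\<in>I. smooth_map (open_submfd (gtop G, A) (U a)) S (\<lambda>\<gamma>. f (\<sigma> a \<gamma>)))"
      by (rule smooth_map_iff_smooth_on_sections[OF B]) (use * in blast)+
  qed
qed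

end
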